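(* Let $\{X_n\}_{n=-\infty}^{\infty}$ be a stationary and ergodic time series taking values in a finite alphabet $\mathcal{X}$, and let $g:\mathcal{X}\to(-\infty,\infty)$ be arbitrary. Set $K_n=\max(1,\lfloor 0.1\log_{|\mathcal{X}|} n\rfloor)$ and $J_n=\max(1,\lceil n^{0.5}\rceil)$, and let $g_n$ be the estimator defined in the context (which depends only on $X_0^n$). Then: (A) if the conditional expectation $G(X_{-\infty}^0)=E(g(X_1)\mid X_{-\infty}^0)$ is continuous with respect to the metric $d^*$, then $$\lim_{n\to\infty}\left|g_n-E(g(X_{n+1})\mid X_0^n)\right|=0 \quad\text{almost surely;}$$ (B) without any continuity assumption, $$\lim_{n\to\infty}\frac1n\sum_{i=0}^{n-1}\left|g_i-E(g(X_{i+1})\mid X_0^i)\right|=0\quad\text{almost surely;}$$ (C) without any continuity assumption, for every $\epsilon>0$, $$\lim_{n\to\infty}P\left(\left|g_n-E(g(X_{n+1})\mid X_0^n)\right|>\epsilon\right)=0.$$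
   Context: Notation: $X_m^n=(X_m,\dots,X_n)$ for $m\le n$ (empty if $m>n$). For $k\ge1$ and $n\ge 0$ define stopping times $\tau^k_0(n)=0$ and, for $i\ge1$, $\tau^k_i(n)=\min\{t>\tau^k_{i-1}(n): X_{n-k+1-t}^{n-t}=X_{n-k+1}^n\}$ (the successive backward recurrence times of the block $X_{n-k+1}^n$). Define $\kappa_n=\max\{1\le k\le K_n: \tau^k_{J_n}(n)\le n-k+1\}$ if such $k$ exists and $\kappa_n=0$ otherwise (the longest block length up to $K_n$ whose final block occurs at least $J_n$ times earlier within $X_0^n$). Define $\lambda_n=\max\{j\ge1:\tau^{\kappa_n}_j(n)\le n-\kappa_n+1\}$ if $\kappa_n>0$ and $\lambda_n=0$ otherwise. The estimator is $g_0=0$ and, for $n\ge1$, $g_n=\frac{1}{\lambda_n}\sum_{i=1}^{\lambda_n} g(X_{n-\tau^{\kappa_n}_i(n)+1})$ if $\kappa_n>0$, and $g_n=0$ otherwise. Let $\mathcal{X}^{*-}$ be the set of one-sided sequences $(\dots,x_{-1},x_0)$ with $x_i\in\mathcal{X}$, and define $G:\mathcal{X}^{*-}\to\mathbb{R}$ by $G(x_{-\infty}^0)=E(g(X_1)\mid X_{-\infty}^0=x_{-\infty}^0)$ (defined almost surely). The metric on $\mathcal{X}^{*-}$ is $d^*(x_{-\infty}^0,y_{-\infty}^0)=\sum_{i=0}^\infty 2^{-i-1}1_{\{x_{-i}\ne y_{-i}\}}$. $G$ is called continuous if some version of it is continuous on $\mathcal{X}^{*-}$ with respect to $d^*$. 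*)

theory Defs
  imports "HOL-Probability.Probability"
begin

abbreviation path_space :: "(int \<Rightarrow> 'x) measure" where
  "path_space \<equiv> PiM UNIV (\<lambda>_. count_space UNIV)"

definition stationary_proc :: "'a measure \<Rightarrow> (int \<Rightarrow> 'a \<Rightarrow> 'x) \<Rightarrow> bool" where
  "stationary_proc M X \<longleftrightarrow>
     (\<forall>k::int. distr M path_space (\<lambda>\<omega> i. X (i + k) \<omega>) = distr M path_space (\<lambda>\<omega> i. X i \<omega>))"

definition ergodic_proc :: "'a measure \<Rightarrow> (int \<Rightarrow> 'a \<Rightarrow> 'x) \<Rightarrow> bool" where
  "ergodic_proc M X \<longleftrightarrow>
     (\<forall>B \<in> sets (path_space :: (int \<Rightarrow> 'x) measure).
        (\<lambda>y i. y (i + 1)) -` B = B \<longrightarrow>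
        measure M {\<omega> \<in> space M. (\<lambda>i. X i \<omega>) \<in> B} \<in> {0, 1})"

definition past_alg :: "'a measure \<Rightarrow> (int \<Rightarrow> 'a \<Rightarrow> 'x) \<Rightarrow> nat \<Rightarrow> 'a measure" where
  "past_alg M X n = sigma (space M) {X i -` A \<inter> space M | i A. 0 \<le> i \<and> i \<le> int n}"

definition inf_past_alg :: "'a measure \<Rightarrow> (int \<Rightarrow> 'a \<Rightarrow> 'x) \<Rightarrow> 'a measure" where
  "inf_past_alg M X = sigma (space M) {X i -` A \<inter> space M | i A. i \<le> 0}"

definition cond_pred :: "'a measure \<Rightarrow> (int \<Rightarrow> 'a \<Rightarrow> 'x) \<Rightarrow> ('x \<Rightarrow> real) \<Rightarrow> nat \<Rightarrow> 'a \<Rightarrow> real" where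
  "cond_pred M X g n = real_cond_exp M (past_alg M X n) (\<lambda>\<omega>. g (X (int n + 1) \<omega>))"

text \<open>The metric d* on one-sided sequences; a sequence (..., x_{-1}, x_0) is
  represented by y :: nat => 'x with y i = x_{-i}.\<close>
definition dstar :: "(nat \<Rightarrow> 'x) \<Rightarrow> (nat \<Rightarrow> 'x) \<Rightarrow> real" where
  "dstar x y = (\<Sum>i. (1/2) ^ (i + 1) * (if x i \<noteq> y i then 1 else 0))"

definition G_continuous :: "'a measure \<Rightarrow> (int \<Rightarrow> 'a \<Rightarrow> 'x) \<Rightarrow> ('x \<Rightarrow> real) \<Rightarrow> bool" where
  "G_continuous M X g \<longleftrightarrow>
     (\<exists>G :: (nat \<Rightarrow> 'x) \<Rightarrow> real.
        (\<forall>y. \<forall>e>0. \<exists>d>0. \<forall>z. dstar y z < d \<longrightarrow> \<bar>G z - G y\<bar> < e) \<and>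
        (AE \<omega> in M. G (\<lambda>i. X (- int i) \<omega>) =
                     real_cond_exp M (inf_past_alg M X) (\<lambda>\<omega>. g (X 1 \<omega>)) \<omega>))"

definition K_par :: "nat \<Rightarrow> nat \<Rightarrow> nat" where
  "K_par a n = max 1 (nat \<lfloor>0.1 * log (real a) (real n)\<rfloor>)"

definition J_par :: "nat \<Rightarrow> nat" where
  "J_par n = max 1 (nat \<lceil>sqrt (real n)\<rceil>)"

text \<open>Backward recurrence times t of the block x_{n-k+1}^n that occur within x_0^n,
  i.e. the set of all values tau^k_i(n), i \<ge> 1, with tau^k_i(n) \<le> n-k+1.\<close>
definition rec_times :: "(int \<Rightarrow> 'x) \<Rightarrow> nat \<Rightarrow> nat \<Rightarrow> nat set" where
  "rec_times x k n = {t. 1 \<le> t \<and> int t \<le> int n - int k + 1 \<and>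
      (\<forall>j<k. x (int n - int k + 1 - int t + int j) = x (int n - int k + 1 + int j))}"

definition kappa :: "nat \<Rightarrow> (int \<Rightarrow> 'x) \<Rightarrow> nat \<Rightarrow> nat" where
  "kappa a x n = (let S = {k. 1 \<le> k \<and> k \<le> K_par a n \<and> J_par n \<le> card (rec_times x k n)}
                  in if S = {} then 0 else Max S)"

definition g_est :: "('x::finite \<Rightarrow> real) \<Rightarrow> (int \<Rightarrow> 'x) \<Rightarrow> nat \<Rightarrow> real" where
  "g_est g x n =
     (if n = 0 then 0 else
      let k = kappa CARD('x) x n in
      if k = 0 then 0 else
      (\<Sum>t \<in> rec_times x k n. g (x (int n - int t + 1))) / real (card (rec_times x k n)))"

end

(*
  Everything is transported to path space, where the law P of the process is shift invariant.
  Write T for the shift, G_s(x) = E(g(x_1) | x_{-s},...,x_0) and C_s = G_s o T^s, which is the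
  conditional expectation to be estimated at time s.

  (1) The increments g(x_{s+1}) - C_s along the occurrences of a fixed word are martingale
  differences.  An exponential supermartingale bounds the probability that their average over N
  occurrences exceeds e, for some N >= J_n, by exp(-c J_n); there are only about n^{0.2} words of
  length at most K_n, so by Borel-Cantelli g_n is asymptotic to the average of C_s over the
  earlier occurrences s of the current block.

  (2) Let D_k = sup_{i >= k} |G_i - G_k|.  By L2 martingale convergence and Kolmogorov's
  inequality E D_k -> 0.  As G_k depends on k+1 coordinates only, once kappa_n > k the error is at
  most D_k o T^n plus the average of D_k o T^s over the same occurrences s, up to the error of (1).

  (3) For (A), continuity is uniform by compactness and makes D_k uniformly small, and the maximal
  ergodic lemma shows that every word of positive probability has positive lower frequency, so
  kappa_n -> infinity.

  (4) For (B), all but o(n) times i < n have kappa_i = K_i: every word accounts for at most J_n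
  occurrences with fewer than J_n predecessors, and there are few words.  For words of one
  fixed length a covering argument bounds the number of times at which the average of D_k over the
  earlier occurrences exceeds e by (2/e) times the sum of D_k o T^s over s < n, and this sum is
  controlled by the maximal ergodic lemma.  K_i takes boundedly many values on [eta n, n).
  For (C), the same two counting bounds are averaged over shifts of a window of length n.
*)
theory Submission
  imports Defs "HOL-Real_Asymp.Real_Asymp"
begin

section \<open>Counting along occurrences of a label\<close>

text \<open>The obstacle is that \<open>kappa\<close> is chosen from the data and that
  \<open>K_par\<close> grows, so no limit theorem for one fixed word applies to the estimator. Two
  devices give uniformity in the word. Against noise, the deviation bound is exponential in J_n
  \<ge> sqrt n, while the words to be controlled number only a power of n. Against bias, the earlier
  occurrences of the current block are a selected sample of times, over which D_k o T^s need not
  have small average even if its average over all s < n is small; the covering bound charges the bad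
  times against the full sum, once for each block length and regardless of the number of words. It
  says nothing about an individual time, which is why (B) and (C) result without continuity, whereas
  (A) takes D_k uniformly small. The constants are tied together by 0.1 + 0.1 + 0.5 < 1: lengths up
  to K_n, words of one length and J_n predecessors give O(n^0.7) times with too few earlier
  occurrences. The frequency statements needed are one-sided, an upper bound for averages of D_k and
  a lower bound for counts of words, and the maximal ergodic lemma supplies both.\<close>

lemma card_rare_le:
  fixes l :: "nat \<Rightarrow> 'c" and a :: "nat \<Rightarrow> nat"
  assumes "finite I" "finite L" "l ` I \<subseteq> L"
    and start: "\<And>i i'. i \<in> I \<Longrightarrow> i' \<in> I \<Longrightarrow> a i \<le> i'"
  shows "card {i \<in> I. card {s. a i \<le> s \<and> s < i \<and> l s = l i} < J} \<le> card L * J"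
proof -
  let ?S = "\<lambda>i. {s. a i \<le> s \<and> s < i \<and> l s = l i}"
  let ?B = "\<lambda>c. {i \<in> I. l i = c \<and> card (?S i) < J}"
  have B: "card (?B c) \<le> J" for c
  proof (cases "?B c = {}")
    case False
    have fin: "finite (?B c)" using assms(1) by simp
    \<comment> \<open>By \<open>start\<close>, the window of the last bad index with label c
      contains all other bad indices with that label, so there are fewer than J of these.\<close>
    define i where "i = Max (?B c)"
    have i: "i \<in> ?B c" unfolding i_def using fin False by (rule Max_in)
    have "?B c - {i} \<subseteq> ?S i"
    proof
      fix j assume j: "j \<in> ?B c - {i}"
      then have "j \<le> i" unfolding i_def using fin by (intro Max_ge) auto
      with j i start show "j \<in> ?S i" by auto
    qed
    then have "card (?B c - {i}) \<le> card (?S i)"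
      by (rule card_mono[rotated]) (auto intro: finite_subset[of _ "{..<i}"])
    then have "card (?B c - {i}) < J" using i by (elim order.strict_trans1) blast
    then show ?thesis using card_Diff_singleton[OF i] by linarith
  next
    case True
    then show ?thesis by (metis card.empty le0)
  qed
  have "card {i \<in> I. card (?S i) < J} \<le> card (\<Union>c\<in>L. ?B c)"
    using assms by (intro card_mono) auto
  also have "\<dots> \<le> (\<Sum>c\<in>L. card (?B c))"
    using assms by (intro card_UN_le)
  also have "\<dots> \<le> card L * J"
    using B sum_bounded_above[of L "\<lambda>c. card (?B c)" J] by simp
  finally show ?thesis .
qed

text \<open>Strip bad windows from the right. A bad index lies outside its own nonempty window, whence
  the factor 2.\<close>
lemma card_maximal_single:
  fixes d :: "nat \<Rightarrow> real" and a :: "nat \<Rightarrow> nat"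
  assumes d: "\<And>s. 0 \<le> d s" and "e > 0"
    and B: "\<And>i. i \<in> B \<Longrightarrow> i \<in> O' \<and>
      (\<Sum>s\<in>O' \<inter> {a i..<i}. d s) > e * real (card (O' \<inter> {a i..<i}))"
  shows "e * real (card (B \<inter> {..<q})) \<le> 2 * (\<Sum>s\<in>O' \<inter> {..<q}. d s)"
proof (induction q rule: less_induct)
  case (less q)
  show ?case
  proof (cases q)
    case (Suc i)
    show ?thesis
    proof (cases "i \<in> B")
      case False
      then have "B \<inter> {..<q} = B \<inter> {..<i}" using Suc by (auto simp: less_Suc_eq)
      moreover have "(\<Sum>s\<in>O' \<inter> {..<i}. d s) \<le> (\<Sum>s\<in>O' \<inter> {..<q}. d s)"
        using Suc d by (intro sum_mono2) auto
      ultimately show ?thesis using less[of i] Suc by simp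
    next
      case True
      let ?W = "O' \<inter> {a i..<i}"
      have W: "(\<Sum>s\<in>?W. d s) > e * real (card ?W)" using B[OF True] by simp
      have ne: "?W \<noteq> {}" using W by auto
      then have "card ?W \<ge> 1" by (simp add: Suc_leI card_gt_0_iff)
      from ne have ai: "a i < i" by auto
      have BO: "B \<subseteq> O'" using B by auto
      have "B \<inter> {..<q} \<subseteq> B \<inter> {..<a i} \<union> insert i ?W"
        using BO Suc by auto
      then have "card (B \<inter> {..<q}) \<le> card (B \<inter> {..<a i} \<union> insert i ?W)"
        by (intro card_mono) auto
      also have "\<dots> \<le> card (B \<inter> {..<a i}) + card (insert i ?W)" by (rule card_Un_le)
      also have "\<dots> \<le> card (B \<inter> {..<a i}) + 2 * card ?W"
        using \<open>card ?W \<ge> 1\<close> card_insert_le_m1[of 1] by (simp add: card_insert_if)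
      finally have "real (card (B \<inter> {..<q})) \<le> real (card (B \<inter> {..<a i})) + 2 * real (card ?W)"
        by linarith
      then have "e * real (card (B \<inter> {..<q})) \<le> e * (real (card (B \<inter> {..<a i})) + 2 * real (card ?W))"
        using \<open>e > 0\<close> by (intro mult_left_mono) auto
      then have "e * real (card (B \<inter> {..<q})) \<le> e * real (card (B \<inter> {..<a i})) + 2 * (e * real (card ?W))"
        by (simp add: algebra_simps)
      also have "\<dots> \<le> 2 * (\<Sum>s\<in>O' \<inter> {..<a i}. d s) + 2 * (\<Sum>s\<in>?W. d s)"
        using less[of "a i"] ai Suc W by simp
      also have "\<dots> = 2 * (\<Sum>s\<in>O' \<inter> {..<a i} \<union> ?W. d s)"
        by (subst sum.union_disjoint) auto
      also have "\<dots> \<le> 2 * (\<Sum>s\<in>O' \<inter> {..<q}. d s)"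
        using Suc ai d by (intro mult_left_mono sum_mono2) auto
      finally show ?thesis .
    qed
  qed simp
qed

text \<open>The label classes are disjoint, so the bounds for the single labels add up to the full
  sum of \<open>d\<close>. The result is independent of the number of labels, which matters because
  the labels will be words of growing length.\<close>

lemma card_maximal_le:
  fixes l :: "nat \<Rightarrow> 'c" and a :: "nat \<Rightarrow> nat" and d :: "nat \<Rightarrow> real"
  assumes d: "\<And>s. 0 \<le> d s" and e: "e > 0" and I: "I \<subseteq> {..<q}"
  shows "e * real (card {i \<in> I. (\<Sum>s | a i \<le> s \<and> s < i \<and> l s = l i. d s) >
            e * real (card {s. a i \<le> s \<and> s < i \<and> l s = l i})})
         \<le> 2 * (\<Sum>s<q. d s)"
proof -
  let ?S = "\<lambda>i. {s. a i \<le> s \<and> s < i \<and> l s = l i}"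
  let ?L = "l ` {..<q}"
  let ?O = "\<lambda>c. {s. l s = c}"
  let ?B = "\<lambda>c. {i \<in> I. l i = c \<and> sum d (?S i) > e * real (card (?S i))}"
  have S: "?O c \<inter> {a i..<i} = ?S i" if "l i = c" for i c using that by auto
  have B': "e * real (card (?B c \<inter> {..<q})) \<le> 2 * (\<Sum>s\<in>?O c \<inter> {..<q}. d s)" for c
  proof (rule card_maximal_single[of d e _ _ a])
    fix i assume "i \<in> ?B c"
    then have i: "l i = c" "sum d (?S i) > e * real (card (?S i))"
      unfolding mem_Collect_eq by blast+
    then show "i \<in> ?O c \<and> (\<Sum>s\<in>?O c \<inter> {a i..<i}. d s) > e * real (card (?O c \<inter> {a i..<i}))"
      using i unfolding S[OF i(1)] mem_Collect_eq by blast
  qed (use d e in auto)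
  have B: "e * real (card (?B c)) \<le> 2 * (\<Sum>s\<in>?O c \<inter> {..<q}. d s)" for c
  proof -
    have "?B c \<inter> {..<q} = ?B c" using I by blast
    then show ?thesis using B'[of c] by simp
  qed
  have "card {i \<in> I. sum d (?S i) > e * real (card (?S i))} \<le> card (\<Union>c\<in>?L. ?B c)"
  proof (rule card_mono)
    have "finite I" using I finite_subset by blast
    then show "finite (\<Union>c\<in>?L. ?B c)" by simp
    show "{i \<in> I. sum d (?S i) > e * real (card (?S i))} \<subseteq> (\<Union>c\<in>?L. ?B c)"
      using I by blast
  qed
  also have "\<dots> \<le> (\<Sum>c\<in>?L. card (?B c))" by (intro card_UN_le) auto
  finally have "real (card {i \<in> I. sum d (?S i) > e * real (card (?S i))}) \<le> real (\<Sum>c\<in>?L. card (?B c))"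
    by linarith
  then have "e * real (card {i \<in> I. sum d (?S i) > e * real (card (?S i))})
      \<le> e * real (\<Sum>c\<in>?L. card (?B c))"
    using e by (intro mult_left_mono) auto
  also have "\<dots> = (\<Sum>c\<in>?L. e * real (card (?B c)))" by (simp add: sum_distrib_left)
  also have "\<dots> \<le> (\<Sum>c\<in>?L. 2 * (\<Sum>s\<in>?O c \<inter> {..<q}. d s))" by (intro sum_mono B)
  also have "\<dots> = 2 * (\<Sum>c\<in>?L. \<Sum>s | s \<in> {..<q} \<and> l s = c. d s)"
    by (simp add: sum_distrib_left Int_def conj_commute)
  also have "\<dots> = 2 * (\<Sum>s<q. d s)"
    by (subst sum.group) auto
  finally show ?thesis .
qed

section \<open>The estimator as an average over earlier occurrences of the current block\<close>

definition sh :: "int \<Rightarrow> (int \<Rightarrow> 'x) \<Rightarrow> int \<Rightarrow> 'x" where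
  "sh m y = (\<lambda>i. y (i + m))"

text \<open>Blocks are listed backwards, latest symbol first, so that shorter suffixes are prefixes.\<close>
definition blk :: "(int \<Rightarrow> 'x) \<Rightarrow> nat \<Rightarrow> nat \<Rightarrow> 'x list" where
  "blk x k s = map (\<lambda>j. x (int s - int j)) [0..<k]"

text \<open>An occurrence is indexed by its end position s instead of the backward time t = n - s,
  so that the symbol following it is x_{s+1}. The condition \<open>k - 1 \<le> s\<close> keeps the
  occurrence within the coordinates \<ge> 0.\<close>

definition occ :: "(int \<Rightarrow> 'x) \<Rightarrow> nat \<Rightarrow> nat \<Rightarrow> nat set" where
  "occ x k n = {s. k - 1 \<le> s \<and> s < n \<and> blk x k s = blk x k n}"

lemma sh_sh [simp]: "sh m (sh n y) = sh (m + n) y"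
  by (auto simp: sh_def algebra_simps)

lemma sh_0 [simp]: "sh 0 y = y"
  by (simp add: sh_def)

lemma blk_sh: "blk (sh (int i) y) k s = blk y k (i + s)"
  by (auto simp: blk_def sh_def algebra_simps)

lemma length_blk [simp]: "length (blk x k s) = k"
  by (simp add: blk_def)

lemma blk_eq_iff: "blk x k s = blk y k t \<longleftrightarrow> (\<forall>j<k. x (int s - int j) = y (int t - int j))"
  by (simp add: blk_def list_eq_iff_nth_eq)

lemma blk_eq_mono: "blk x k s = blk y k t \<Longrightarrow> k' \<le> k \<Longrightarrow> blk x k' s = blk y k' t"
  by (auto simp: blk_eq_iff)

lemma bij_betw_rec_times:
  assumes "k \<ge> 1"
  shows "bij_betw (\<lambda>t. n - t) (rec_times x k n) (occ x k n)"
proof (rule bij_betwI[where g = "\<lambda>s. n - s"])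
  \<comment> \<open>\<open>rec_times\<close> reads a block forwards and \<open>blk\<close> reads it
    backwards; the reflection of j to k - 1 - j identifies the two.\<close>
  have rev: "(\<forall>j<k. P (int k - 1 - int j)) \<longleftrightarrow> (\<forall>j<k. P (int j))" for P
  proof safe
    fix j assume *: "\<forall>j<k. P (int k - 1 - int j)" "j < k"
    have "k - 1 - j < k" using *(2) by simp
    then have "P (int k - 1 - int (k - 1 - j))" using *(1) by blast
    moreover have "int k - 1 - int (k - 1 - j) = int j" using *(2) by linarith
    ultimately show "P (int j)" by simp
  next
    fix j assume *: "\<forall>j<k. P (int j)" "j < k"
    have "k - 1 - j < k" using *(2) by simp
    then have "P (int (k - 1 - j))" using *(1) by blast
    moreover have "int (k - 1 - j) = int k - 1 - int j" using *(2) by linarith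
    ultimately show "P (int k - 1 - int j)" by metis
  qed
  have key: "(\<forall>j<k. x (int n - int k + 1 - int t + int j) = x (int n - int k + 1 + int j))
      \<longleftrightarrow> (\<forall>j<k. x (int n - int t - int j) = x (int n - int j))" for t
    using rev[of "\<lambda>j. x (int n - int k + 1 - int t + j) = x (int n - int k + 1 + j)"]
    by (simp add: algebra_simps)
  show "(\<lambda>t. n - t) \<in> rec_times x k n \<rightarrow> occ x k n"
    using assms by (auto simp: rec_times_def occ_def blk_eq_iff key of_nat_diff)
  show "(\<lambda>s. n - s) \<in> occ x k n \<rightarrow> rec_times x k n"
  proof
    fix s assume s: "s \<in> occ x k n"
    then have "\<forall>j<k. x (int n - int (n - s) - int j) = x (int n - int j)"
      by (auto simp: occ_def blk_eq_iff of_nat_diff)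
    then show "n - s \<in> rec_times x k n"
      using s assms unfolding rec_times_def mem_Collect_eq key by (auto simp: occ_def)
  qed
qed (use assms in \<open>auto simp: occ_def rec_times_def\<close>)

lemma card_rec_times: "k \<ge> 1 \<Longrightarrow> card (rec_times x k n) = card (occ x k n)"
  by (rule bij_betw_same_card[OF bij_betw_rec_times])

lemma sum_rec_times:
  assumes "k \<ge> 1"
  shows "(\<Sum>t\<in>rec_times x k n. f (x (int n - int t + 1))) = (\<Sum>s\<in>occ x k n. f (x (int s + 1)))"
  using assms
  by (intro sum.reindex_bij_betw[OF bij_betw_rec_times, THEN trans[rotated]] sum.cong)
     (auto simp: rec_times_def of_nat_diff)

lemma kappa_cases:
  "kappa a x n = 0 \<or> (1 \<le> kappa a x n \<and> kappa a x n \<le> K_par a n \<and> J_par n \<le> card (occ x (kappa a x n) n))"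
proof -
  let ?S = "{k. 1 \<le> k \<and> k \<le> K_par a n \<and> J_par n \<le> card (rec_times x k n)}"
  have "Max ?S \<in> ?S" if "?S \<noteq> {}"
    using that by (intro Max_in) auto
  then have "kappa a x n = 0 \<or> kappa a x n \<in> ?S"
    unfolding kappa_def Let_def by auto
  then show ?thesis
    by (auto simp: card_rec_times)
qed

lemma kappa_ge:
  assumes "1 \<le> k" "k \<le> K_par a n" "J_par n \<le> card (occ x k n)"
  shows "k \<le> kappa a x n"
proof -
  let ?S = "{k. 1 \<le> k \<and> k \<le> K_par a n \<and> J_par n \<le> card (rec_times x k n)}"
  have "k \<in> ?S" using assms by (simp add: card_rec_times)
  then show ?thesis by (auto simp: kappa_def Let_def intro: Max_ge)
qed

lemma kappa_le: "kappa a x n \<le> K_par a n"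
  using kappa_cases[of a x n] by auto

lemma J_par_pos: "J_par n \<ge> 1" by (simp add: J_par_def)
lemma K_par_pos: "K_par a n \<ge> 1" by (simp add: K_par_def)

lemma g_est_eq:
  fixes g :: "'x::finite \<Rightarrow> real"
  assumes "kappa CARD('x) x n > 0"
  shows "g_est g x n = (\<Sum>s\<in>occ x (kappa CARD('x) x n) n. g (x (int s + 1))) /
     real (card (occ x (kappa CARD('x) x n) n))"
proof -
  have "J_par n \<le> card (occ x (kappa CARD('x) x n) n)"
    using kappa_cases[of "CARD('x)" x n] assms by auto
  then have "n > 0" using J_par_pos[of n] by (auto simp: occ_def intro!: Nat.gr0I)
  then show ?thesis using assms
    by (simp add: g_est_def Let_def sum_rec_times card_rec_times)
qed

section \<open>Growth of J_n, of K_n and of the number of words\<close>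

lemma J_par_mono: "m \<le> n \<Longrightarrow> J_par m \<le> J_par n"
  unfolding J_par_def by (intro max.mono nat_mono ceiling_mono) auto

lemma J_par_le: "real (J_par n) \<le> sqrt (real n) + 1"
proof -
  have "real (nat \<lceil>sqrt (real n)\<rceil>) \<le> sqrt (real n) + 1"
    by (simp add: of_nat_nat) 
  then show ?thesis unfolding J_par_def by (auto simp: of_nat_max)
qed

lemma J_par_ge: "sqrt (real n) \<le> real (J_par n)"
  unfolding J_par_def by linarith

lemma K_par_mono: "m \<le> n \<Longrightarrow> m > 0 \<Longrightarrow> a \<ge> 1 \<Longrightarrow> K_par a m \<le> K_par a n"
  unfolding K_par_def
  by (intro max.mono nat_mono floor_mono)
     (auto simp: log_def divide_right_mono)

lemma K_par_tendsto:
  assumes "a \<ge> 2"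
  shows "eventually (\<lambda>n. k \<le> K_par a n) sequentially"
proof -
  have "eventually (\<lambda>n. real k \<le> 0.1 * (ln (real n) / ln (real a))) sequentially"
  proof -
    have "ln (real a) > 0" using assms by simp
    then have "filterlim (\<lambda>n::nat. 0.1 * (ln (real n) / ln (real a))) at_top sequentially"
      by real_asymp
    then show ?thesis by (simp add: filterlim_at_top)
  qed
  then show ?thesis
  proof eventually_elim
    case (elim n)
    then have "int k \<le> \<lfloor>0.1 * log (real a) (real n)\<rfloor>" by (simp add: log_def le_floor_iff)
    then show ?case by (auto simp: K_par_def)
  qed
qed

text \<open>The factor \<open>a\<close> pays for the lower cutoff at 1 in \<open>K_par\<close>, by
  K_n \<le> 1 + 0.1 log_a n.\<close>

lemma card_pow_K_par_le:
  assumes "a \<ge> 1" "n \<ge> 1"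
  shows "real (a ^ K_par a n) \<le> real a * real n powr 0.1"
proof (cases "a = 1")
  case True
  then show ?thesis using assms by (simp add: ge_one_powr_ge_zero)
next
  case False
  then have a: "real a > 1" using assms by simp
  let ?r = "0.1 * log (real a) (real n)"
  have r: "?r \<ge> 0" using a assms by (auto simp: zero_le_log_cancel_iff)
  have pw: "real a powr ?r = real n powr 0.1"
    using a assms by (simp add: powr_def log_def)
  have "real (K_par a n) \<le> 1 + ?r"
    unfolding K_par_def using r by (simp add: of_nat_max) linarith
  then have "real a powr real (K_par a n) \<le> real a powr (1 + ?r)"
    using a by (intro powr_mono) auto
  also have "\<dots> = real a * real n powr 0.1"
    using a pw by (simp add: powr_add)
  finally show ?thesis using a by (simp add: powr_realpow)
qed

text \<open>A union over the lengths 1, ..., K_n therefore costs at most one more factor of the size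
  of the number of words, whence the squares of n^0.1 further on. For \<open>a = 1\<close> the
  logarithm is 0 by division by zero, and K_n = 1.\<close>

lemma K_par_le_pow:
  assumes "a \<ge> 1"
  shows "K_par a n \<le> a ^ K_par a n"
proof (cases "a = 1")
  case True
  then show ?thesis by (simp add: K_par_def log_def)
next
  case False
  then have "2 ^ K_par a n \<le> a ^ K_par a n" using assms by (intro power_mono) auto
  moreover have "K_par a n < 2 ^ K_par a n" by simp
  ultimately show ?thesis by linarith
qed

text \<open>As log_a 2 \<le> 1, a factor 2^(10 m) in n adds at most m to 0.1 log_a n, and rounding
  adds at most 1. Hence the times within a constant factor of n use boundedly many block
  lengths.\<close>

lemma K_par_slow:
  assumes a: "a \<ge> 1" and i: "i \<ge> 1" "n \<le> i * 2 ^ (10 * m)" "n \<ge> 1"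
  shows "K_par a n \<le> K_par a i + m + 1"
proof (cases "a = 1")
  case True
  then show ?thesis by (simp add: K_par_def log_def)
next
  case False
  then have a2: "real a \<ge> 2" using a by simp
  have "log (real a) (real n) \<le> log (real a) (real i * 2 ^ (10 * m))"
  proof -
    have "real n \<le> real (i * 2 ^ (10 * m))" using i(2) by (simp only: of_nat_le_iff)
    then have "real n \<le> real i * 2 ^ (10 * m)" by simp
    then show ?thesis using a2 i by (intro log_mono) auto
  qed
  also have "\<dots> = log (real a) (real i) + 10 * real m * log (real a) 2"
    using a2 i by (subst log_mult) (auto simp: log_nat_power)
  also have "10 * real m * log (real a) 2 \<le> 10 * real m * 1"
    using a2 by (intro mult_left_mono) auto
  finally have le: "0.1 * log (real a) (real n) \<le> 0.1 * log (real a) (real i) + real m" by simp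
  then have "\<lfloor>0.1 * log (real a) (real n)\<rfloor> \<le> \<lfloor>0.1 * log (real a) (real i)\<rfloor> + int m + 1"
    by linarith
  then have "nat \<lfloor>0.1 * log (real a) (real n)\<rfloor> \<le> nat \<lfloor>0.1 * log (real a) (real i)\<rfloor> + m + 1"
    by linarith
  then show ?thesis unfolding K_par_def by linarith
qed

lemma card_words: "card {w::'x::finite list. length w = k} = CARD('x) ^ k"
  using card_lists_length_eq[of "UNIV::'x set" k] by simp

lemma finite_words [simp]: "finite {w::'x::finite list. length w = k}"
  using finite_lists_length_eq[of "UNIV::'x set" k] by simp

section \<open>Shift-invariant measures on path space\<close>

text \<open>Dependence on the coordinates in \<open>I\<close> takes the place of measurability with
  respect to the sigma-algebra they generate. For finite \<open>I\<close> and a finite alphabet it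
  forces a finite range, so measurability and integrability follow from it alone.\<close>

definition dep :: "int set \<Rightarrow> ((int \<Rightarrow> 'x) \<Rightarrow> 'b) \<Rightarrow> bool" where
  "dep I F \<longleftrightarrow> (\<forall>y z. (\<forall>i\<in>I. y i = z i) \<longrightarrow> F y = F z)"

lemma dep_eq: "dep I F \<Longrightarrow> (\<And>i. i \<in> I \<Longrightarrow> y i = z i) \<Longrightarrow> F y = F z"
  unfolding dep_def by blast

lemma dep_mono: "dep I F \<Longrightarrow> I \<subseteq> I' \<Longrightarrow> dep I' F"
  unfolding dep_def by blast

lemma dep_const: "dep I (\<lambda>y. c)"
  by (simp add: dep_def)

lemma dep_coord: "i \<in> I \<Longrightarrow> dep I (\<lambda>y. h (y i))"
  unfolding dep_def by metis

lemma dep_comp: "dep I F \<Longrightarrow> dep I (\<lambda>y. h (F y))"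
  unfolding dep_def by metis

lemma dep_comp2: "dep I F \<Longrightarrow> dep I F' \<Longrightarrow> dep I (\<lambda>y. h (F y) (F' y))"
  unfolding dep_def by metis

lemma dep_fun: "(\<And>j. dep I (F j)) \<Longrightarrow> dep I (\<lambda>y. h (\<lambda>j. F j y))"
  unfolding dep_def by (intro allI impI arg_cong[where f = h] ext) blast

lemma dep_sum: "(\<And>j. j \<in> A \<Longrightarrow> dep I (F j)) \<Longrightarrow> dep I (\<lambda>y. \<Sum>j\<in>A. F j y)"
  unfolding dep_def by (intro allI impI sum.cong) blast+

lemma dep_sh: "dep {a..b} F \<Longrightarrow> dep {a + m..b + m} (\<lambda>y. F (sh m y))"
  unfolding dep_def sh_def by simp

lemma dep_blk:
  assumes "\<And>j. j < k \<Longrightarrow> int s - int j \<in> I"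
  shows "dep I (\<lambda>y. blk y k s)"
  using assms unfolding dep_def blk_eq_iff by blast

lemma dep_measurable:
  fixes F :: "(int \<Rightarrow> 'x::finite) \<Rightarrow> 'b"
  assumes "finite I" "dep I F"
  shows "F \<in> measurable path_space (count_space UNIV)"
proof -
  have "(\<lambda>y. restrict y I) \<in> measurable path_space (PiM I (\<lambda>_. count_space (UNIV :: 'x set)))"
    by (intro measurable_restrict_subset) auto
  then have "(\<lambda>y. restrict y I) \<in> measurable path_space (count_space (PiE I (\<lambda>_. UNIV :: 'x set)))"
    using assms by (simp add: count_space_PiM_finite)
  then have "(\<lambda>y. F (restrict y I)) \<in> measurable path_space (count_space UNIV)"
    by (rule measurable_compose) simp
  moreover have "F (restrict y I) = F y" for y
    by (rule dep_eq[OF assms(2)]) simp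
  ultimately show ?thesis by simp
qed

lemma dep_finite_range:
  fixes F :: "(int \<Rightarrow> 'x::finite) \<Rightarrow> 'b"
  assumes "finite I" "dep I F"
  shows "finite (range F)"
proof -
  have "range F \<subseteq> F ` PiE I (\<lambda>_. UNIV)"
  proof
    fix r assume "r \<in> range F"
    then obtain y where "r = F y" by blast
    moreover have "F y = F (restrict y I)" by (rule dep_eq[OF assms(2)]) simp
    ultimately show "r \<in> F ` PiE I (\<lambda>_. UNIV)" by auto
  qed
  moreover have "finite (F ` PiE I (\<lambda>_. UNIV :: 'x set))"
    using assms by (intro finite_imageI finite_PiE) auto
  ultimately show ?thesis by (rule finite_subset)
qed

lemma sh_measurable [measurable]:
  "sh m \<in> measurable path_space (path_space :: (int \<Rightarrow> 'x) measure)"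
  unfolding sh_def
  by (rule measurable_PiM_single') (auto simp: space_PiM intro!: measurable_component_singleton)

section \<open>Conditional expectation given finitely many coordinates\<close>

definition cyl :: "int set \<Rightarrow> (int \<Rightarrow> 'x) \<Rightarrow> (int \<Rightarrow> 'x) set" where
  "cyl I y = {z. \<forall>i\<in>I. z i = y i}"

text \<open>The elementary conditional expectation given the coordinates in \<open>I\<close>, as a
  version defined everywhere and depending on exactly these coordinates. On null cylinders the
  quotient is 0.\<close>

definition cexp :: "(int \<Rightarrow> 'x) measure \<Rightarrow> int set \<Rightarrow> ((int \<Rightarrow> 'x) \<Rightarrow> real) \<Rightarrow> (int \<Rightarrow> 'x) \<Rightarrow> real" where
  "cexp P I F y = (\<integral>z. F z * indicator (cyl I y) z \<partial>P) / measure P (cyl I y)"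

lemma cyl_cong: "(\<And>i. i \<in> I \<Longrightarrow> y i = z i) \<Longrightarrow> cyl I y = cyl I z"
  unfolding cyl_def by auto

lemma dep_cyl: "dep I (\<lambda>y. cyl I y)"
  unfolding dep_def by (intro allI impI cyl_cong) blast

lemma dep_cexp: "dep I (cexp P I F)"
  unfolding cexp_def by (rule dep_comp[OF dep_cyl])

locale path_measure = prob_space P for P :: "(int \<Rightarrow> 'x::finite) measure" +
  assumes sets_P [measurable_cong]: "sets P = sets path_space"
begin

lemma space_P [simp]: "space P = UNIV"
  using sets_eq_imp_space_eq[OF sets_P] by (simp add: space_PiM)

lemma dep_meas:
  assumes "finite I" "dep I F"
  shows "F \<in> measurable P (count_space UNIV)"
  using dep_measurable[OF assms] by (simp add: measurable_cong_sets[OF sets_P refl])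

lemma dep_borel:
  fixes F :: "_ \<Rightarrow> 'b::topological_space"
  assumes "finite I" "dep I F"
  shows "F \<in> borel_measurable P"
  using measurable_compose[OF dep_meas[OF assms], of "\<lambda>x. x" borel] by simp

lemma dep_integrable:
  fixes F :: "_ \<Rightarrow> real"
  assumes "finite I" "dep I F"
  shows "integrable P F"
proof -
  have "finite ((\<lambda>x. \<bar>x\<bar>) ` range F)" using dep_finite_range[OF assms] by simp
  then have "\<bar>F y\<bar> \<le> Max ((\<lambda>x. \<bar>x\<bar>) ` range F)" for y by (intro Max_ge) auto
  then show ?thesis
    by (intro integrable_const_bound[where B = "Max ((\<lambda>x. \<bar>x\<bar>) ` range F)"] dep_borel[OF assms]) auto
qed

lemma dep_sets:
  assumes "finite I" "dep I Q"
  shows "{y. Q y} \<in> sets P"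
  using dep_meas[OF assms] by (simp add: pred_def[symmetric] pred_def)

lemma cyl_sets:
  assumes "finite I"
  shows "cyl I y \<in> sets P"
proof -
  have "dep I (\<lambda>z. \<forall>i\<in>I. z i = y i)" unfolding dep_def by auto
  then show ?thesis using dep_sets[OF assms] unfolding cyl_def by blast
qed

text \<open>The cylinders of extensional \<open>w\<close> partition the space, \<open>y\<close>
  lying in that of \<open>restrict y I\<close> only, and \<open>H\<close> is constant on each of
  them.\<close>

lemma integral_cyl_decomp:
  fixes F H :: "(int \<Rightarrow> 'x) \<Rightarrow> real"
  assumes I: "finite I" and F: "integrable P F" and H: "dep I H"
  shows "(\<integral>y. F y * H y \<partial>P) =
    (\<Sum>w\<in>PiE I (\<lambda>_. UNIV). H w * (\<integral>y. F y * indicator (cyl I w) y \<partial>P))"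
proof -
  let ?W = "PiE I (\<lambda>_. UNIV :: 'x set)"
  have fin: "finite ?W" using I by (intro finite_PiE) auto
  have dec: "F y * H y = (\<Sum>w\<in>?W. H w * (F y * indicator (cyl I w) y))" for y
  proof -
    have "y \<in> cyl I w \<longleftrightarrow> w = restrict y I" if "w \<in> ?W" for w
      using that by (auto simp: cyl_def PiE_def extensional_def restrict_def)
    then have "(\<Sum>w\<in>?W. H w * (F y * indicator (cyl I w) y)) =
        (\<Sum>w\<in>?W. if w = restrict y I then H (restrict y I) * F y else 0)"
      by (intro sum.cong) (auto simp: indicator_def)
    also have "\<dots> = H (restrict y I) * F y"
      using fin by (subst sum.delta) auto
    also have "H (restrict y I) = H y" by (rule dep_eq[OF H]) simp
    finally show ?thesis by simp
  qed
  show ?thesis unfolding dec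
    using F cyl_sets[OF I]
    by (subst Bochner_Integration.integral_sum) (auto intro!: integrable_mult_right integrable_mult_indicator[of _ _ F, simplified mult.commute[of _ "F _"] real_scaleR_def])
qed

text \<open>This is the defining property of conditional expectation. Both sides split over
  cylinders; on those of positive probability the quotient in \<open>cexp\<close> cancels, and the
  null ones contribute nothing.\<close>

lemma integral_cexp:
  assumes I: "finite I" and F: "integrable P F" and H: "dep I H"
  shows "(\<integral>y. F y * H y \<partial>P) = (\<integral>y. cexp P I F y * H y \<partial>P)"
proof -
  let ?W = "PiE I (\<lambda>_. UNIV :: 'x set)"
  have "(\<integral>y. cexp P I F y * H y \<partial>P) = (\<integral>y. 1 * (cexp P I F y * H y) \<partial>P)" by simp
  also have "\<dots> = (\<Sum>w\<in>?W. (cexp P I F w * H w) * (\<integral>y. 1 * indicator (cyl I w) y \<partial>P))"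
    by (rule integral_cyl_decomp[OF I _ dep_comp2[OF dep_cexp H]]) simp
  also have "\<dots> = (\<Sum>w\<in>?W. H w * (\<integral>y. F y * indicator (cyl I w) y \<partial>P))"
  proof (rule sum.cong)
    fix w
    show "(cexp P I F w * H w) * (\<integral>y. 1 * indicator (cyl I w) y \<partial>P) =
      H w * (\<integral>y. F y * indicator (cyl I w) y \<partial>P)"
    proof (cases "measure P (cyl I w) = 0")
      case True
      have "AE y in P. y \<notin> cyl I w"
        using True cyl_sets[OF I] by (intro AE_not_in) (simp add: null_sets_def emeasure_eq_measure)
      then have "(\<integral>y. F y * indicator (cyl I w) y \<partial>P) = 0"
        by (intro integral_eq_zero_AE) auto
      then show ?thesis using True by (simp add: cexp_def)
    next
      case False
      then show ?thesis using cyl_sets[OF I] by (simp add: cexp_def)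
    qed
  qed simp
  also have "\<dots> = (\<integral>y. F y * H y \<partial>P)"
    by (rule integral_cyl_decomp[OF I F H, symmetric])
  finally show ?thesis by simp
qed

lemma abs_cexp_le:
  assumes I: "finite I" and F: "integrable P F" "\<And>y. \<bar>F y\<bar> \<le> b"
  shows "\<bar>cexp P I F y\<bar> \<le> b"
proof -
  have b: "b \<ge> 0" using F(2)[of y] by linarith
  have int: "integrable P (\<lambda>z. F z * indicator (cyl I y) z)"
    using integrable_mult_indicator[OF cyl_sets[OF I] F(1)] by (simp add: mult.commute)
  have int': "integrable P (\<lambda>z. b * indicator (cyl I y) z)"
    using cyl_sets[OF I] by (intro integrable_mult_right integrable_real_indicator) (auto simp: less_top[symmetric])
  have "\<bar>\<integral>z. F z * indicator (cyl I y) z \<partial>P\<bar> \<le> (\<integral>z. b * indicator (cyl I y) z \<partial>P)"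
    using F(2) b
    by (intro integral_abs_bound[THEN order_trans] integral_mono integrable_abs int int')
       (auto simp: abs_mult indicator_def)
  also have "\<dots> = b * measure P (cyl I y)" using cyl_sets[OF I] by simp
  finally show ?thesis
    using b by (cases "prob (cyl I y) = 0")
      (auto simp: cexp_def pos_divide_le_eq zero_less_measure_iff)
qed

end

locale stationary_path = path_measure P for P :: "(int \<Rightarrow> 'x::finite) measure" +
  assumes distr_sh: "distr P path_space (sh m) = P"
begin

lemma sh_meas [measurable]: "sh m \<in> measurable P P"
  using sh_measurable[of m] by (simp add: measurable_cong_sets[OF sets_P sets_P])

lemma distr_sh': "distr P P (sh m) = P"
  using distr_sh[of m] distr_cong[OF refl sets_P, of P "sh m" "sh m"] by simp

lemma integral_sh:
  fixes F :: "_ \<Rightarrow> real"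
  assumes [measurable]: "F \<in> borel_measurable P"
  shows "(\<integral>y. F (sh m y) \<partial>P) = (\<integral>y. F y \<partial>P)"
proof -
  have "(\<integral>y. F y \<partial>distr P P (sh m)) = (\<integral>y. F (sh m y) \<partial>P)"
    by (rule integral_distr) auto
  then show ?thesis by (simp add: distr_sh')
qed

lemma prob_sh:
  assumes [measurable]: "{y. Q y} \<in> sets P"
  shows "prob {y. Q (sh m y)} = prob {y. Q y}"
proof -
  have "measure (distr P P (sh m)) {y. Q y} = prob (sh m -` {y. Q y} \<inter> space P)"
    by (rule measure_distr) auto
  then show ?thesis by (simp add: distr_sh' vimage_def)
qed

lemma sets_sh:
  assumes "{y. Q y} \<in> sets P"
  shows "{y. Q (sh m y)} \<in> sets P"
  using measurable_sets[OF sh_meas[of m] assms] by (simp add: vimage_def)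

lemma AE_sh:
  assumes "AE y in P. Q y"
  shows "AE y in P. Q (sh m y)"
proof -
  have "AE y in distr P P (sh m). Q y" by (subst distr_sh') (rule assms)
  then show ?thesis by (rule AE_distrD[rotated]) simp
qed

end

section \<open>Deviations of the block averages\<close>

text \<open>\<open>fwd\<close>, \<open>pred_at\<close> and \<open>incr\<close> are G_s, C_s and the
  martingale difference g(x_{s+1}) - C_s.\<close>

definition fwd :: "(int \<Rightarrow> 'x) measure \<Rightarrow> ('x \<Rightarrow> real) \<Rightarrow> nat \<Rightarrow> (int \<Rightarrow> 'x) \<Rightarrow> real" where
  "fwd P g s = cexp P {- int s..0} (\<lambda>z. g (z 1))"

definition pred_at :: "(int \<Rightarrow> 'x) measure \<Rightarrow> ('x \<Rightarrow> real) \<Rightarrow> nat \<Rightarrow> (int \<Rightarrow> 'x) \<Rightarrow> real" where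
  "pred_at P g s y = fwd P g s (sh (int s) y)"

definition incr :: "(int \<Rightarrow> 'x) measure \<Rightarrow> ('x \<Rightarrow> real) \<Rightarrow> nat \<Rightarrow> (int \<Rightarrow> 'x) \<Rightarrow> real" where
  "incr P g s y = g (y (int s + 1)) - pred_at P g s y"

text \<open>All lengths up to K_n are included, not only kappa_n, so that a union bound can deal
  with the choice of the length from the data.\<close>

definition deviant :: "(int \<Rightarrow> 'x::finite) measure \<Rightarrow> ('x \<Rightarrow> real) \<Rightarrow> real \<Rightarrow> nat \<Rightarrow> (int \<Rightarrow> 'x) set" where
  "deviant P g e n = {y. \<exists>k. 1 \<le> k \<and> k \<le> K_par CARD('x) n \<and> J_par n \<le> card (occ y k n) \<and>
     \<bar>\<Sum>s\<in>occ y k n. incr P g s y\<bar> > e * real (card (occ y k n))}"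

lemma dep_fwd: "dep {- int s..0} (fwd P g s)"
  unfolding fwd_def by (rule dep_cexp)

lemma dep_pred_at: "dep {0..int s} (pred_at P g s)"
  using dep_sh[OF dep_fwd[of s P g], where m = "int s"] by (simp add: pred_at_def[abs_def])

lemma dep_incr: "dep {0..int s + 1} (incr P g s)"
  unfolding incr_def[abs_def]
  by (intro dep_comp2[of _ _ _ "\<lambda>a b. a - b"] dep_coord dep_mono[OF dep_pred_at]) auto

lemma occ_cong:
  assumes "\<And>i. - int k \<le> i \<Longrightarrow> i \<le> int n \<Longrightarrow> y i = z i"
  shows "occ y k n = occ z k n"
proof -
  have "blk y k s = blk z k s" if "s \<le> n" for s
    using that unfolding blk_eq_iff by (intro allI impI assms) auto
  then show ?thesis unfolding occ_def by auto
qed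

lemma dep_occ: "dep {- int k..int n} (\<lambda>y. occ y k n)"
  unfolding dep_def by (auto intro!: occ_cong)

lemma dep_occ_sum:
  assumes "\<And>s. s < n \<Longrightarrow> dep I (F s)" "{- int k..int n} \<subseteq> I"
  shows "dep I (\<lambda>y. \<Sum>s\<in>occ y k n. F s y)"
  unfolding dep_def
proof (intro allI impI sum.cong)
  fix y z :: "int \<Rightarrow> 'a" and s assume *: "\<forall>i\<in>I. y i = z i" 
  show "occ y k n = occ z k n"
    by (rule dep_eq[OF dep_occ]) (use * assms(2) in auto)
  assume "s \<in> occ z k n"
  then have "s < n" by (simp add: occ_def)
  then show "F s y = F s z" using * dep_eq[OF assms(1)] by blast
qed

lemma dep_deviant: "dep {- int (K_par CARD('x) n)..int n} (\<lambda>y :: int \<Rightarrow> 'x::finite. y \<in> deviant P g e n)"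
  unfolding dep_def
proof (intro allI impI)
  let ?I = "{- int (K_par CARD('x) n)..int n}"
  fix y z :: "int \<Rightarrow> 'x" assume *: "\<forall>i\<in>?I. y i = z i"
  have "occ y k n = occ z k n" if "k \<le> K_par CARD('x) n" for k
    by (rule dep_eq[OF dep_occ]) (use * that in auto)
  moreover have "(\<Sum>s\<in>occ y k n. incr P g s y) = (\<Sum>s\<in>occ z k n. incr P g s z)"
    if "k \<le> K_par CARD('x) n" for k
    by (rule dep_eq[OF dep_occ_sum[of n ?I "incr P g" k]])
       (use that * in \<open>auto intro!: dep_mono[OF dep_incr]\<close>)
  ultimately show "(y \<in> deviant P g e n) = (z \<in> deviant P g e n)"
    unfolding deviant_def by auto
qed

lemma exp_le_quadratic:
  fixes x :: real
  assumes "\<bar>x\<bar> \<le> 1"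
  shows "exp x \<le> 1 + x + x\<^sup>2"
proof (cases "x \<ge> 0")
  case True
  then show ?thesis using assms exp_bound[of x] by simp
next
  case False
  define t where "t = - x"
  have t: "t > 0" using False by (simp add: t_def)
  \<comment> \<open>The product equals 1 + t^3. Together with 1 + t \<le> exp t this bounds exp (-
    t) from above.\<close>
  have "1 \<le> (1 + t) * (1 - t + t\<^sup>2)"
    using t by (simp add: algebra_simps power2_eq_square)
  also have "\<dots> \<le> exp t * (1 - t + t\<^sup>2)"
  proof (rule mult_right_mono)
    have "0 \<le> (1 - t)\<^sup>2 + t" using t by simp
    then show "0 \<le> 1 - t + t\<^sup>2" using t by (simp add: power2_eq_square algebra_simps)
  qed (rule exp_ge_add_one_self)
  finally have "exp (- t) \<le> 1 - t + t\<^sup>2"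
    by (simp add: exp_minus field_simps)
  then show ?thesis by (simp add: t_def)
qed

lemma (in path_measure) abs_fwd_le:
  assumes "\<And>x. \<bar>g x\<bar> \<le> b"
  shows "\<bar>fwd P g s y\<bar> \<le> b"
  unfolding fwd_def
  by (rule abs_cexp_le) (auto intro!: dep_integrable[of "{1}"] dep_coord assms)

lemma (in path_measure) abs_incr_le:
  assumes "\<And>x. \<bar>g x\<bar> \<le> b"
  shows "\<bar>incr P g s y\<bar> \<le> 2 * b"
  using assms[of "y (int s + 1)"]
    abs_fwd_le[where g = g and b = b and s = s and y = "sh (int s) y", OF assms]
  unfolding incr_def pred_at_def by linarith

context stationary_path
begin

text \<open>The martingale difference property. Stationarity moves time m to the origin, where the
  claim is the defining property of G_m tested against the shifted \<open>H\<close>.\<close>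

lemma integral_incr_eq_0:
  assumes H: "dep {0..int m} H"
  shows "(\<integral>y. H y * incr P g m y \<partial>P) = 0"
proof -
  define H' where "H' = (\<lambda>y. H (sh (- int m) y))"
  have H': "dep {- int m..0} H'"
    using dep_sh[OF H, of "- int m"] by (simp add: H'_def)
  let ?f = "\<lambda>y. g (y 1) * H' y" and ?h = "\<lambda>y. fwd P g m y * H' y"
  have f: "dep {- int m..1} ?f"
    by (intro dep_comp2[of _ _ _ "\<lambda>a b. a * b"] dep_coord dep_mono[OF H']) auto
  have h: "dep {- int m..0} ?h"
    by (intro dep_comp2[of _ _ _ "\<lambda>a b. a * b"] dep_fwd H')
  have "H y * incr P g m y = ?f (sh (int m) y) - ?h (sh (int m) y)" for y
    by (simp add: incr_def pred_at_def H'_def algebra_simps) (simp add: sh_def)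
  then have "(\<integral>y. H y * incr P g m y \<partial>P) = (\<integral>y. ?f (sh (int m) y) - ?h (sh (int m) y) \<partial>P)"
    by simp
  also have "\<dots> = (\<integral>y. ?f y - ?h y \<partial>P)"
    by (rule integral_sh) (intro borel_measurable_diff dep_borel[OF _ f] dep_borel[OF _ h]; simp)
  also have "\<dots> = (\<integral>y. ?f y \<partial>P) - (\<integral>y. ?h y \<partial>P)"
    by (intro Bochner_Integration.integral_diff dep_integrable[OF _ f] dep_integrable[OF _ h]) auto
  also have "(\<integral>y. ?f y \<partial>P) = (\<integral>y. ?h y \<partial>P)"
    unfolding fwd_def
    by (rule integral_cexp[OF _ _ H']) (auto intro!: dep_integrable[of "{1}"] dep_coord)
  finally show ?thesis by simp
qed

text \<open>\<open>u s\<close> decides from the past whether the increment at time s is counted. For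
  a counted one, with x = \<theta> * \<open>incr\<close> and v = (\<theta> * b)^2, the quadratic
  bound gives exp (x - v) \<le> (1 + x + v) exp (- v) \<le> 1 + x exp (- v), and the term linear in
  x integrates to 0 against functions of the past.\<close>

lemma exp_supermartingale:
  fixes u :: "nat \<Rightarrow> (int \<Rightarrow> 'x) \<Rightarrow> real"
  assumes u: "\<And>s. dep {0..int s} (u s)" "\<And>s y. u s y \<in> {0, 1}"
    and b: "\<And>s y. \<bar>incr P g s y\<bar> \<le> b" and \<theta>: "\<bar>\<theta>\<bar> * b \<le> 1"
  shows "(\<integral>y. exp (\<Sum>s<m. u s y * (\<theta> * incr P g s y - (\<theta> * b)\<^sup>2)) \<partial>P) \<le> 1"
proof (induction m)
  case 0
  show ?case by (simp add: prob_space)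
next
  case (Suc m)
  define v where "v = (\<theta> * b)\<^sup>2"
  let ?Z = "\<lambda>m y. exp (\<Sum>s<m. u s y * (\<theta> * incr P g s y - v))"
  let ?H = "\<lambda>y. ?Z m y * u m y"
  have dS: "dep {0..int m} (\<lambda>y. u s y * (\<theta> * incr P g s y - v))" if "s < m" for s m
    by (intro dep_comp2[of _ _ _ "\<lambda>a b. a * (\<theta> * b - v)"] dep_mono[OF u(1)] dep_mono[OF dep_incr])
       (use that in auto)
  have dZ: "dep {0..int m} (?Z m)" for m
    by (intro dep_comp[of _ _ exp] dep_sum dS) auto
  have dH: "dep {0..int m} ?H"
    by (intro dep_comp2[of _ _ _ "\<lambda>a b. a * b"] dZ u)
  have dHY: "dep {0..int m + 1} (\<lambda>y. ?H y * incr P g m y)"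
    by (intro dep_comp2[of _ _ _ "\<lambda>a b. a * b"] dep_mono[OF dH] dep_incr) auto
  have step: "?Z (Suc m) y \<le> ?Z m y + \<theta> * exp (- v) * (?H y * incr P g m y)" for y
  proof -
    let ?x = "\<theta> * incr P g m y"
    have xb: "\<bar>?x\<bar> \<le> \<bar>\<theta>\<bar> * b" unfolding abs_mult using b by (intro mult_left_mono) auto
    then have x1: "\<bar>?x\<bar> \<le> 1" using \<theta> by linarith
    have xv: "?x\<^sup>2 \<le> v"
    proof -
      have "?x\<^sup>2 = \<bar>?x\<bar>\<^sup>2" by simp
      also have "\<dots> \<le> (\<bar>\<theta>\<bar> * b)\<^sup>2" using xb by (intro power_mono) auto
      finally show ?thesis by (simp add: v_def power_mult_distrib)
    qed
    have "exp (u m y * (?x - v)) \<le> 1 + u m y * (exp (- v) * ?x)"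
    proof (cases "u m y = 0")
      case False
      then have "u m y = 1" using u(2)[of m y] by auto
      moreover have "exp (?x - v) \<le> 1 + exp (- v) * ?x"
      proof -
        have "exp (?x - v) = exp ?x * exp (- v)" by (simp add: exp_diff exp_minus field_simps)
        also have "\<dots> \<le> (1 + ?x + v) * exp (- v)"
          using exp_le_quadratic[OF x1] xv by (intro mult_right_mono) auto
        also have "\<dots> = (1 + v) * exp (- v) + exp (- v) * ?x" by (simp add: algebra_simps)
        also have "(1 + v) * exp (- v) \<le> exp v * exp (- v)"
          by (intro mult_right_mono) auto
        finally show ?thesis by (simp add: exp_minus)
      qed
      ultimately show ?thesis by simp
    qed simp
    then have "?Z m y * exp (u m y * (?x - v)) \<le> ?Z m y * (1 + u m y * (exp (- v) * ?x))"
      by (intro mult_left_mono) auto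
    moreover have "?Z (Suc m) y = ?Z m y * exp (u m y * (?x - v))"
      by (simp add: exp_add)
    moreover have "?Z m y * (1 + u m y * (exp (- v) * ?x)) = ?Z m y + \<theta> * exp (- v) * (?H y * incr P g m y)"
      by (simp add: distrib_left)
    ultimately show ?thesis by (simp only:)
  qed
  have "(\<integral>y. ?Z (Suc m) y \<partial>P) \<le> (\<integral>y. ?Z m y + \<theta> * exp (- v) * (?H y * incr P g m y) \<partial>P)"
    by (intro integral_mono step Bochner_Integration.integrable_add integrable_mult_right
        dep_integrable[OF _ dZ] dep_integrable[OF _ dHY]) auto
  also have "\<dots> = (\<integral>y. ?Z m y \<partial>P) + \<theta> * exp (- v) * (\<integral>y. ?H y * incr P g m y \<partial>P)"
    by (subst Bochner_Integration.integral_add)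
       (auto intro!: integrable_mult_right dep_integrable[OF _ dZ] dep_integrable[OF _ dHY] simp del: sum.lessThan_Suc)
  also have "\<dots> \<le> 1"
    using Suc integral_incr_eq_0[OF dH, of g] by (simp add: v_def)
  finally show ?case by (simp add: v_def)
qed

text \<open>The compensator is subtracted for counted increments only. On the event in question the
  exponent is therefore at least c N \<ge> c J with the random count N, and Markov's inequality
  applies at once, without splitting over the values of N.\<close>

lemma azuma_random_count:
  fixes u :: "nat \<Rightarrow> (int \<Rightarrow> 'x) \<Rightarrow> real"
  assumes u: "\<And>s. dep {0..int s} (u s)" "\<And>s y. u s y \<in> {0, 1}"
    and b: "\<And>s y. \<bar>incr P g s y\<bar> \<le> b" "b > 0" and e: "e > 0" "e \<le> b"
    and \<sigma>: "\<sigma> \<in> {1, -1}"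
  shows "prob {y. real J \<le> (\<Sum>s<m. u s y) \<and> \<sigma> * (\<Sum>s<m. u s y * incr P g s y) > e * (\<Sum>s<m. u s y)}
         \<le> exp (- ((e / (2 * b))\<^sup>2 * real J))"
proof -
  \<comment> \<open>maximises \<open>\<sigma> * \<theta> * e - (\<theta> * b)\<^sup>2\<close>\<close>
  define \<theta> where "\<theta> = \<sigma> * e / (2 * b\<^sup>2)"
  define c where "c = (e / (2 * b))\<^sup>2"
  have \<sigma>2: "\<sigma> * \<sigma> = 1" "\<bar>\<sigma>\<bar> = 1" using \<sigma> by auto
  have "\<bar>\<theta>\<bar> * b = e / (2 * b)"
    using b e \<sigma>2 by (simp add: \<theta>_def abs_mult power2_eq_square field_simps)
  also have "\<dots> \<le> 1" using b e by simp
  finally have \<theta>1: "\<bar>\<theta>\<bar> * b \<le> 1" .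
  have v: "(\<theta> * b)\<^sup>2 = c"
    using b \<sigma>2 by (simp add: \<theta>_def c_def power2_eq_square field_simps)
  have c2: "e * (e / (2 * b\<^sup>2)) = 2 * c"
    using b by (simp add: c_def power2_eq_square field_simps)
  let ?L = "\<lambda>y. \<Sum>s<m. u s y * (\<theta> * incr P g s y - (\<theta> * b)\<^sup>2)"
  let ?N = "\<lambda>y. \<Sum>s<m. u s y" and ?S = "\<lambda>y. \<Sum>s<m. u s y * incr P g s y"
  have dL: "dep {0..int m} ?L"
  proof (rule dep_sum)
    fix s assume "s \<in> {..<m}"
    then show "dep {0..int m} (\<lambda>y. u s y * (\<theta> * incr P g s y - (\<theta> * b)\<^sup>2))"
      by (intro dep_comp2[of _ _ _ "\<lambda>a b'. a * (\<theta> * b' - (\<theta> * b)\<^sup>2)"]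
          dep_mono[OF u(1)] dep_mono[OF dep_incr]) auto
  qed
  have dE: "dep {0..int m} (\<lambda>y. exp (?L y))" by (rule dep_comp[OF dL])
  have sub: "{y. real J \<le> ?N y \<and> \<sigma> * ?S y > e * ?N y} \<subseteq> {y \<in> space P. exp (?L y) \<ge> exp (c * real J)}"
  proof
    fix y assume "y \<in> {y. real J \<le> ?N y \<and> \<sigma> * ?S y > e * ?N y}"
    then have J: "real J \<le> ?N y" and S: "\<sigma> * ?S y > e * ?N y" by simp_all
    have L: "?L y = \<theta> * ?S y - c * ?N y"
      unfolding v by (simp add: sum_subtractf sum_distrib_left algebra_simps)
    have "2 * c * ?N y = (e * (e / (2 * b\<^sup>2))) * ?N y" by (simp only: c2)
    also have "\<dots> = e / (2 * b\<^sup>2) * (e * ?N y)" by simp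
    also have "\<dots> \<le> e / (2 * b\<^sup>2) * (\<sigma> * ?S y)"
      using S e b by (intro mult_left_mono) auto
    also have "\<dots> = \<theta> * ?S y" by (simp add: \<theta>_def)
    finally have "?L y \<ge> c * ?N y" unfolding L by linarith
    moreover have "c * ?N y \<ge> c * real J" using J by (intro mult_left_mono) (auto simp: c_def)
    ultimately show "y \<in> {y \<in> space P. exp (?L y) \<ge> exp (c * real J)}" by simp
  qed
  have "prob {y. real J \<le> ?N y \<and> \<sigma> * ?S y > e * ?N y} \<le> prob {y \<in> space P. exp (?L y) \<ge> exp (c * real J)}"
    using sub dep_sets[OF _ dep_comp[OF dE, of "\<lambda>r. exp (c * real J) \<le> r"]]
    by (intro finite_measure_mono) auto
  also have "\<dots> \<le> (\<integral>y. exp (?L y) \<partial>P) / exp (c * real J)"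
    by (rule integral_Markov_inequality_measure[of _ _ "{}"]) (auto intro: dep_integrable[OF _ dE])
  also have "\<dots> \<le> 1 / exp (c * real J)"
    by (intro divide_right_mono exp_supermartingale u b \<theta>1) auto
  finally show ?thesis by (simp add: c_def exp_minus field_simps)
qed

text \<open>A union bound over lengths, words and the two signs. The increments are bounded by 2 b,
  which turns the constant e / (2 b) into e / (4 b).\<close>

lemma prob_deviant_le:
  assumes b: "\<And>x. \<bar>g x\<bar> \<le> b" "b > 0" and e: "e > 0" "e \<le> b" and n: "n \<ge> 1"
  shows "prob (deviant P g e n)
     \<le> 2 * (real CARD('x) * real n powr 0.1)\<^sup>2 * exp (- ((e / (4 * b))\<^sup>2 * sqrt (real n)))"
proof -
  let ?K = "K_par CARD('x) n" and ?J = "J_par n"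
  let ?c = "(e / (2 * (2 * b)))\<^sup>2"
  \<comment> \<open>The word is fixed before the path is seen, so that counting at time s is decided
    by the coordinates 0, ..., s. The random current block enters only through the union over all
    \<open>w\<close>.\<close>
  define u :: "'x list \<Rightarrow> nat \<Rightarrow> (int \<Rightarrow> 'x) \<Rightarrow> real" where
    "u = (\<lambda>w s y. if length w - 1 \<le> s \<and> blk y (length w) s = w then 1 else 0)"
  have du: "dep {0..int s} (u w s)" for w s
  proof (cases "length w - 1 \<le> s")
    case True
    then have "dep {0..int s} (\<lambda>y. blk y (length w) s)" by (intro dep_blk) auto
    then show ?thesis unfolding u_def by (rule dep_comp)
  qed (simp add: u_def dep_const)
  have u01: "u w s y \<in> {0, 1}" for w s y by (simp add: u_def)
  let ?N = "\<lambda>w y. \<Sum>s<n. u w s y" and ?S = "\<lambda>w y. \<Sum>s<n. u w s y * incr P g s y"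
  define E where "E = (\<lambda>w \<sigma>. {y. real ?J \<le> ?N w y \<and> \<sigma> * ?S w y > e * ?N w y})"
  have dN: "dep {0..int n} (?N w)" for w
    by (intro dep_sum dep_mono[OF du]) auto
  have dS: "dep {0..int n} (?S w)" for w
    by (intro dep_sum dep_comp2[of _ _ _ "\<lambda>a b. a * b"] dep_mono[OF du] dep_mono[OF dep_incr]) auto
  have E_sets: "E w \<sigma> \<in> sets P" for w \<sigma>
    unfolding E_def
    by (rule dep_sets[OF _ dep_comp2[OF dN dS, of "\<lambda>a b. real ?J \<le> a \<and> \<sigma> * b > e * a"]]) simp
  have E_le: "prob (E w \<sigma>) \<le> exp (- (?c * real ?J))" if "\<sigma> \<in> {1, -1}" for w \<sigma>
    unfolding E_def
    by (rule azuma_random_count[OF du u01 abs_incr_le[OF b(1)] _ _ _ that]) (use b e in auto)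
  have occ_sum: "(\<Sum>s\<in>occ y k n. f s) = (\<Sum>s<n. u (blk y k n) s y * f s)" for y k f
  proof -
    have "(\<Sum>s<n. u (blk y k n) s y * f s) = (\<Sum>s<n. if s \<in> occ y k n then f s else 0)"
      by (intro sum.cong) (auto simp: u_def occ_def)
    also have "\<dots> = (\<Sum>s\<in>occ y k n. f s)"
      by (subst sum.inter_filter[symmetric]) (auto intro!: sum.cong simp: occ_def)
    finally show ?thesis by simp
  qed
  have "deviant P g e n \<subseteq> (\<Union>k\<in>{1..?K}. \<Union>w\<in>{w. length w = k}. E w 1 \<union> E w (-1))"
  proof
    fix y assume "y \<in> deviant P g e n"
    then obtain k where k: "1 \<le> k" "k \<le> ?K" "?J \<le> card (occ y k n)"
      "\<bar>\<Sum>s\<in>occ y k n. incr P g s y\<bar> > e * real (card (occ y k n))"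
      by (auto simp: deviant_def)
    have card: "real (card (occ y k n)) = ?N (blk y k n) y"
      using occ_sum[of "\<lambda>_. 1" y k] by simp
    have "real ?J \<le> ?N (blk y k n) y" using k(3) card by linarith
    moreover have "\<bar>?S (blk y k n) y\<bar> > e * ?N (blk y k n) y"
      using k(4) unfolding card occ_sum by simp
    ultimately have "y \<in> E (blk y k n) 1 \<union> E (blk y k n) (-1)"
      unfolding E_def by auto
    then show "y \<in> (\<Union>k\<in>{1..?K}. \<Union>w\<in>{w. length w = k}. E w 1 \<union> E w (-1))"
      using k by auto
  qed
  then have "prob (deviant P g e n) \<le> prob (\<Union>k\<in>{1..?K}. \<Union>w\<in>{w. length w = k}. E w 1 \<union> E w (-1))"
    using E_sets by (intro finite_measure_mono sets.finite_UN) auto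
  also have "\<dots> \<le> (\<Sum>k\<in>{1..?K}. prob (\<Union>w\<in>{w. length w = k}. E w 1 \<union> E w (-1)))"
    using E_sets by (intro measure_UNION_le sets.finite_UN) auto
  also have "\<dots> \<le> (\<Sum>k\<in>{1..?K}. \<Sum>w | length w = k. prob (E w 1 \<union> E w (-1)))"
    using E_sets by (intro sum_mono measure_UNION_le) auto
  also have "\<dots> \<le> (\<Sum>k\<in>{1..?K}. \<Sum>w::'x list | length w = k. 2 * exp (- (?c * real ?J)))"
  proof (intro sum_mono)
    fix w :: "'x list"
    have "prob (E w 1 \<union> E w (-1)) \<le> prob (E w 1) + prob (E w (-1))"
      using E_sets by (intro measure_Un_le) auto
    then show "prob (E w 1 \<union> E w (-1)) \<le> 2 * exp (- (?c * real ?J))"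
      using E_le[of 1 w] E_le[of "-1" w] by simp
  qed
  also have "\<dots> = (\<Sum>k\<in>{1..?K}. real (CARD('x) ^ k)) * (2 * exp (- (?c * real ?J)))"
    by (simp add: card_words sum_distrib_right)
  also have "\<dots> \<le> (real CARD('x) * real n powr 0.1)\<^sup>2 * (2 * exp (- ((e / (4 * b))\<^sup>2 * sqrt (real n))))"
  proof (rule mult_mono)
    have A: "1 \<le> CARD('x)" by (simp add: Suc_leI)
    have "(\<Sum>k\<in>{1..?K}. real (CARD('x) ^ k)) \<le> (\<Sum>k\<in>{1..?K}. real (CARD('x) ^ ?K))"
      using A by (intro sum_mono) (simp only: of_nat_le_iff, intro power_increasing, auto)
    also have "\<dots> = real ?K * real (CARD('x) ^ ?K)" by simp
    also have "\<dots> \<le> real (CARD('x) ^ ?K) * real (CARD('x) ^ ?K)"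
      using K_par_le_pow[OF A, of n] by (intro mult_right_mono) (simp only: of_nat_le_iff, simp)
    also have "\<dots> \<le> (real CARD('x) * real n powr 0.1)\<^sup>2"
      unfolding power2_eq_square using card_pow_K_par_le[OF A n] by (intro mult_mono) auto
    finally show "(\<Sum>k\<in>{1..?K}. real (CARD('x) ^ k)) \<le> (real CARD('x) * real n powr 0.1)\<^sup>2" .
    have "?c * real ?J \<ge> ?c * sqrt (real n)" using J_par_ge by (intro mult_left_mono) auto
    then show "2 * exp (- (?c * real ?J)) \<le> 2 * exp (- ((e / (4 * b))\<^sup>2 * sqrt (real n)))" by simp
  qed auto
  finally show ?thesis by (simp add: mult_ac)
qed

lemma deviant_sets: "deviant P g e n \<in> sets P"
  using dep_sets[OF _ dep_deviant[of n P g e]] by simp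

lemma summable_prob_deviant:
  assumes e: "e > 0"
  shows "summable (\<lambda>n. prob (deviant P g e n))"
proof -
  \<comment> \<open>Taking e into the maximum secures \<open>e \<le> b\<close>, which keeps the
    exponential parameter admissible.\<close>
  define b where "b = max e (Max (range (\<lambda>x. \<bar>g x\<bar>)))"
  have b: "\<bar>g x\<bar> \<le> b" "b > 0" "e \<le> b" for x
    using e unfolding b_def by (auto simp: le_max_iff_disj intro!: disjI2 Max_ge)
  define c where "c = (e / (4 * b))\<^sup>2"
  have c: "c > 0" using e b by (simp add: c_def)
  define h where "h = (\<lambda>n. 2 * (real CARD('x) * real n powr 0.1)\<^sup>2 * exp (- (c * sqrt (real n))))"
  \<comment> \<open>The factor exp (- c sqrt n), coming from J_n \<ge> sqrt n, beats every power of
    n, in particular the squared number of words.\<close>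
  have "h \<in> O(\<lambda>n. real n powr - 2)"
    unfolding h_def using c by real_asymp
  moreover have "summable (\<lambda>n. norm (real n powr - 2))" by (simp add: summable_real_powr_iff)
  ultimately have "summable h"
    by (rule summable_comparison_test_bigo[rotated])
  then show ?thesis
  proof (rule summable_comparison_test_ev[rotated])
    show "\<forall>\<^sub>F n in sequentially. norm (prob (deviant P g e n)) \<le> h n"
      using eventually_ge_at_top[of 1]
      by eventually_elim
         (use prob_deviant_le[OF b(1,2) e b(3)] in \<open>auto simp: h_def c_def\<close>)
  qed
qed

lemma AE_eventually_not_deviant:
  assumes "e > 0"
  shows "AE y in P. eventually (\<lambda>n. y \<notin> deviant P g e n) sequentially"
proof -
  have "AE y in P. eventually (\<lambda>n. y \<in> space P - deviant P g e n) sequentially"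
    by (rule borel_cantelli_AE1)
       (auto intro: summable_prob_deviant assms deviant_sets simp: emeasure_eq_measure)
  then show ?thesis by simp
qed

end

section \<open>Oscillation of the finite-past predictions\<close>

text \<open>This is D_k. One reference prediction G_k serves all longer pasts at once, which is
  needed because the length of the past is the time s itself. The supremum is genuine, as all G_i
  are bounded by max |g|.\<close>

definition fluct :: "(int \<Rightarrow> 'x) measure \<Rightarrow> ('x \<Rightarrow> real) \<Rightarrow> nat \<Rightarrow> (int \<Rightarrow> 'x) \<Rightarrow> real" where
  "fluct P g k y = (SUP i\<in>{k..}. \<bar>fwd P g i y - fwd P g k y\<bar>)"

context path_measure
begin

lemma prob_UNIV [simp]: "prob UNIV = 1"
  using prob_space by simp

lemma fwd_borel [measurable]: "fwd P g s \<in> borel_measurable P"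
  by (rule dep_borel[OF _ dep_fwd]) simp

text \<open>The martingale property of G_0, G_1, ...: since \<open>H\<close> is a function of the
  shorter past, both sides equal the integral of g(x_1) \<open>H\<close>.\<close>

lemma fwd_tower:
  assumes "i \<le> n" and H: "dep {- int i..0} H"
  shows "(\<integral>y. fwd P g n y * H y \<partial>P) = (\<integral>y. fwd P g i y * H y \<partial>P)"
proof -
  have g: "integrable P (\<lambda>z. g (z 1))" by (auto intro!: dep_integrable[of "{1}"] dep_coord)
  have "dep {- int n..0} H" using assms by (intro dep_mono[OF H]) auto
  from integral_cexp[OF _ g this] integral_cexp[OF _ g H] show ?thesis
    unfolding fwd_def by simp
qed

text \<open>Orthogonality of martingale increments: by the tower property the mixed term is the
  second moment of G_i.\<close>

lemma integral_fwd_diff_sq: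
  assumes "i \<le> n"
  shows "(\<integral>y. (fwd P g n y - fwd P g i y)\<^sup>2 \<partial>P) = (\<integral>y. (fwd P g n y)\<^sup>2 \<partial>P) - (\<integral>y. (fwd P g i y)\<^sup>2 \<partial>P)"
proof -
  have int: "integrable P (\<lambda>y. fwd P g m y * fwd P g l y)" for m l
    by (rule dep_integrable[of "{- int (max m l)..0}"])
       (auto intro!: dep_comp2[of _ _ _ "\<lambda>a b. a * b"] dep_mono[OF dep_fwd])
  have "(\<integral>y. (fwd P g n y - fwd P g i y)\<^sup>2 \<partial>P) =
     (\<integral>y. fwd P g n y * fwd P g n y - 2 * (fwd P g n y * fwd P g i y) + fwd P g i y * fwd P g i y \<partial>P)"
    by (simp add: power2_eq_square algebra_simps)
  also have "\<dots> = (\<integral>y. fwd P g n y * fwd P g n y \<partial>P) - 2 * (\<integral>y. fwd P g n y * fwd P g i y \<partial>P)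
      + (\<integral>y. fwd P g i y * fwd P g i y \<partial>P)"
    using int by simp
  also have "(\<integral>y. fwd P g n y * fwd P g i y \<partial>P) = (\<integral>y. fwd P g i y * fwd P g i y \<partial>P)"
    by (rule fwd_tower[OF assms dep_fwd])
  finally show ?thesis by (simp add: power2_eq_square)
qed

text \<open>The second moments increase and are bounded, hence form a Cauchy sequence, and by
  orthogonality their differences are the squared L2 distances.\<close>

lemma fwd_L2_Cauchy:
  assumes "\<delta> > 0"
  obtains k where "\<And>n. n \<ge> k \<Longrightarrow> (\<integral>y. (fwd P g n y - fwd P g k y)\<^sup>2 \<partial>P) \<le> \<delta>"
proof -
  define a where "a = (\<lambda>n. \<integral>y. (fwd P g n y)\<^sup>2 \<partial>P)"
  have ge0: "(\<integral>y. (fwd P g n y - fwd P g i y)\<^sup>2 \<partial>P) \<ge> 0" for n i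
    by (rule integral_nonneg_AE) simp
  have "incseq a"
  proof (rule incseq_SucI)
    fix n
    show "a n \<le> a (Suc n)"
      using integral_fwd_diff_sq[of n "Suc n" g] ge0[of "Suc n" n] by (simp add: a_def)
  qed
  moreover define b where "b = Max (range (\<lambda>x. \<bar>g x\<bar>))"
  have "\<bar>g x\<bar> \<le> b" for x unfolding b_def by (intro Max_ge) auto
  then have fb: "\<bar>fwd P g n y\<bar> \<le> b" for n y by (rule abs_fwd_le)
  have "a n \<le> b\<^sup>2" for n
  proof -
    have "a n \<le> (\<integral>y. b\<^sup>2 \<partial>P)"
      unfolding a_def
      by (intro integral_mono dep_integrable[of "{- int n..0}"] dep_comp[OF dep_fwd])
         (auto intro!: abs_le_square_iff[THEN iffD1] order_trans[OF fb] simp: dep_const)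
    then show ?thesis by simp
  qed
  ultimately obtain L where "a \<longlonglongrightarrow> L" using incseq_convergent[of a "b\<^sup>2"] by blast
  then have "Cauchy a" by (rule LIMSEQ_imp_Cauchy)
  then obtain k where k: "\<And>m n. m \<ge> k \<Longrightarrow> n \<ge> k \<Longrightarrow> dist (a m) (a n) < \<delta>"
    unfolding Cauchy_def using assms by blast
  show ?thesis
  proof (rule that)
    fix n assume "n \<ge> k"
    then show "(\<integral>y. (fwd P g n y - fwd P g k y)\<^sup>2 \<partial>P) \<le> \<delta>"
      using integral_fwd_diff_sq[of k n g] k[of n k] by (simp add: a_def dist_real_def)
  qed
qed

text \<open>The event is split by the first index i of exceedance. The piece \<open>A i\<close> is
  decided by the coordinates -i, ..., 0, so G_N - G_i is orthogonal to (G_i - G_k) restricted to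
  \<open>A i\<close>, and the mean square over \<open>A i\<close> can only grow from i to N.\<close>

lemma kolmogorov_maximal:
  assumes e: "e > 0" and kN: "k \<le> N"
  shows "e\<^sup>2 * prob {y. \<exists>i\<in>{k..N}. \<bar>fwd P g i y - fwd P g k y\<bar> > e}
    \<le> (\<integral>y. (fwd P g N y - fwd P g k y)\<^sup>2 \<partial>P)"
proof -
  let ?f = "fwd P g"
  define A where "A = (\<lambda>i. {y. \<bar>?f i y - ?f k y\<bar> > e \<and> (\<forall>j\<in>{k..<i}. \<bar>?f j y - ?f k y\<bar> \<le> e)})"
  have df: "dep {- int i..0} (?f j)" if "j \<le> i" for i j
    using that by (intro dep_mono[OF dep_fwd]) auto
  have dA: "dep {- int i..0} (\<lambda>y. y \<in> A i)" if "k \<le> i" for i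
    unfolding dep_def
  proof (intro allI impI)
    fix y z :: "int \<Rightarrow> 'x" assume *: "\<forall>j\<in>{- int i..0}. y j = z j"
    have "?f j y = ?f j z" if "j \<le> i" for j
      by (rule dep_eq[OF df[OF that]]) (use * in auto)
    then show "(y \<in> A i) = (z \<in> A i)" unfolding A_def using \<open>k \<le> i\<close> by auto
  qed
  have A_sets: "A i \<in> sets P" if "k \<le> i" for i
    using dep_sets[OF _ dA[OF that]] by simp
  have disj: "disjoint_family_on A {k..N}"
    unfolding disjoint_family_on_def A_def
  proof safe
    fix m n y
    assume *: "m \<in> {k..N}" "n \<in> {k..N}" "m \<noteq> n"
      "e < \<bar>?f m y - ?f k y\<bar>" "\<forall>j\<in>{k..<m}. \<bar>?f j y - ?f k y\<bar> \<le> e"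
      "e < \<bar>?f n y - ?f k y\<bar>" "\<forall>j\<in>{k..<n}. \<bar>?f j y - ?f k y\<bar> \<le> e"
    have "m < n \<or> n < m" using *(3) by auto
    then have False using * by (auto simp: not_less[symmetric])
    then show "y \<in> {}" ..
  qed
  have union: "{y. \<exists>i\<in>{k..N}. \<bar>?f i y - ?f k y\<bar> > e} = (\<Union>i\<in>{k..N}. A i)"
  proof (intro equalityI subsetI)
    fix y assume "y \<in> {y. \<exists>i\<in>{k..N}. \<bar>?f i y - ?f k y\<bar> > e}"
    then have ex: "\<exists>i. i \<in> {k..N} \<and> \<bar>?f i y - ?f k y\<bar> > e" by auto
    define i where "i = (LEAST i. i \<in> {k..N} \<and> \<bar>?f i y - ?f k y\<bar> > e)"
    have i: "i \<in> {k..N}" "\<bar>?f i y - ?f k y\<bar> > e" using LeastI_ex[OF ex] by (simp_all add: i_def)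
    have "\<bar>?f j y - ?f k y\<bar> \<le> e" if "j \<in> {k..<i}" for j
      using not_less_Least[of j "\<lambda>i. i \<in> {k..N} \<and> \<bar>?f i y - ?f k y\<bar> > e"] that i(1)
      unfolding i_def[symmetric] by (auto simp: not_less)
    then show "y \<in> (\<Union>i\<in>{k..N}. A i)" using i by (auto simp: A_def)
  qed (auto simp: A_def)
  have intH: "integrable P (\<lambda>y. H (?f N y) (?f i y) (?f k y) * indicator (A i) y)"
    if "i \<in> {k..N}" for i and H :: "real \<Rightarrow> real \<Rightarrow> real \<Rightarrow> real"
  proof (rule dep_integrable[of "{- int N..0}"])
    have 1: "dep {- int N..0} (\<lambda>y. y \<in> A i)"
      using that by (intro dep_mono[OF dA]) auto
    have 2: "dep {- int N..0} (\<lambda>y. H (?f N y) (?f i y))"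
      using that by (intro dep_comp2[of _ _ _ H] df) auto
    have 3: "dep {- int N..0} (\<lambda>y. H (?f N y) (?f i y) (?f k y))"
      using that by (intro dep_comp2[OF 2 df, of _ "\<lambda>a b. a b"]) auto
    show "dep {- int N..0} (\<lambda>y. H (?f N y) (?f i y) (?f k y) * indicator (A i) y)"
      using dep_comp2[OF 3 1, of "\<lambda>a b. a * of_bool b"] by (simp add: indicator_def of_bool_def)
  qed simp
  have step: "e\<^sup>2 * prob (A i) \<le> (\<integral>y. (?f N y - ?f k y)\<^sup>2 * indicator (A i) y \<partial>P)"
    if i: "i \<in> {k..N}" for i
  proof -
    let ?H = "\<lambda>y. (?f i y - ?f k y) * indicator (A i) y"
    have dH: "dep {- int i..0} ?H"
    proof -
      have "dep {- int i..0} (\<lambda>y. ?f i y - ?f k y)"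
        using i by (intro dep_comp2[of _ _ _ "\<lambda>a b. a - b"] df) auto
      then show ?thesis
        using dep_comp2[OF _ dA, of i _ "\<lambda>a b. a * of_bool b"] i by (simp add: indicator_def of_bool_def)
    qed
    have dHN: "dep {- int N..0} ?H" using i by (intro dep_mono[OF dH]) auto
    have cross: "(\<integral>y. ?f N y * ?H y - ?f i y * ?H y \<partial>P) = 0"
    proof -
      have "(\<integral>y. ?f N y * ?H y - ?f i y * ?H y \<partial>P) = (\<integral>y. ?f N y * ?H y \<partial>P) - (\<integral>y. ?f i y * ?H y \<partial>P)"
        by (intro Bochner_Integration.integral_diff dep_integrable[of "{- int N..0}"]
            dep_comp2[OF _ dHN, of _ "\<lambda>a b. a * b"] df) (use i in auto)
      also have "\<dots> = 0" using fwd_tower[OF _ dH, of N g] i by simp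
      finally show ?thesis .
    qed
    have int1: "integrable P (\<lambda>y. (?f i y - ?f k y)\<^sup>2 * indicator (A i) y)"
      using intH[OF i, of "\<lambda>a b c. (b - c)\<^sup>2"] .
    have int2: "integrable P (\<lambda>y. 2 * (?f N y * ?H y - ?f i y * ?H y))"
      using intH[OF i, of "\<lambda>a b c. 2 * (a * (b - c) - b * (b - c))"] by (simp add: algebra_simps)
    have "e\<^sup>2 * prob (A i) = (\<integral>y. e\<^sup>2 * indicator (A i) y \<partial>P)"
      using A_sets i by simp
    also have "\<dots> \<le> (\<integral>y. (?f i y - ?f k y)\<^sup>2 * indicator (A i) y \<partial>P)"
    proof (rule integral_mono[OF _ int1])
      show "integrable P (\<lambda>y. e\<^sup>2 * indicator (A i) y)" using intH[OF i, of "\<lambda>_ _ _. e\<^sup>2"] .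
      fix y
      show "e\<^sup>2 * indicator (A i) y \<le> (?f i y - ?f k y)\<^sup>2 * indicator (A i) y"
      proof (cases "y \<in> A i")
        case True
        then have "\<bar>e\<bar> \<le> \<bar>?f i y - ?f k y\<bar>" using e by (simp add: A_def)
        then show ?thesis by (simp add: True abs_le_square_iff)
      qed simp
    qed
    also have "\<dots> = (\<integral>y. (?f i y - ?f k y)\<^sup>2 * indicator (A i) y + 2 * (?f N y * ?H y - ?f i y * ?H y) \<partial>P)"
      by (subst Bochner_Integration.integral_add[OF int1 int2], subst integral_mult_right_zero, subst cross) simp
    also have "\<dots> \<le> (\<integral>y. (?f N y - ?f k y)\<^sup>2 * indicator (A i) y \<partial>P)"
    proof (rule integral_mono[OF Bochner_Integration.integrable_add[OF int1 int2]])
      show "integrable P (\<lambda>y. (?f N y - ?f k y)\<^sup>2 * indicator (A i) y)"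
        using intH[OF i, of "\<lambda>a b c. (a - c)\<^sup>2"] .
      fix y
      have "(?f N y - ?f k y)\<^sup>2 = (?f i y - ?f k y)\<^sup>2 + 2 * ((?f N y - ?f i y) * (?f i y - ?f k y)) + (?f N y - ?f i y)\<^sup>2"
        by (simp add: power2_eq_square algebra_simps)
      then have "(?f i y - ?f k y)\<^sup>2 + 2 * ((?f N y - ?f i y) * (?f i y - ?f k y)) \<le> (?f N y - ?f k y)\<^sup>2"
        by simp
      then show "(?f i y - ?f k y)\<^sup>2 * indicator (A i) y + 2 * (?f N y * ?H y - ?f i y * ?H y)
          \<le> (?f N y - ?f k y)\<^sup>2 * indicator (A i) y"
        by (cases "y \<in> A i") (simp_all add: algebra_simps)
    qed
    finally show ?thesis .
  qed
  have "e\<^sup>2 * prob (\<Union>i\<in>{k..N}. A i) = (\<Sum>i\<in>{k..N}. e\<^sup>2 * prob (A i))"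
    using A_sets disj by (subst finite_measure_finite_Union) (auto simp: sum_distrib_left)
  also have "\<dots> \<le> (\<Sum>i\<in>{k..N}. \<integral>y. (?f N y - ?f k y)\<^sup>2 * indicator (A i) y \<partial>P)"
    by (rule sum_mono) (rule step)
  also have "\<dots> = (\<integral>y. (\<Sum>i\<in>{k..N}. (?f N y - ?f k y)\<^sup>2 * indicator (A i) y) \<partial>P)"
    by (rule Bochner_Integration.integral_sum[symmetric]) (rule intH[of _ "\<lambda>a b c. (a - c)\<^sup>2"])
  also have "\<dots> \<le> (\<integral>y. (?f N y - ?f k y)\<^sup>2 \<partial>P)"
  proof (rule integral_mono)
    show "integrable P (\<lambda>y. \<Sum>i\<in>{k..N}. (?f N y - ?f k y)\<^sup>2 * indicator (A i) y)"
      by (rule Bochner_Integration.integrable_sum) (rule intH[of _ "\<lambda>a b c. (a - c)\<^sup>2"])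
    show "integrable P (\<lambda>y. (?f N y - ?f k y)\<^sup>2)"
      by (intro dep_integrable[of "{- int N..0}"] dep_comp2[of _ _ _ "\<lambda>a b. (a - b)\<^sup>2"] df) (use kN in auto)
    fix y
    have "(\<Sum>i\<in>{k..N}. indicator (A i) y) = (indicator (\<Union>i\<in>{k..N}. A i) y :: real)"
      by (rule indicator_UN_disjoint[symmetric]) (use disj in auto)
    also have "\<dots> \<le> 1" by (simp add: indicator_def)
    finally show "(\<Sum>i\<in>{k..N}. (?f N y - ?f k y)\<^sup>2 * indicator (A i) y) \<le> (?f N y - ?f k y)\<^sup>2"
      by (simp add: sum_distrib_left[symmetric] mult_left_le)
  qed
  finally show ?thesis unfolding union .
qed

lemma fluct_bdd: "bdd_above ((\<lambda>i. \<bar>fwd P g i y - fwd P g k y\<bar>) ` {k..})"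
proof -
  define b where "b = Max (range (\<lambda>x. \<bar>g x\<bar>))"
  have "\<bar>g x\<bar> \<le> b" for x unfolding b_def by (intro Max_ge) auto
  then have fb: "\<bar>fwd P g n y\<bar> \<le> b" for n by (rule abs_fwd_le)
  have "\<bar>fwd P g i y - fwd P g k y\<bar> \<le> 2 * b" for i
    using fb[of i] fb[of k] by linarith
  then show ?thesis by (intro bdd_aboveI[of _ "2 * b"]) auto
qed

lemma fluct_ge: "k \<le> i \<Longrightarrow> \<bar>fwd P g i y - fwd P g k y\<bar> \<le> fluct P g k y"
  unfolding fluct_def by (rule cSUP_upper[OF _ fluct_bdd]) simp

lemma fluct_nonneg: "0 \<le> fluct P g k y"
  using fluct_ge[of k k g y] by simp

lemma fluct_borel [measurable]: "fluct P g k \<in> borel_measurable P"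
  unfolding fluct_def[abs_def]
  by (rule borel_measurable_cSUP) (auto intro: fluct_bdd)

lemma fluct_le:
  assumes "\<And>x. \<bar>g x\<bar> \<le> b"
  shows "fluct P g k y \<le> 2 * b"
  unfolding fluct_def
proof (rule cSUP_least)
  fix i
  show "\<bar>fwd P g i y - fwd P g k y\<bar> \<le> 2 * b"
    using abs_fwd_le[where g = g, OF assms, where s = i and y = y]
      abs_fwd_le[where g = g, OF assms, where s = k and y = y] by linarith
qed simp

lemma fluct_integrable: "integrable P (fluct P g k)"
proof -
  define b where "b = Max (range (\<lambda>x. \<bar>g x\<bar>))"
  have "\<bar>g x\<bar> \<le> b" for x unfolding b_def by (intro Max_ge) auto
  from fluct_le[OF this] show ?thesis
    by (intro integrable_const_bound[where B = "2 * b"]) (auto simp: fluct_nonneg)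
qed

lemma fluct_integral_small:
  assumes \<delta>: "\<delta> > 0"
  obtains k where "(\<integral>y. fluct P g k y \<partial>P) \<le> \<delta>"
proof -
  define b where "b = max 1 (Max (range (\<lambda>x. \<bar>g x\<bar>)))"
  have b: "\<bar>g x\<bar> \<le> b" for x unfolding b_def by (intro max.coboundedI2 Max_ge) auto
  have b1: "b > 0" by (simp add: b_def)
  define e where "e = \<delta> / 2"
  have e: "e > 0" using \<delta> by (simp add: e_def)
  \<comment> \<open>Off the exceedance event D_k is at most e = \<delta> / 2, and on it at most 2 b;
    probability \<delta> / (4 b) for the event thus leaves \<delta> in total.\<close>
  define \<delta>' where "\<delta>' = e\<^sup>2 * (\<delta> / (4 * b))"
  have "\<delta>' > 0" using e \<delta> b1 by (simp add: \<delta>'_def)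
  then obtain k where k: "\<And>n. n \<ge> k \<Longrightarrow> (\<integral>y. (fwd P g n y - fwd P g k y)\<^sup>2 \<partial>P) \<le> \<delta>'"
    using fwd_L2_Cauchy by blast
  define A where "A = (\<lambda>n. {y. \<exists>i\<in>{k..k+n}. \<bar>fwd P g i y - fwd P g k y\<bar> > e})"
  have A_sets [measurable]: "A n \<in> sets P" for n
  proof -
    have "{y \<in> space P. \<exists>i\<in>{k..k+n}. \<bar>fwd P g i y - fwd P g k y\<bar> > e} \<in> sets P" by measurable
    then show ?thesis by (simp add: A_def)
  qed
  have A_le: "prob (A n) \<le> \<delta> / (4 * b)" for n
  proof -
    have "e\<^sup>2 * prob (A n) \<le> \<delta>'"
      unfolding A_def using kolmogorov_maximal[OF e, of k "k + n" g] k[of "k + n"] by simp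
    then show ?thesis
      unfolding \<delta>'_def by (rule mult_left_le_imp_le) (use e in simp)
  qed
  \<comment> \<open>The bound is uniform in the horizon k + n, so it passes to the increasing
    union.\<close>
  have "(\<lambda>n. prob (A n)) \<longlonglongrightarrow> prob (\<Union>n. A n)"
  proof (rule finite_Lim_measure_incseq)
    show "range A \<subseteq> events" using A_sets by blast
  qed (auto simp: A_def incseq_def)
  then have UA_le: "prob (\<Union>n. A n) \<le> \<delta> / (4 * b)"
    by (rule LIMSEQ_le_const2) (use A_le in auto)
  have "(\<integral>y. fluct P g k y \<partial>P) \<le> (\<integral>y. e + 2 * b * indicator (\<Union>n. A n) y \<partial>P)"
  proof (rule integral_mono[OF fluct_integrable])
    show "integrable P (\<lambda>y. e + 2 * b * indicator (\<Union>n. A n) y)"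
      by (intro Bochner_Integration.integrable_add integrable_mult_right integrable_real_indicator)
         (auto simp: emeasure_eq_measure)
    fix y
    show "fluct P g k y \<le> e + 2 * b * indicator (\<Union>n. A n) y"
    proof (cases "y \<in> (\<Union>n. A n)")
      case True
      then show ?thesis using fluct_le[where g = g, OF b, where k = k and y = y] e by simp
    next
      case False
      have "\<bar>fwd P g i y - fwd P g k y\<bar> \<le> e" if "k \<le> i" for i
      proof -
        have "y \<notin> A (i - k)" using False by blast
        then show ?thesis using that by (auto simp: A_def not_less)
      qed
      then have "fluct P g k y \<le> e" unfolding fluct_def by (intro cSUP_least) auto
      then show ?thesis using False by simp
    qed
  qed
  also have "\<dots> = e + 2 * b * prob (\<Union>n. A n)"
    by (subst Bochner_Integration.integral_add)
       (auto simp: emeasure_eq_measure prob_space intro!: integrable_mult_right integrable_real_indicator)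
  also have "\<dots> \<le> e + 2 * b * (\<delta> / (4 * b))"
    using UA_le b1 by (intro add_left_mono mult_left_mono) auto
  also have "\<dots> = \<delta>" using b1 by (simp add: e_def)
  finally show ?thesis by (rule that)
qed

end

section \<open>The maximal ergodic lemma and word frequencies\<close>

context stationary_path
begin

lemma maximal_ergodic:
  fixes f :: "(int \<Rightarrow> 'x) \<Rightarrow> real"
  assumes f: "integrable P f"
  shows "0 \<le> (\<integral>y. f y * indicator {y. \<exists>n. (\<Sum>i<n. f (sh (int i) y)) > 0} y \<partial>P)"
proof -
  define S where "S = (\<lambda>n y. \<Sum>i<n. f (sh (int i) y))"
  \<comment> \<open>The maximum includes n = 0, hence is nonnegative; the inequality off
    \<open>A N\<close> rests on this.\<close>
  define M where "M = (\<lambda>N y. Max ((\<lambda>n. S n y) ` {..N}))"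
  define A where "A = (\<lambda>N. {y. M N y > 0})"
  have [measurable]: "f \<in> borel_measurable P" using f by (rule borel_measurable_integrable)
  have int_sh: "integrable P (\<lambda>y. F (sh m y))" if "integrable P F" for F :: "_ \<Rightarrow> real" and m
    using that integrable_distr[of "sh m" P P F] by (simp add: distr_sh')
  have S_int: "integrable P (S n)" for n
    unfolding S_def by (intro Bochner_Integration.integrable_sum int_sh f)
  have M_Suc: "M (Suc N) y = max (S (Suc N) y) (M N y)" for N y
    unfolding M_def atMost_Suc image_insert by (rule Max_insert) auto
  have M_int: "integrable P (M N)" for N
  proof (induction N)
    case 0
    show ?case using S_int[of 0] by (simp add: M_def)
  next
    case (Suc N)
    then show ?case unfolding M_Suc[abs_def] by (intro integrable_max S_int)
  qed
  have M_ge: "S n y \<le> M N y" if "n \<le> N" for n N y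
    unfolding M_def using that by (intro Max_ge) auto
  have M_nonneg: "0 \<le> M N y" for N y using M_ge[of 0 N y] by (simp add: S_def)
  have M_at: "\<exists>n\<le>N. M N y = S n y" for N y
  proof -
    have "M N y \<in> (\<lambda>n. S n y) ` {..N}" unfolding M_def by (intro Max_in) auto
    then show ?thesis by auto
  qed
  have A_sets [measurable]: "A N \<in> sets P" for N
  proof -
    have [measurable]: "M N \<in> borel_measurable P" using M_int by (rule borel_measurable_integrable)
    have "{y \<in> space P. M N y > 0} \<in> sets P" by measurable
    then show ?thesis by (simp add: A_def)
  qed
  \<comment> \<open>Garsia's argument: on \<open>A N\<close> the maximum is attained at some \<open>n \<ge> 1\<close>, so \<open>f\<close> dominates \<open>M N - M N \<circ> sh 1\<close>.\<close>
  have "0 \<le> (\<integral>y. f y * indicator (A N) y \<partial>P)" for N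
  proof -
    have le: "M N y - M N (sh 1 y) \<le> f y * indicator (A N) y" for y
    proof (cases "y \<in> A N")
      case True
      obtain n where n: "n \<le> N" "M N y = S n y" using M_at by blast
      then have "S n y > 0" using True by (simp add: A_def)
      then obtain m where m: "n = Suc m" by (cases n) (auto simp: S_def)
      have "S n y = f y + S m (sh 1 y)"
        unfolding m S_def sum.lessThan_Suc_shift by (simp add: add.commute)
      also have "S m (sh 1 y) \<le> M N (sh 1 y)" using n m by (intro M_ge) auto
      finally show ?thesis using n True by simp
    next
      case False
      then have "M N y \<le> 0" by (simp add: A_def)
      then show ?thesis using False M_nonneg[of N "sh 1 y"] by simp
    qed
    have "0 = (\<integral>y. M N y - M N (sh 1 y) \<partial>P)"
      by (subst Bochner_Integration.integral_diff[OF M_int int_sh[OF M_int]])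
         (simp add: integral_sh M_int borel_measurable_integrable)
    also have "\<dots> \<le> (\<integral>y. f y * indicator (A N) y \<partial>P)"
      using le integrable_mult_indicator[OF A_sets f, of N]
      by (intro integral_mono Bochner_Integration.integrable_diff M_int int_sh)
         (auto simp: mult.commute)
    finally show ?thesis .
  qed
  moreover have "(\<lambda>N. \<integral>y. f y * indicator (A N) y \<partial>P) \<longlonglongrightarrow>
      (\<integral>y. f y * indicator {y. \<exists>n. (\<Sum>i<n. f (sh (int i) y)) > 0} y \<partial>P)"
  proof (rule integral_dominated_convergence[where w = "\<lambda>y. \<bar>f y\<bar>"])
    have "{y \<in> space P. \<exists>n. (\<Sum>i<n. f (sh (int i) y)) > 0} \<in> sets P" by measurable
    then have [measurable]: "{y. \<exists>n. (\<Sum>i<n. f (sh (int i) y)) > 0} \<in> sets P" by simp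
    show "(\<lambda>y. f y * indicator {y. \<exists>n. (\<Sum>i<n. f (sh (int i) y)) > 0} y) \<in> borel_measurable P"
      by measurable
    show "(\<lambda>y. f y * indicator (A N) y) \<in> borel_measurable P" for N by measurable
    show "integrable P (\<lambda>y. \<bar>f y\<bar>)" using f by simp
    show "AE y in P. norm (f y * indicator (A N) y) \<le> \<bar>f y\<bar>" for N
      by (simp add: indicator_def)
    have "(\<lambda>N. f y * indicator (A N) y) \<longlonglongrightarrow>
        f y * indicator {y. \<exists>n. (\<Sum>i<n. f (sh (int i) y)) > 0} y" for y
    proof (rule tendsto_eventually, cases "\<exists>n. S n y > 0")
      case True
      then obtain n where n: "S n y > 0" by blast
      have "y \<in> A N" if "N \<ge> n" for N using M_ge[OF that, of y] n by (simp add: A_def)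
      then have "\<forall>\<^sub>F N in sequentially. y \<in> A N" by (auto simp: eventually_sequentially)
      then show "\<forall>\<^sub>F N in sequentially. f y * indicator (A N) y =
          f y * indicator {y. \<exists>n. (\<Sum>i<n. f (sh (int i) y)) > 0} y"
        by eventually_elim (use True in \<open>auto simp: S_def\<close>)
    next
      case False
      then have "y \<notin> A N" for N using M_at[of N y] by (auto simp: A_def)
      then show "\<forall>\<^sub>F N in sequentially. f y * indicator (A N) y =
          f y * indicator {y. \<exists>n. (\<Sum>i<n. f (sh (int i) y)) > 0} y"
        using False by (simp add: S_def)
    qed
    then show "AE y in P. (\<lambda>N. f y * indicator (A N) y) \<longlonglongrightarrow>
        f y * indicator {y. \<exists>n. (\<Sum>i<n. f (sh (int i) y)) > 0} y" by simp
  qed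
  ultimately show ?thesis by (intro LIMSEQ_le_const) auto
qed

text \<open>The weak type inequality, obtained from the maximal ergodic lemma for
  \<open>D - e\<close>. It controls the averages for all n simultaneously.\<close>

lemma maximal_average:
  fixes D :: "(int \<Rightarrow> 'x) \<Rightarrow> real"
  assumes D: "integrable P D" "\<And>y. 0 \<le> D y"
  shows "e * prob {y. \<exists>n. (\<Sum>i<n. D (sh (int i) y)) > e * real n} \<le> (\<integral>y. D y \<partial>P)"
proof -
  let ?A = "{y. \<exists>n. (\<Sum>i<n. D (sh (int i) y)) > e * real n}"
  have [measurable]: "D \<in> borel_measurable P" using D(1) by (rule borel_measurable_integrable)
  have "{y \<in> space P. \<exists>n. (\<Sum>i<n. D (sh (int i) y)) > e * real n} \<in> sets P" by measurable
  then have [measurable]: "?A \<in> sets P" by simp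
  have A_int: "integrable P (\<lambda>y. c * indicator ?A y)" for c :: real
    by (intro integrable_mult_right integrable_real_indicator) (auto simp: emeasure_eq_measure)
  have DA_int: "integrable P (\<lambda>y. D y * indicator ?A y)"
    using integrable_mult_indicator[of ?A P D] D by (simp add: mult.commute)
  have A: "?A = {y. \<exists>n. (\<Sum>i<n. D (sh (int i) y) - e) > 0}"
    by (simp add: sum_subtractf algebra_simps)
  have "0 \<le> (\<integral>y. (D y - e) * indicator ?A y \<partial>P)"
    unfolding A by (rule maximal_ergodic) (use D in simp)
  also have "\<dots> = (\<integral>y. D y * indicator ?A y - e * indicator ?A y \<partial>P)"
    by (simp add: algebra_simps)
  also have "\<dots> = (\<integral>y. D y * indicator ?A y \<partial>P) - e * prob ?A"
    by (subst Bochner_Integration.integral_diff[OF DA_int A_int]) simp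
  also have "(\<integral>y. D y * indicator ?A y \<partial>P) \<le> (\<integral>y. D y \<partial>P)"
    by (intro integral_mono DA_int D(1)) (use D in \<open>simp add: indicator_def\<close>)
  finally show ?thesis by simp
qed

text \<open>For fixed e, the event that every k fails has probability at most (1/e) E D_k for each
  k, and E D_k can be made arbitrarily small. The k found depends on the path, but then serves all
  n.\<close>

lemma AE_fluct_average_small:
  "AE y in P. \<forall>e>0. \<exists>k. \<forall>n. (\<Sum>i<n. fluct P g k (sh (int i) y)) \<le> e * real n"
proof -
  have *: "AE y in P. \<exists>k. \<forall>n. (\<Sum>i<n. fluct P g k (sh (int i) y)) \<le> e * real n" if e: "e > 0" for e
  proof -
    define B where "B = (\<lambda>k. {y. \<exists>n. (\<Sum>i<n. fluct P g k (sh (int i) y)) > e * real n})"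
    have B_sets [measurable]: "B k \<in> sets P" for k
    proof -
      have "{y \<in> space P. \<exists>n. (\<Sum>i<n. fluct P g k (sh (int i) y)) > e * real n} \<in> sets P" by measurable
      then show ?thesis by (simp add: B_def)
    qed
    have "prob (\<Inter>k. B k) \<le> \<delta>" if \<delta>: "\<delta> > 0" for \<delta>
    proof -
      obtain k where k: "(\<integral>y. fluct P g k y \<partial>P) \<le> e * \<delta>"
        using fluct_integral_small[of "e * \<delta>" g] e \<delta> by (metis mult_pos_pos)
      have "e * prob (B k) \<le> e * \<delta>"
        using maximal_average[OF fluct_integrable fluct_nonneg, of e g k] k by (simp add: B_def)
      then have "prob (B k) \<le> \<delta>" using e by simp
      moreover have "prob (\<Inter>k. B k) \<le> prob (B k)"
        using B_sets by (intro finite_measure_mono) auto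
      ultimately show ?thesis by linarith
    qed
    then have "prob (\<Inter>k. B k) \<le> 0" by (rule field_le_epsilon) simp
    then have "prob (\<Inter>k. B k) = 0" using measure_nonneg[of P "\<Inter>k. B k"] by linarith
    moreover have "(\<Inter>k. B k) \<in> sets P" using B_sets by blast
    ultimately have "(\<Inter>k. B k) \<in> null_sets P" by (simp add: null_sets_def emeasure_eq_measure)
    from AE_not_in[OF this] show ?thesis by eventually_elim (auto simp: B_def not_less)
  qed
  have "AE y in P. \<forall>j. \<exists>k. \<forall>n. (\<Sum>i<n. fluct P g k (sh (int i) y)) \<le> 1 / real (Suc j) * real n"
    unfolding AE_all_countable by (intro allI *) simp
  then show ?thesis
  proof (eventually_elim, intro allI impI)
    fix y and e :: real
    assume *: "\<forall>j. \<exists>k. \<forall>n. (\<Sum>i<n. fluct P g k (sh (int i) y)) \<le> 1 / real (Suc j) * real n" and e: "e > 0"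
    obtain j where j: "1 / real (Suc j) < e" using nat_approx_posE[OF e] by auto
    obtain k where k: "\<And>n. (\<Sum>i<n. fluct P g k (sh (int i) y)) \<le> 1 / real (Suc j) * real n"
      using * by blast
    have "(\<Sum>i<n. fluct P g k (sh (int i) y)) \<le> e * real n" for n
      using k[of n] mult_right_mono[of "1 / real (Suc j)" e "real n"] j by linarith
    then show "\<exists>k. \<forall>n. (\<Sum>i<n. fluct P g k (sh (int i) y)) \<le> e * real n" by blast
  qed
qed

lemma word_sets [measurable]: "{y. blk y k s = w} \<in> sets P"
  by (rule dep_sets[of "{int s - int k..int s}"]) (auto intro!: dep_comp[OF dep_blk])

end

section \<open>Word frequencies and growth of kappa_n under ergodicity\<close>

locale ergodic_path = stationary_path P for P :: "(int \<Rightarrow> 'x::finite) measure" +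
  assumes ergodic: "B \<in> sets P \<Longrightarrow> sh 1 -` B = B \<Longrightarrow> prob B \<in> {0, 1}"
begin

text \<open>\<open>B\<close> is the event that the lower frequency of \<open>w\<close> vanishes. It
  is shift invariant, so its probability is 0 or 1. If it were 1, the maximal event of f = 1 / (j +
  1) - 1_w would have full probability, so f would have a nonnegative integral; letting j grow,
  \<open>w\<close> would have probability 0.\<close>

lemma AE_word_frequency:
  assumes pos: "prob {y. blk y k 0 = w} > 0"
  shows "AE y in P. \<exists>r>0. eventually (\<lambda>n. real (card {s. s < n \<and> blk y k s = w}) \<ge> r * real n) sequentially"
proof -
  define u :: "(int \<Rightarrow> 'x) \<Rightarrow> real" where "u = indicator {y. blk y k 0 = w}"
  define c where "c = (\<lambda>n y. \<Sum>s<n. u (sh (int s) y))"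
  have u_meas [measurable]: "u \<in> borel_measurable P" unfolding u_def by measurable
  have u01: "0 \<le> u y" "u y \<le> 1" for y by (auto simp: u_def indicator_def)
  have u_int: "integrable P u"
    unfolding u_def by (intro integrable_real_indicator) (auto simp: emeasure_eq_measure)
  have c_Suc: "c (Suc n) y = u y + c n (sh 1 y)" for n y
    unfolding c_def sum.lessThan_Suc_shift by (simp add: add.commute)
  have c_card: "c n y = real (card {s. s < n \<and> blk y k s = w})" for n y
  proof -
    have "c n y = (\<Sum>s<n. if blk y k s = w then 1 else 0)"
      unfolding c_def u_def by (intro sum.cong) (auto simp: blk_sh)
    also have "\<dots> = (\<Sum>s | s \<in> {..<n} \<and> blk y k s = w. 1)"
      by (rule sum.inter_filter[symmetric]) simp
    finally show ?thesis by simp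
  qed
  define B where "B = {y. \<forall>j m. \<exists>n\<ge>m. c n y * real (Suc j) < real n}"
  have B_sets: "B \<in> sets P"
  proof -
    have "{y \<in> space P. \<forall>j m. \<exists>n\<in>{m..}. c n y * real (Suc j) < real n} \<in> sets P"
      unfolding c_def by measurable
    then show ?thesis by (simp add: B_def Bex_def)
  qed
  \<comment> \<open>The shift changes \<open>c n\<close> by at most 1; the factor 2 lost in the frequency is absorbed by \<open>j\<close>.\<close>
  have "sh 1 y \<in> B \<longleftrightarrow> y \<in> B" for y
  proof
    assume y: "y \<in> B"
    have "\<exists>n\<ge>m. c n (sh 1 y) * real (Suc j) < real n" for j m
    proof -
      from y obtain n where n: "n \<ge> m + 2" "c n y * real (Suc (2 * j + 1)) < real n"
        unfolding B_def by blast
      then obtain n' where n': "n = Suc n'" by (cases n) auto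
      have "c n' (sh 1 y) \<le> c n y" using u01[of y] by (simp add: n' c_Suc)
      then have "c n' (sh 1 y) * real (Suc (2 * j + 1)) \<le> c n y * real (Suc (2 * j + 1))"
        by (intro mult_right_mono) auto
      with n(2) have "2 * (c n' (sh 1 y) * real (Suc j)) < real n" by (simp add: algebra_simps)
      then have "c n' (sh 1 y) * real (Suc j) < real n'" using n n' by simp
      then show ?thesis using n(1) n' by (intro exI[of _ n']) simp
    qed
    then show "sh 1 y \<in> B" by (simp add: B_def)
  next
    assume y: "sh 1 y \<in> B"
    have "\<exists>n\<ge>m. c n y * real (Suc j) < real n" for j m
    proof -
      from y obtain n where n: "n \<ge> m + 2 * Suc j" "c n (sh 1 y) * real (Suc (2 * j + 1)) < real n"
        unfolding B_def by blast
      have "c (Suc n) y \<le> 1 + c n (sh 1 y)" using u01[of y] by (simp add: c_Suc)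
      then have "c (Suc n) y * real (Suc j) \<le> (1 + c n (sh 1 y)) * real (Suc j)"
        by (intro mult_right_mono) auto
      moreover have "2 * (c n (sh 1 y) * real (Suc j)) < real n"
        using n(2) by (simp add: algebra_simps)
      moreover have "2 * real (Suc j) \<le> real n" using n(1) by linarith
      ultimately have "c (Suc n) y * real (Suc j) < real (Suc n)" by (simp add: distrib_right)
      then show ?thesis using n(1) by (intro exI[of _ "Suc n"]) simp
    qed
    then show "y \<in> B" by (simp add: B_def)
  qed
  then have "sh 1 -` B = B" by auto
  from ergodic[OF B_sets this] have "prob B = 0 \<or> prob B = 1" by simp
  moreover have "prob B \<noteq> 1"
  proof
    assume B1: "prob B = 1"
    then have AE_B: "AE y in P. y \<in> B" using B_sets by (simp add: prob_eq_1 AE_iff_measurable)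
    have "prob {y. blk y k 0 = w} \<le> 1 / real (Suc j)" for j
    proof -
      define f where "f = (\<lambda>y. 1 / real (Suc j) - u y)"
      have f_int: "integrable P f" unfolding f_def using u_int by simp
      have f_sum: "(\<Sum>i<n. f (sh (int i) y)) = real n / real (Suc j) - c n y" for n y
        by (simp add: f_def sum_subtractf c_def)
      have "0 \<le> (\<integral>y. f y * indicator {y. \<exists>n. (\<Sum>i<n. f (sh (int i) y)) > 0} y \<partial>P)"
        by (rule maximal_ergodic[OF f_int])
      also have "\<dots> = (\<integral>y. f y \<partial>P)"
      proof (rule integral_cong_AE)
        have [measurable]: "f \<in> borel_measurable P" using f_int by (rule borel_measurable_integrable)
        have "{y \<in> space P. \<exists>n. (\<Sum>i<n. f (sh (int i) y)) > 0} \<in> sets P" by measurable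
        then have [measurable]: "{y. \<exists>n. (\<Sum>i<n. f (sh (int i) y)) > 0} \<in> sets P" by simp
        show "(\<lambda>y. f y * indicator {y. \<exists>n. (\<Sum>i<n. f (sh (int i) y)) > 0} y) \<in> borel_measurable P"
          by measurable
        show "f \<in> borel_measurable P" by measurable
        show "AE y in P. f y * indicator {y. \<exists>n. (\<Sum>i<n. f (sh (int i) y)) > 0} y = f y"
          using AE_B
        proof eventually_elim
          case (elim y)
          then obtain n where "c n y * real (Suc j) < real n" unfolding B_def by blast
          then have "c n y < real n / real (Suc j)" by (simp only: pos_less_divide_eq of_nat_0_less_iff zero_less_Suc)
          then have "(\<Sum>i<n. f (sh (int i) y)) > 0" unfolding f_sum by simp
          then show ?case by (auto simp: indicator_def)
        qed
      qed
      also have "\<dots> = 1 / real (Suc j) - (\<integral>y. u y \<partial>P)"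
        unfolding f_def using u_int by (subst Bochner_Integration.integral_diff) auto
      also have "(\<integral>y. u y \<partial>P) = prob {y. blk y k 0 = w}" unfolding u_def by simp
      finally show ?thesis by simp
    qed
    moreover obtain j where "1 / real (Suc j) < prob {y. blk y k 0 = w}"
      using nat_approx_posE[OF pos] by auto
    ultimately show False by (meson not_le)
  qed
  ultimately have "B \<in> null_sets P" using B_sets by (simp add: null_sets_def emeasure_eq_measure)
  from AE_not_in[OF this] show ?thesis
  proof eventually_elim
    case (elim y)
    then obtain j m where jm: "\<And>n. n \<ge> m \<Longrightarrow> real n \<le> c n y * real (Suc j)"
      unfolding B_def by (auto simp: not_less)
    have "\<forall>\<^sub>F n in sequentially. real (card {s. s < n \<and> blk y k s = w}) \<ge> 1 / real (Suc j) * real n"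
      using eventually_ge_at_top[of m]
    proof eventually_elim
      case (elim n)
      then show ?case using jm[OF elim] unfolding c_card
        by (simp only: pos_divide_le_eq of_nat_0_less_iff zero_less_Suc times_divide_eq_left mult_1)
    qed
    then show ?case by (intro exI[of _ "1 / real (Suc j)"]) simp
  qed
qed

text \<open>Linear growth of the count beats J_n, which is of order sqrt n. The extra k pays for the
  positions s < k - 1, which \<open>occ\<close> discards. A word of probability 0 almost surely
  never appears at a time s \<ge> 0.\<close>

lemma AE_word_count_ge:
  "AE y in P. (\<forall>s. blk y k s \<noteq> w) \<or>
     eventually (\<lambda>n. J_par n + k \<le> card {s. s < n \<and> blk y k s = w}) sequentially"
proof (cases "prob {y. blk y k 0 = w} = 0")
  case True
  have "AE y in P. blk y k 0 \<noteq> w"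
    using AE_not_in[of "{y. blk y k 0 = w}" P] True by (simp add: null_sets_def emeasure_eq_measure)
  then have "AE y in P. \<forall>s. blk (sh (int s) y) k 0 \<noteq> w"
    unfolding AE_all_countable by (intro allI AE_sh)
  then show ?thesis by eventually_elim (simp add: blk_sh)
next
  case False
  then have "prob {y. blk y k 0 = w} > 0" by (simp add: zero_less_measure_iff)
  from AE_word_frequency[OF this] show ?thesis
  proof eventually_elim
    case (elim y)
    then obtain r where r: "r > 0"
      "\<forall>\<^sub>F n in sequentially. real (card {s. s < n \<and> blk y k s = w}) \<ge> r * real n" by blast
    have "\<forall>\<^sub>F n in sequentially. sqrt (real n) + 1 + real k \<le> r * real n"
      using r(1) by real_asymp
    with r(2) have "\<forall>\<^sub>F n in sequentially. J_par n + k \<le> card {s. s < n \<and> blk y k s = w}"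
    proof eventually_elim
      case (elim n)
      then have "real (J_par n) + real k \<le> real (card {s. s < n \<and> blk y k s = w})"
        using J_par_le[of n] by linarith
      then show ?case by linarith
    qed
    then show ?case ..
  qed
qed

text \<open>There are finitely many words of length k, so from some n on every word that appears at
  all has enough occurrences, whichever of them is the current block. Two letters are required for
  K_n to tend to infinity.\<close>

lemma AE_kappa_unbounded:
  assumes "CARD('x) \<ge> 2"
  shows "AE y in P. \<forall>k. eventually (\<lambda>n. k \<le> kappa CARD('x) y n) sequentially"
proof -
  have "AE y in P. \<forall>k. \<forall>w. (\<forall>s. blk y k s \<noteq> w) \<or>
     eventually (\<lambda>n. J_par n + k \<le> card {s. s < n \<and> blk y k s = w}) sequentially"
    unfolding AE_all_countable by (intro allI AE_word_count_ge)
  then show ?thesis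
  proof (eventually_elim, intro allI)
    fix y :: "int \<Rightarrow> 'x" and k :: nat
    assume *: "\<forall>k. \<forall>w. (\<forall>s. blk y k s \<noteq> w) \<or>
     eventually (\<lambda>n. J_par n + k \<le> card {s. s < n \<and> blk y k s = w}) sequentially"
    have "\<forall>\<^sub>F n in sequentially. \<forall>w\<in>{w. length w = k}. (\<forall>s. blk y k s \<noteq> w) \<or>
        J_par n + k \<le> card {s. s < n \<and> blk y k s = w}"
    proof (intro eventually_ball_finite ballI)
      fix w
      from * show "\<forall>\<^sub>F n in sequentially. (\<forall>s. blk y k s \<noteq> w) \<or>
        J_par n + k \<le> card {s. s < n \<and> blk y k s = w}"
      proof -
        consider "\<forall>s. blk y k s \<noteq> w" | "\<forall>\<^sub>F n in sequentially. J_par n + k \<le> card {s. s < n \<and> blk y k s = w}"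
          using * by blast
        then show ?thesis by cases (auto elim: eventually_mono)
      qed
    qed simp
    then show "eventually (\<lambda>n. k \<le> kappa CARD('x) y n) sequentially"
      using K_par_tendsto[OF assms, of k]
    proof eventually_elim
      case (elim n)
      let ?w = "blk y k n"
      have "J_par n + k \<le> card {s. s < n \<and> blk y k s = ?w}"
        using elim(1)[rule_format, of ?w] by auto
      also have "\<dots> \<le> card (occ y k n \<union> {..<k})"
        by (intro card_mono) (auto simp: occ_def)
      also have "\<dots> \<le> card (occ y k n) + k"
        using card_Un_le[of "occ y k n" "{..<k}"] by simp
      finally have "J_par n \<le> card (occ y k n)" by simp
      then show ?case using elim(2) by (cases "k = 0") (auto intro!: kappa_ge)
    qed
  qed
qed

end

section \<open>Reduction to counting bounds\<close>

definition err :: "(int \<Rightarrow> 'x::finite) measure \<Rightarrow> ('x \<Rightarrow> real) \<Rightarrow> nat \<Rightarrow> (int \<Rightarrow> 'x) \<Rightarrow> real" where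
  "err P g n y = \<bar>g_est g y n - pred_at P g n y\<bar>"

lemma K_par_le:
  assumes "a \<ge> 1" "n \<ge> 1"
  shows "K_par a n \<le> n"
proof (cases "a = 1")
  case True
  then show ?thesis using assms by (simp add: K_par_def log_def)
next
  case False
  then have a: "2 \<le> a" using assms by simp
  have "n < 2 ^ n" by simp
  also have "\<dots> \<le> a ^ n" using a by (intro power_mono) auto
  finally have "real n \<le> real (a ^ n)" by simp
  then have "real n \<le> real a powr real n" using a by (simp add: powr_realpow)
  then have "log (real a) (real n) \<le> real n"
    using a assms by (subst log_le_iff) auto
  moreover have "log (real a) (real n) \<ge> 0" using a assms by (simp add: log_def)
  ultimately have "0.1 * log (real a) (real n) \<le> real n" by simp
  then have "nat \<lfloor>0.1 * log (real a) (real n)\<rfloor> \<le> n" by linarith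
  then show ?thesis using assms by (simp add: K_par_def)
qed

text \<open>If kappa_i < K_i, the block of length K_i ending at i has fewer than J_i \<le> J_n
  predecessors. Such times are counted for each length and each word, and the total is of order
  n^0.7 = o(n).\<close>

lemma card_kappa_lt_K_par_le:
  fixes y :: "int \<Rightarrow> 'x::finite"
  assumes n: "n \<ge> 1"
  shows "real (card {i. 1 \<le> i \<and> i < n \<and> kappa CARD('x) y i < K_par CARD('x) i})
    \<le> (real CARD('x) * real n powr 0.1)\<^sup>2 * (sqrt (real n) + 1)"
proof -
  let ?A = "CARD('x)"
  let ?K = "K_par ?A"
  have A: "1 \<le> ?A" by (simp add: Suc_leI)
  define R where "R = (\<lambda>K. {i \<in> {i. 1 \<le> i \<and> i < n \<and> ?K i = K}.
    card {s. K - 1 \<le> s \<and> s < i \<and> blk y K s = blk y K i} < J_par n})"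
  have "card (R K) \<le> card {w::'x list. length w = K} * J_par n" for K
    unfolding R_def
  proof (rule card_rare_le)
    \<comment> \<open>Grouping by the value K of K_i gives a common window start K - 1, and K_i
      \<le> i puts every index of the group at or beyond it.\<close>
    fix i i' assume "i' \<in> {i. 1 \<le> i \<and> i < n \<and> ?K i = K}"
    then show "K - 1 \<le> i'" using K_par_le[OF A, of i'] by auto
  qed auto
  then have R: "card (R K) \<le> ?A ^ K * J_par n" for K
    by (simp only: card_words)
  have "{i. 1 \<le> i \<and> i < n \<and> kappa ?A y i < ?K i} \<subseteq> (\<Union>K\<in>{1..?K n}. R K)"
  proof
    fix i assume i: "i \<in> {i. 1 \<le> i \<and> i < n \<and> kappa ?A y i < ?K i}"
    then have "card (occ y (?K i) i) < J_par i"
      using kappa_ge[of "?K i" ?A i y] K_par_pos[of ?A i] by (auto simp: not_le[symmetric])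
    also have "J_par i \<le> J_par n" using i by (intro J_par_mono) auto
    finally have "i \<in> R (?K i)" using i by (simp add: R_def occ_def)
    moreover have "?K i \<le> ?K n" using i A by (intro K_par_mono) auto
    ultimately show "i \<in> (\<Union>K\<in>{1..?K n}. R K)" using K_par_pos[of ?A i] by auto
  qed
  then have "card {i. 1 \<le> i \<and> i < n \<and> kappa ?A y i < ?K i} \<le> card (\<Union>K\<in>{1..?K n}. R K)"
    by (intro card_mono finite_UN_I) (auto simp: R_def)
  also have "\<dots> \<le> (\<Sum>K\<in>{1..?K n}. card (R K))" by (intro card_UN_le) auto
  also have "\<dots> \<le> (\<Sum>K\<in>{1..?K n}. ?A ^ ?K n * J_par n)"
    using A by (intro sum_mono order_trans[OF R] mult_right_mono power_increasing) auto
  also have "\<dots> = ?K n * (?A ^ ?K n * J_par n)" by simp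
  also have "\<dots> \<le> ?A ^ ?K n * (?A ^ ?K n * J_par n)"
    by (intro mult_right_mono K_par_le_pow A) auto
  finally have "real (card {i. 1 \<le> i \<and> i < n \<and> kappa ?A y i < ?K i})
      \<le> real (?A ^ ?K n * (?A ^ ?K n * J_par n))" by (simp only: of_nat_le_iff)
  also have "\<dots> = real (?A ^ ?K n) * real (?A ^ ?K n) * real (J_par n)" by simp
  also have "\<dots> \<le> (real ?A * real n powr 0.1) * (real ?A * real n powr 0.1) * (sqrt (real n) + 1)"
    using card_pow_K_par_le[OF A n] J_par_le[of n] by (intro mult_mono) auto
  finally show ?thesis by (simp add: power2_eq_square)
qed

text \<open>The covering bound needs labels of one length. On this range of i the length K_i takes
  at most m + 2 values, and the bound is applied once for each of them.\<close>

lemma card_occ_average_large_le: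
  fixes y :: "int \<Rightarrow> 'x::finite" and d :: "nat \<Rightarrow> real"
  assumes d: "\<And>s. 0 \<le> d s" and e: "e > 0" and n: "n \<ge> 1"
  shows "e * real (card {i. i < n \<and> n \<le> i * 2 ^ (10 * m) \<and>
      (\<Sum>s\<in>occ y (K_par CARD('x) i) i. d s) > e * real (card (occ y (K_par CARD('x) i) i))})
    \<le> real (m + 2) * (2 * (\<Sum>s<n. d s))"
proof -
  let ?A = "CARD('x)"
  let ?K = "K_par ?A"
  have A: "1 \<le> ?A" by (simp add: Suc_leI)
  define R where "R = (\<lambda>K. {i \<in> {..<n}.
    (\<Sum>s | K - 1 \<le> s \<and> s < i \<and> blk y K s = blk y K i. d s) >
      e * real (card {s. K - 1 \<le> s \<and> s < i \<and> blk y K s = blk y K i})})"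
  have R: "e * real (card (R K)) \<le> 2 * (\<Sum>s<n. d s)" for K
    unfolding R_def by (rule card_maximal_le[OF d e]) simp
  let ?B = "{i. i < n \<and> n \<le> i * 2 ^ (10 * m) \<and>
      (\<Sum>s\<in>occ y (?K i) i. d s) > e * real (card (occ y (?K i) i))}"
  have sub: "?B \<subseteq> (\<Union>K\<in>{?K n - (m + 1)..?K n}. R K)"
  proof
    fix i assume i: "i \<in> ?B"
    then have "i \<ge> 1" using n by (cases i) auto
    then have "?K n \<le> ?K i + m + 1" using i n A by (intro K_par_slow) auto
    moreover have "?K i \<le> ?K n" using i \<open>i \<ge> 1\<close> A by (intro K_par_mono) auto
    moreover have "i \<in> R (?K i)" using i by (simp add: R_def occ_def)
    ultimately show "i \<in> (\<Union>K\<in>{?K n - (m + 1)..?K n}. R K)" by (intro UN_I[of "?K i"]) auto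
  qed
  have "card ?B \<le> card (\<Union>K\<in>{?K n - (m + 1)..?K n}. R K)"
    using sub by (intro card_mono finite_UN_I) (auto simp: R_def)
  also have "\<dots> \<le> (\<Sum>K\<in>{?K n - (m + 1)..?K n}. card (R K))" by (intro card_UN_le) auto
  finally have "e * real (card ?B) \<le> e * real (\<Sum>K\<in>{?K n - (m + 1)..?K n}. card (R K))"
    using e by (intro mult_left_mono) (simp_all only: of_nat_le_iff)
  also have "\<dots> = (\<Sum>K\<in>{?K n - (m + 1)..?K n}. e * real (card (R K)))" by (simp add: sum_distrib_left)
  also have "\<dots> \<le> (\<Sum>K\<in>{?K n - (m + 1)..?K n}. 2 * (\<Sum>s<n. d s))" by (intro sum_mono R)
  also have "\<dots> = real (card {?K n - (m + 1)..?K n}) * (2 * (\<Sum>s<n. d s))" by simp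
  also have "\<dots> \<le> real (m + 2) * (2 * (\<Sum>s<n. d s))"
    using d by (intro mult_right_mono) (auto intro!: sum_nonneg)
  finally show ?thesis .
qed

text \<open>The occurrences seen by a shifted path are those of the original path in a translated
  window. All shifts of a window of length n thus fall under the counting lemmas, which is why these
  allow the window start to depend on the index.\<close>

lemma occ_sh:
  "occ (sh (int i) y) k n = (\<lambda>t. t - i) ` {t. i + (k - 1) \<le> t \<and> t < i + n \<and> blk y k t = blk y k (i + n)}"
  (is "_ = ?h ` ?T")
proof (intro equalityI subsetI)
  fix s assume "s \<in> occ (sh (int i) y) k n"
  then have "i + s \<in> ?T" by (auto simp: occ_def blk_sh)
  then show "s \<in> ?h ` ?T" by (intro image_eqI[of _ _ "i + s"]) auto
qed (auto simp: occ_def blk_sh)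

lemma
  shows card_occ_sh: "card (occ (sh (int i) y) k n) =
      card {t. i + (k - 1) \<le> t \<and> t < i + n \<and> blk y k t = blk y k (i + n)}"
    and sum_occ_sh: "(\<Sum>s\<in>occ (sh (int i) y) k n. f (sh (int s) (sh (int i) y))) =
      (\<Sum>t | i + (k - 1) \<le> t \<and> t < i + n \<and> blk y k t = blk y k (i + n). f (sh (int t) y))"
proof -
  let ?T = "{t. i + (k - 1) \<le> t \<and> t < i + n \<and> blk y k t = blk y k (i + n)}"
  have inj: "inj_on (\<lambda>t. t - i) ?T" by (auto simp: inj_on_def)
  show "card (occ (sh (int i) y) k n) = card ?T"
    unfolding occ_sh by (rule card_image[OF inj])
  show "(\<Sum>s\<in>occ (sh (int i) y) k n. f (sh (int s) (sh (int i) y))) = (\<Sum>t\<in>?T. f (sh (int t) y))"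
    unfolding occ_sh by (subst sum.reindex[OF inj]) (auto intro!: sum.cong)
qed

text \<open>A shift i is identified with the end i + n of its window. The assumption on N makes each
  of the N windows start no later than any of them ends, as the hypothesis \<open>start\<close> of
  \<open>card_rare_le\<close> demands.\<close>

lemma card_shifts_rare_le:
  fixes y :: "int \<Rightarrow> 'x::finite"
  assumes "N + K \<le> n + 1"
  shows "card {i. i < N \<and> card (occ (sh (int i) y) K n) < J} \<le> CARD('x) ^ K * J"
proof -
  define a where "a = (\<lambda>j. j - n + (K - 1))"
  have "{i. i < N \<and> card (occ (sh (int i) y) K n) < J} \<subseteq>
     (\<lambda>j. j - n) ` {j \<in> {n..<n + N}. card {t. a j \<le> t \<and> t < j \<and> blk y K t = blk y K j} < J}"
    (is "_ \<subseteq> _ ` ?R")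
  proof
    fix i assume "i \<in> {i. i < N \<and> card (occ (sh (int i) y) K n) < J}"
    then have "i + n \<in> ?R" by (simp add: card_occ_sh a_def)
    then show "i \<in> (\<lambda>j. j - n) ` ?R" by (intro image_eqI[of _ _ "i + n"]) auto
  qed
  then have "card {i. i < N \<and> card (occ (sh (int i) y) K n) < J} \<le> card ((\<lambda>j. j - n) ` ?R)"
    by (intro card_mono) auto
  also have "\<dots> \<le> card ?R" by (rule card_image_le) simp
  also have "\<dots> \<le> card {w::'x list. length w = K} * J"
    using assms by (intro card_rare_le) (auto simp: a_def)
  finally show ?thesis by (simp add: card_words)
qed

lemma card_shifts_average_large_le:
  fixes y :: "int \<Rightarrow> 'x::finite" and f :: "(int \<Rightarrow> 'x) \<Rightarrow> real"
  assumes f: "\<And>y. 0 \<le> f y" and e: "e > 0"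
  shows "e * real (card {i. i < N \<and> (\<Sum>s\<in>occ (sh (int i) y) K n. f (sh (int s) (sh (int i) y))) >
      e * real (card (occ (sh (int i) y) K n))}) \<le> 2 * (\<Sum>s<n + N. f (sh (int s) y))"
proof -
  define a where "a = (\<lambda>j. j - n + (K - 1))"
  let ?R = "{j \<in> {n..<n + N}. (\<Sum>t | a j \<le> t \<and> t < j \<and> blk y K t = blk y K j. f (sh (int t) y)) >
     e * real (card {t. a j \<le> t \<and> t < j \<and> blk y K t = blk y K j})}"
  let ?B = "{i. i < N \<and> (\<Sum>s\<in>occ (sh (int i) y) K n. f (sh (int s) (sh (int i) y))) >
      e * real (card (occ (sh (int i) y) K n))}"
  have "?B \<subseteq> (\<lambda>j. j - n) ` ?R"
  proof
    fix i assume i: "i \<in> ?B"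
    have "i + n \<in> ?R" using i unfolding card_occ_sh sum_occ_sh by (simp add: a_def)
    then show "i \<in> (\<lambda>j. j - n) ` ?R" by (intro image_eqI[of _ _ "i + n"]) auto
  qed
  then have "card ?B \<le> card ((\<lambda>j. j - n) ` ?R)" by (intro card_mono) auto
  also have "\<dots> \<le> card ?R" by (rule card_image_le) simp
  finally have "e * real (card ?B) \<le> e * real (card ?R)" using e by (intro mult_left_mono) auto
  also have "\<dots> \<le> 2 * (\<Sum>s<n + N. f (sh (int s) y))"
    by (rule card_maximal_le) (use f e in auto)
  finally show ?thesis .
qed

context path_measure
begin

text \<open>Each earlier occurrence s agrees with n in the last k + 1 symbols, so G_k takes the same
  value at both times, and C_s and C_n differ from it by at most the respective D_k because k \<le>
  s < n. One e pays for the martingale noise and one for the average of D_k.\<close>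

lemma err_le_fluct:
  assumes nd: "y \<notin> deviant P g e n" and k: "Suc k \<le> kappa CARD('x) y n"
    and avg: "(\<Sum>s\<in>occ y (kappa CARD('x) y n) n. fluct P g k (sh (int s) y))
      \<le> e * real (card (occ y (kappa CARD('x) y n) n))"
  shows "err P g n y \<le> 2 * e + fluct P g k (sh (int n) y)"
proof -
  define K where "K = kappa CARD('x) y n"
  define S where "S = occ y K n"
  have K: "1 \<le> K" "K \<le> K_par CARD('x) n" "J_par n \<le> card S"
    using kappa_cases[of "CARD('x)" y n] k by (auto simp: K_def S_def)
  then have S: "real (card S) > 0" using J_par_pos[of n] by simp
  have dev: "\<bar>\<Sum>s\<in>S. incr P g s y\<bar> \<le> e * real (card S)"
    using nd K unfolding deviant_def S_def by (auto simp: not_less)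
  have near: "\<bar>pred_at P g s y - pred_at P g n y\<bar> \<le> fluct P g k (sh (int s) y) + fluct P g k (sh (int n) y)"
    if s: "s \<in> S" for s
  proof -
    have "k \<le> s" "s < n" using s k unfolding S_def occ_def K_def by auto
    have "blk y K s = blk y K n" using s by (simp add: S_def occ_def)
    then have "blk y (Suc k) s = blk y (Suc k) n"
      by (rule blk_eq_mono) (use k in \<open>simp add: K_def\<close>)
    then have *: "\<And>j. j < Suc k \<Longrightarrow> y (int s - int j) = y (int n - int j)" by (simp add: blk_eq_iff)
    have "fwd P g k (sh (int s) y) = fwd P g k (sh (int n) y)"
    proof (rule dep_eq[OF dep_fwd])
      fix i :: int assume "i \<in> {- int k..0}"
      then show "sh (int s) y i = sh (int n) y i"
        using *[of "nat (- i)"] by (simp add: sh_def add.commute nat_less_iff)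
    qed
    then show ?thesis
      using fluct_ge[of k s g "sh (int s) y"] fluct_ge[of k n g "sh (int n) y"] \<open>k \<le> s\<close> \<open>s < n\<close>
      unfolding pred_at_def by linarith
  qed
  have "(g_est g y n - pred_at P g n y) * real (card S) =
      (\<Sum>s\<in>S. incr P g s y) + (\<Sum>s\<in>S. pred_at P g s y - pred_at P g n y)"
    using K S by (simp add: g_est_eq[of y n g] S_def K_def incr_def sum_subtractf field_simps)
  then have "err P g n y * real (card S) \<le>
      \<bar>\<Sum>s\<in>S. incr P g s y\<bar> + \<bar>\<Sum>s\<in>S. pred_at P g s y - pred_at P g n y\<bar>"
    unfolding err_def using S by (simp add: abs_mult_pos[symmetric])
  also have "\<bar>\<Sum>s\<in>S. pred_at P g s y - pred_at P g n y\<bar> \<le>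
      (\<Sum>s\<in>S. fluct P g k (sh (int s) y) + fluct P g k (sh (int n) y))"
    by (intro order_trans[OF sum_abs] sum_mono near)
  also have "\<dots> \<le> e * real (card S) + fluct P g k (sh (int n) y) * real (card S)"
    using avg by (simp add: sum.distrib S_def K_def mult.commute)
  finally have "err P g n y * real (card S) \<le> (2 * e + fluct P g k (sh (int n) y)) * real (card S)"
    using dev by (simp add: algebra_simps)
  then show ?thesis using S by simp
qed

lemma err_le:
  assumes b: "\<And>x. \<bar>g x\<bar> \<le> b"
  shows "err P g n y \<le> 2 * b"
proof -
  have b0: "b \<ge> 0" using b[of undefined] by linarith
  have "\<bar>g_est g y n\<bar> \<le> b"
  proof (cases "kappa CARD('x) y n > 0")
    case True
    let ?S = "occ y (kappa CARD('x) y n) n"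
    have S: "real (card ?S) > 0"
      using kappa_cases[of "CARD('x)" y n] True J_par_pos[of n] by auto
    have "\<bar>\<Sum>s\<in>?S. g (y (int s + 1))\<bar> \<le> (\<Sum>s\<in>?S. b)"
      by (intro order_trans[OF sum_abs] sum_mono b)
    then show ?thesis using S by (simp add: g_est_eq[OF True] abs_divide pos_divide_le_eq mult.commute)
  qed (simp add: g_est_def b0)
  then show ?thesis
    using abs_fwd_le[where g = g, OF b, where s = n and y = "sh (int n) y"]
    unfolding err_def pred_at_def by linarith
qed

lemma err_eq_0_of_card_1:
  assumes "CARD('x) = 1" "n \<ge> 1"
  shows "err P g n y = 0"
proof -
  have eq: "x = x'" for x x' :: 'x using assms(1) by (metis UNIV_I card_1_singletonE singletonD)
  then have eqf: "y = z" for y z :: "int \<Rightarrow> 'x" by (intro ext)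
  define c where "c = g undefined"
  have gc: "g x = c" for x unfolding c_def by (rule arg_cong[OF eq])
  have cyl: "cyl I y = UNIV" for I and y :: "int \<Rightarrow> 'x"
    unfolding cyl_def by (auto intro: eq)
  have p: "pred_at P g n y = c"
    by (simp add: pred_at_def fwd_def cexp_def cyl gc)
  have "occ y 1 n = {..<n}" by (auto simp: occ_def blk_def intro: eq)
  moreover have "J_par n \<le> n"
  proof -
    have "sqrt (real n) \<le> real n" using assms(2) by (intro real_le_lsqrt) (auto simp: power2_eq_square)
    then show ?thesis using assms(2) unfolding J_par_def by (simp add: nat_le_iff ceiling_le_iff)
  qed
  ultimately have "1 \<le> kappa CARD('x) y n" using K_par_pos by (intro kappa_ge) auto
  then have k: "kappa CARD('x) y n > 0" by simp
  have "real (card (occ y (kappa CARD('x) y n) n)) > 0"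
    using kappa_cases[of "CARD('x)" y n] k J_par_pos[of n] by auto
  then have "g_est g y n = c" unfolding g_est_eq[OF k] gc by auto
  then show ?thesis by (simp add: err_def p)
qed

lemma dep_g_est: "dep {- int (n + K_par CARD('x) n)..int n} (\<lambda>y :: int \<Rightarrow> 'x. g_est g y n)"
  unfolding dep_def
proof (intro allI impI)
  let ?I = "{- int (n + K_par CARD('x) n)..int n}"
  fix y z :: "int \<Rightarrow> 'x" assume *: "\<forall>i\<in>?I. y i = z i"
  have o: "occ y k n = occ z k n" if "k \<le> K_par CARD('x) n" for k
    by (rule dep_eq[OF dep_occ]) (use * that in auto)
  then have kap: "kappa CARD('x) y n = kappa CARD('x) z n"
    unfolding kappa_def by (auto simp: card_rec_times Let_def cong: conj_cong)
  show "g_est g y n = g_est g z n"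
  proof (cases "kappa CARD('x) z n > 0")
    case True
    then have True': "kappa CARD('x) y n > 0" by (simp add: kap)
    have "(\<Sum>s\<in>occ z (kappa CARD('x) z n) n. g (y (int s + 1))) =
          (\<Sum>s\<in>occ z (kappa CARD('x) z n) n. g (z (int s + 1)))"
      by (intro sum.cong arg_cong[where f = g] *[rule_format]) (auto simp: occ_def)
    then show ?thesis
      unfolding g_est_eq[OF True] g_est_eq[OF True'] kap o[OF kappa_le] by simp
  qed (simp add: g_est_def kap)
qed

lemma dep_err: "dep {- int (n + K_par CARD('x) n)..int n} (err P g n)"
  unfolding err_def[abs_def]
  by (intro dep_comp2[of _ _ _ "\<lambda>a b. \<bar>a - b\<bar>"] dep_g_est dep_mono[OF dep_pred_at]) auto

end

section \<open>Convergence on path space\<close>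

text \<open>By stationarity the left side is the expected number of shifts i < N at which the event
  holds. A pathwise count thereby bounds the probability at a single time.\<close>

lemma (in stationary_path) prob_le_of_card_shifts:
  fixes F :: "(int \<Rightarrow> 'x) \<Rightarrow> real"
  assumes E [measurable]: "{y. Q y} \<in> sets P" and F: "integrable P F"
    and le: "\<And>y. real (card {i. i < N \<and> Q (sh (int i) y)}) \<le> F y"
  shows "real N * prob {y. Q y} \<le> (\<integral>y. F y \<partial>P)"
proof -
  have sets: "{y. Q (sh (int i) y)} \<in> sets P" for i by (rule sets_sh) (rule E)
  have int: "integrable P (indicator {y. Q (sh (int i) y)} :: _ \<Rightarrow> real)" for i
    using sets by (intro integrable_real_indicator) (auto simp: emeasure_eq_measure)
  have "real N * prob {y. Q y} = (\<Sum>i<N. prob {y. Q (sh (int i) y)})"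
    by (simp add: prob_sh[OF E])
  also have "\<dots> = (\<integral>y. (\<Sum>i<N. indicator {y. Q (sh (int i) y)} y) \<partial>P)"
    using sets by (subst Bochner_Integration.integral_sum[OF int]) simp
  also have "\<dots> \<le> (\<integral>y. F y \<partial>P)"
  proof (rule integral_mono[OF Bochner_Integration.integrable_sum[OF int] F])
    fix y
    have "(\<Sum>i<N. indicator {y. Q (sh (int i) y)} y :: real) = (\<Sum>i<N. if Q (sh (int i) y) then 1 else 0)"
      by (intro sum.cong) auto
    also have "\<dots> = (\<Sum>i | i \<in> {..<N} \<and> Q (sh (int i) y). 1)"
      by (rule sum.inter_filter[symmetric]) simp
    also have "\<dots> \<le> F y" using le[of y] by simp
    finally show "(\<Sum>i<N. indicator {y. Q (sh (int i) y)} y) \<le> F y" .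
  qed
  finally show ?thesis .
qed

context ergodic_path
begin

lemma AE_not_deviant_all:
  "AE y in P. \<forall>e>0. eventually (\<lambda>n. y \<notin> deviant P g e n) sequentially"
proof -
  have "AE y in P. \<forall>j. eventually (\<lambda>n. y \<notin> deviant P g (1 / real (Suc j)) n) sequentially"
    unfolding AE_all_countable by (intro allI AE_eventually_not_deviant) simp
  then show ?thesis
  proof (eventually_elim, intro allI impI)
    fix y and e :: real
    assume *: "\<forall>j. eventually (\<lambda>n. y \<notin> deviant P g (1 / real (Suc j)) n) sequentially" and e: "e > 0"
    obtain j where j: "1 / real (Suc j) < e" using nat_approx_posE[OF e] by auto
    from *[rule_format, of j] show "eventually (\<lambda>n. y \<notin> deviant P g e n) sequentially"
    proof eventually_elim
      case (elim n)
      have mono: "1 / real (Suc j) * real c \<le> e * real c" for c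
        using j by (intro mult_right_mono) auto
      show ?case
      proof
        assume "y \<in> deviant P g e n"
        then have "y \<in> deviant P g (1 / real (Suc j)) n"
          unfolding deviant_def mem_Collect_eq by (meson mono order.strict_trans1)
        then show False using elim by blast
      qed
    qed
  qed
qed

text \<open>Continuity enters only through \<open>uc\<close>. An almost sure uniform bound on D_k
  holds at all shifts simultaneously, hence also for averages over any selected set of
  occurrences.\<close>

lemma AE_err_tendsto_0:
  assumes uc: "\<And>e. e > 0 \<Longrightarrow> \<exists>k. AE y in P. fluct P g k y \<le> e"
  shows "AE y in P. (\<lambda>n. err P g n y) \<longlonglongrightarrow> 0"
proof (cases "CARD('x) = 1")
  case True
  have "(\<lambda>n. err P g n y) \<longlonglongrightarrow> 0" for y
    by (intro tendsto_eventually eventually_mono[OF eventually_ge_at_top[of 1]])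
       (simp add: err_eq_0_of_card_1[OF True])
  then show ?thesis by simp
next
  case False
  then have "CARD('x) \<ge> 2" using zero_less_card_finite[where 'a = 'x] by linarith
  from AE_kappa_unbounded[OF this]
  have kap: "AE y in P. \<forall>k. eventually (\<lambda>n. k \<le> kappa CARD('x) y n) sequentially" .
  have "\<exists>k. AE y in P. fluct P g k y \<le> 1 / real (Suc j)" for j by (rule uc) simp
  then obtain k where "\<And>j. AE y in P. fluct P g (k j) y \<le> 1 / real (Suc j)" by metis
  then have "AE y in P. \<forall>j. \<forall>s. fluct P g (k j) (sh (int s) y) \<le> 1 / real (Suc j)"
    unfolding AE_all_countable by (intro allI AE_sh)
  with kap AE_not_deviant_all[of g] show ?thesis
  proof eventually_elim
    case (elim y)
    show ?case
    proof (rule LIMSEQ_I)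
      fix r :: real assume r: "r > 0"
      then have r4: "r / 4 > 0" by simp
      \<comment> \<open>The error bound will be 2 (r / 4) + r / 4, strictly below r.\<close>
      obtain j where j: "1 / real (Suc j) < r / 4" using nat_approx_posE[OF r4] by auto
      have fl: "fluct P g (k j) (sh (int s) y) \<le> r / 4" for s
        using elim(3)[rule_format, of j s] j by linarith
      have "\<forall>\<^sub>F n in sequentially. y \<notin> deviant P g (r / 4) n" using elim(2) r4 by blast
      with elim(1)[rule_format, of "Suc (k j)"]
      have "\<forall>\<^sub>F n in sequentially. norm (err P g n y - 0) < r"
      proof eventually_elim
        case (elim n)
        have "(\<Sum>s\<in>occ y (kappa CARD('x) y n) n. fluct P g (k j) (sh (int s) y)) \<le>
            (\<Sum>s\<in>occ y (kappa CARD('x) y n) n. r / 4)"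
          by (intro sum_mono fl)
        then have "err P g n y \<le> 2 * (r / 4) + fluct P g (k j) (sh (int n) y)"
          by (intro err_le_fluct elim) (simp add: mult.commute)
        then show ?case using fl[of n] r by (simp add: err_def)
      qed
      then show "\<exists>no. \<forall>n\<ge>no. norm (err P g n y - 0) < r" by (simp add: eventually_sequentially)
    qed
  qed
qed

lemma AE_average_err_tendsto_0:
  "AE y in P. (\<lambda>n. (1 / real n) * (\<Sum>i<n. err P g i y)) \<longlonglongrightarrow> 0"
proof (cases "CARD('x) = 1")
  case True
  have "(\<lambda>n. (1 / real n) * (\<Sum>i<n. err P g i y)) \<longlonglongrightarrow> 0" for y
  proof (rule tendsto_sandwich[OF _ _ tendsto_const])
    show "\<forall>\<^sub>F n in sequentially. 0 \<le> (1 / real n) * (\<Sum>i<n. err P g i y)"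
      by (auto intro!: always_eventually sum_nonneg mult_nonneg_nonneg simp: err_def)
    have "(\<Sum>i<n. err P g i y) \<le> err P g 0 y" for n
    proof (cases n)
      case (Suc m)
      have "(\<Sum>i<n. err P g i y) = err P g 0 y + (\<Sum>i<m. err P g (Suc i) y)"
        unfolding Suc by (rule sum.lessThan_Suc_shift)
      then show ?thesis by (simp add: err_eq_0_of_card_1[OF True])
    qed (simp add: err_def)
    then show "\<forall>\<^sub>F n in sequentially. (1 / real n) * (\<Sum>i<n. err P g i y) \<le> (1 / real n) * err P g 0 y"
      by (intro always_eventually allI mult_left_mono) auto
    show "(\<lambda>n. (1 / real n) * err P g 0 y) \<longlonglongrightarrow> 0"
      by (rule tendsto_mult_left_zero[OF lim_1_over_n])
  qed
  then show ?thesis by simp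
next
  case False
  then have A2: "CARD('x) \<ge> 2" using zero_less_card_finite[where 'a = 'x] by linarith
  define b where "b = max 1 (Max (range (\<lambda>x. \<bar>g x\<bar>)))"
  have b: "\<bar>g x\<bar> \<le> b" for x unfolding b_def by (intro max.coboundedI2 Max_ge) auto
  have b1: "b > 0" by (simp add: b_def)
  show ?thesis
    using AE_not_deviant_all[of g] AE_fluct_average_small[of g]
  proof eventually_elim
    case (elim y)
    let ?A = "CARD('x)"
    let ?E = "\<lambda>n. \<Sum>i<n. err P g i y"
    let ?z = "\<lambda>n. (real CARD('x) * real n powr 0.1)\<^sup>2 * (sqrt (real n) + 1)"
    show ?case
    proof (rule LIMSEQ_I)
      fix r :: real assume r: "r > 0"
      \<comment> \<open>The final bound is 5 e, plus a remainder that is eventually below e.\<close>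
      define e where "e = r / 10"
      have e: "e > 0" using r by (simp add: e_def)
      \<comment> \<open>The order of choices matters: m makes the early indices, a share of at most
        2^(- m) up to one index, negligible against the error bound 2 b; \<delta> then absorbs the
        factor m + 2 of the covering bound; and k is chosen for \<delta>.\<close>
      obtain m0 where m0: "(1 / 2 :: real) ^ m0 < e / (2 * b)"
        using real_arch_pow_inv[of "e / (2 * b)" "1 / 2"] e b1 by auto
      define m where "m = m0"
      define \<delta> where "\<delta> = e * min 1 (e / (4 * b * real (m + 2)))"
      have \<delta>: "\<delta> > 0" "\<delta> \<le> e" "2 * b * real (m + 2) * (2 * \<delta>) \<le> e * e"
      proof -
        have pos: "4 * b * real (m + 2) > 0" using b1 by simp
        then show "\<delta> > 0" using e by (simp add: \<delta>_def)
        show "\<delta> \<le> e" using e by (simp add: \<delta>_def)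
        have "\<delta> \<le> e * (e / (4 * b * real (m + 2)))"
          unfolding \<delta>_def using e by (intro mult_left_mono) auto
        then have "(4 * b * real (m + 2)) * \<delta> \<le> (4 * b * real (m + 2)) * (e * (e / (4 * b * real (m + 2))))"
          using pos by (intro mult_left_mono) auto
        also have "\<dots> = e * e" using pos b1 by simp
        finally show "2 * b * real (m + 2) * (2 * \<delta>) \<le> e * e" by (simp add: mult_ac)
      qed
      obtain k where k: "\<And>n. (\<Sum>i<n. fluct P g k (sh (int i) y)) \<le> \<delta> * real n"
        using elim(2) \<delta>(1) by blast
      have "\<forall>\<^sub>F n in sequentially. y \<notin> deviant P g e n \<and> Suc k \<le> K_par ?A n"
        using elim(1) e K_par_tendsto[OF A2] by (auto intro: eventually_conj)
      then obtain n0 where n0: "\<And>n. n \<ge> n0 \<Longrightarrow> y \<notin> deviant P g e n \<and> Suc k \<le> K_par ?A n"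
        by (auto simp: eventually_sequentially)
      \<comment> \<open>The coefficient 5 e collects 2 e from \<open>err_le_fluct\<close>, e from
        the sum of D_k over all times, e from the early indices and e from the covering
        bound.\<close>
      have bound: "?E n \<le> (5 * e) * real n + 2 * b * (real n0 + 2 + ?z n)" if n: "n \<ge> 1" for n
      proof -
        \<comment> \<open>The exceptional times: early ones, where K_i may be much smaller than K_n;
          those with kappa_i < K_i; and those whose occurrences see a large average of D_k. The set
          \<open>{..n0}\<close> in \<open>bad\<close> is the random initial segment before the
          asymptotic statements hold.\<close>
        define L where "L = {i. i < n \<and> \<not> n \<le> i * 2 ^ (10 * m)}"
        define B1 where "B1 = {i. 1 \<le> i \<and> i < n \<and> kappa ?A y i < K_par ?A i}"
        define B2 where "B2 = {i. i < n \<and> n \<le> i * 2 ^ (10 * m) \<and>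
          (\<Sum>s\<in>occ y (K_par ?A i) i. fluct P g k (sh (int s) y)) > e * real (card (occ y (K_par ?A i) i))}"
        define bad where "bad = {..n0} \<union> L \<union> B1 \<union> B2"
        have fin: "finite L" "finite B1" "finite B2" "finite bad"
          by (auto simp: L_def B1_def B2_def bad_def)
        have good: "err P g i y \<le> 2 * e + fluct P g k (sh (int i) y)" if "i < n" "i \<notin> bad" for i
        proof -
          have i: "i > n0" "n \<le> i * 2 ^ (10 * m)" "i \<notin> B1" "i \<notin> B2"
            using that by (auto simp: bad_def L_def)
          then have K: "kappa ?A y i = K_par ?A i"
            using that kappa_le[of ?A y i] by (auto simp: B1_def)
          show ?thesis
            using n0[of i] i that by (intro err_le_fluct) (auto simp: K B2_def not_less)
        qed
        have "err P g i y \<le> 2 * e + fluct P g k (sh (int i) y) + (if i \<in> bad then 2 * b else 0)"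
          if "i < n" for i
          using good[OF that] err_le[where g = g, OF b, where n = i and y = y] fluct_nonneg[of g k "sh (int i) y"] e
          by (cases "i \<in> bad") auto
        then have "?E n \<le> (\<Sum>i<n. 2 * e + fluct P g k (sh (int i) y) + (if i \<in> bad then 2 * b else 0))"
          by (intro sum_mono) auto
        also have "\<dots> = 2 * e * real n + (\<Sum>i<n. fluct P g k (sh (int i) y)) + 2 * b * real (card ({..<n} \<inter> bad))"
          by (simp add: sum.distrib sum.inter_restrict[symmetric] mult_ac)
        also have "\<dots> \<le> 2 * e * real n + e * real n + 2 * b * real (card bad)"
        proof (intro add_mono mult_left_mono order_refl)
          show "(\<Sum>i<n. fluct P g k (sh (int i) y)) \<le> e * real n"
            using k[of n] mult_right_mono[OF \<delta>(2), of "real n"] by simp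
          show "real (card ({..<n} \<inter> bad)) \<le> real (card bad)"
            using fin by (simp add: card_mono)
        qed (use b1 e in auto)
        also have "real (card bad) \<le> (real n0 + 1) + (real n * (1 / 2) ^ m + 1) + ?z n + real (card B2)"
        proof -
          have "card bad \<le> card ({..n0} \<union> L \<union> B1) + card B2"
            unfolding bad_def by (rule card_Un_le)
          also have "card ({..n0} \<union> L \<union> B1) \<le> card ({..n0} \<union> L) + card B1" by (rule card_Un_le)
          also have "card ({..n0} \<union> L) \<le> card {..n0} + card L" by (rule card_Un_le)
          finally have "real (card bad) \<le> (real n0 + 1) + real (card L) + real (card B1) + real (card B2)"
            by simp
          moreover have "real (card L) \<le> real n * (1 / 2) ^ m + 1"
          proof -
            have "L \<subseteq> {..n div 2 ^ m}"
            proof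
              fix i assume "i \<in> L"
              then have "i * 2 ^ (10 * m) < n" by (simp add: L_def)
              moreover have "i * 2 ^ m \<le> i * 2 ^ (10 * m)" by (intro mult_left_mono power_increasing) auto
              ultimately have "i * 2 ^ m \<le> n" by linarith
              then show "i \<in> {..n div 2 ^ m}" by (simp add: less_eq_div_iff_mult_less_eq)
            qed
            then have "card L \<le> n div 2 ^ m + 1" using card_mono[of "{..n div 2 ^ m}" L] by simp
            moreover have "real (n div 2 ^ m) \<le> real n / real (2 ^ m)" by (rule of_nat_div_le_of_nat)
            moreover have "real n / real (2 ^ m) = real n * (1 / 2) ^ m"
              by (simp add: power_one_over field_simps)
            ultimately show ?thesis by linarith
          qed
          moreover have "real (card B1) \<le> ?z n"
            unfolding B1_def by (rule card_kappa_lt_K_par_le[OF n])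
          ultimately show ?thesis by linarith
        qed
        also have "2 * b * ((real n0 + 1) + (real n * (1 / 2) ^ m + 1) + ?z n + real (card B2)) =
          2 * b * (real n0 + 2 + ?z n) + 2 * b * (1 / 2) ^ m * real n + 2 * b * real (card B2)"
          by (simp add: algebra_simps)
        also have "2 * b * (1 / 2) ^ m * real n \<le> e * real n"
          using m0 b1 by (intro mult_right_mono) (auto simp: m_def field_simps)
        also have "2 * b * real (card B2) \<le> e * real n"
        proof -
          have "e * real (card B2) \<le> real (m + 2) * (2 * (\<Sum>s<n. fluct P g k (sh (int s) y)))"
            unfolding B2_def by (rule card_occ_average_large_le) (use fluct_nonneg e n in auto)
          also have "\<dots> \<le> real (m + 2) * (2 * (\<delta> * real n))"
            using k[of n] by (intro mult_left_mono) auto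
          finally have "2 * b * (e * real (card B2)) \<le> 2 * b * (real (m + 2) * (2 * (\<delta> * real n)))"
            using b1 by (intro mult_left_mono) auto
          also have "\<dots> = 2 * b * real (m + 2) * (2 * \<delta>) * real n" by (simp only: mult_ac)
          also have "\<dots> \<le> e * e * real n" using \<delta>(3) by (intro mult_right_mono) auto
          finally have "e * (2 * b * real (card B2)) \<le> e * (e * real n)" by (simp only: mult_ac)
          then show ?thesis using e by simp
        qed
        finally show ?thesis using b1 by (simp add: algebra_simps)
      qed
      have "(\<lambda>n. (2 * b * (real n0 + 2 + ?z n)) / real n) \<longlonglongrightarrow> 0" by real_asymp
      then have "\<forall>\<^sub>F n in sequentially. (2 * b * (real n0 + 2 + ?z n)) / real n < e"
        using e by (rule order_tendstoD(2))
      then have "\<forall>\<^sub>F n in sequentially. norm ((1 / real n) * ?E n - 0) < r"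
        using eventually_ge_at_top[of 1]
      proof eventually_elim
        case (elim n)
        have E0: "?E n \<ge> 0" by (intro sum_nonneg) (simp add: err_def)
        have "(1 / real n) * ?E n \<le> (1 / real n) * ((5 * e) * real n + 2 * b * (real n0 + 2 + ?z n))"
          using bound[OF elim(2)] by (intro mult_left_mono) auto
        also have "\<dots> = 5 * e + (2 * b * (real n0 + 2 + ?z n)) / real n"
          using elim(2) by (simp add: field_simps)
        also have "\<dots> < r" using elim(1) e unfolding e_def by simp
        finally have "(1 / real n) * ?E n < r" .
        moreover have "0 \<le> (1 / real n) * ?E n" using E0 by simp
        ultimately show ?case by simp
      qed
      then show "\<exists>no. \<forall>n\<ge>no. norm ((1 / real n) * ?E n - 0) < r" by (simp add: eventually_sequentially)
    qed
  qed
qed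

text \<open>With n fixed, all shifts of the window use the same length K_n, so one application of
  the covering bound suffices.\<close>

lemma prob_err_large_tendsto_0:
  assumes \<epsilon>: "\<epsilon> > 0"
  shows "(\<lambda>n. prob {y. err P g n y > \<epsilon>}) \<longlonglongrightarrow> 0"
proof (cases "CARD('x) = 1")
  case True
  show ?thesis
    by (intro tendsto_eventually eventually_mono[OF eventually_ge_at_top[of 1]])
       (use \<epsilon> in \<open>simp add: err_eq_0_of_card_1[OF True]\<close>)
next
  case False
  then have A2: "CARD('x) \<ge> 2" using zero_less_card_finite[where 'a = 'x] by linarith
  let ?K = "K_par CARD('x)"
  \<comment> \<open>Matches the error bound 2 e + D_k o T^n when the last term is at most e.\<close>
  define e where "e = \<epsilon> / 3"
  have e: "e > 0" using \<epsilon> by (simp add: e_def)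
  show ?thesis
  proof (rule LIMSEQ_I)
    fix r :: real assume r: "r > 0"
    \<comment> \<open>\<open>E3\<close> and \<open>E4\<close> will have probabilities at most
      \<delta> / e and 8 \<delta> / e, which sum to r / 3.\<close>
    define \<delta> where "\<delta> = e * r / 27"
    have \<delta>: "\<delta> > 0" using e r by (simp add: \<delta>_def)
    obtain k where k: "(\<integral>y. fluct P g k y \<partial>P) \<le> \<delta>" using fluct_integral_small[OF \<delta>] by blast
    let ?D = "fluct P g k"
    let ?z = "\<lambda>n. (real CARD('x) * real n powr 0.1) * (sqrt (real n) + 1)"
    have dev: "\<forall>\<^sub>F n in sequentially. prob (deviant P g e n) < r / 3"
      using summable_LIMSEQ_zero[OF summable_prob_deviant[OF e, of g]] r
      by (intro order_tendstoD(2)) auto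
    have z: "\<forall>\<^sub>F n in sequentially. 3 * ?z n / real n < r / 3"
    proof -
      have "(\<lambda>n. 3 * ?z n / real n) \<longlonglongrightarrow> 0" by real_asymp
      then show ?thesis using r by (intro order_tendstoD(2)) auto
    qed
    have Kn: "\<forall>\<^sub>F n in sequentially. real CARD('x) * real n powr 0.1 \<le> real n / 3" by real_asymp
    have "\<forall>\<^sub>F n in sequentially. norm (prob {y. err P g n y > \<epsilon>} - 0) < r"
      using dev z Kn K_par_tendsto[OF A2, of "Suc k"] eventually_ge_at_top[of 2]
    proof eventually_elim
      case (elim n)
      \<comment> \<open>The number of shifts must be proportional to n, so that n + N \<le> 4 N, and
        must leave room for K_n in the overlap of the windows.\<close>
      define N where "N = n div 2"
      have "n \<le> 3 * N" and N1: "N \<ge> 1" using elim(5) unfolding N_def by presburger+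
      then have "real n \<le> real (3 * N)" by (simp only: of_nat_le_iff)
      with N1 have N: "real n \<le> 3 * real N" "N \<ge> 1" by simp_all
      have A1: "1 \<le> CARD('x)" "1 \<le> n" using A2 elim(5) by auto
      have "real (?K n) \<le> real (CARD('x) ^ ?K n)" using K_par_le_pow[OF A1(1)] by (simp only: of_nat_le_iff)
      also have "\<dots> \<le> real CARD('x) * real n powr 0.1" by (rule card_pow_K_par_le[OF A1])
      also have "\<dots> \<le> real n / 3" by (rule elim(3))
      finally have NK: "N + ?K n \<le> n + 1" unfolding N_def by linarith
      define E2 where "E2 = {y :: int \<Rightarrow> 'x. card (occ y (?K n) n) < J_par n}"
      define E3 where "E3 = {y. ?D (sh (int n) y) > e}"
      define E4 where "E4 = {y. (\<Sum>s\<in>occ y (?K n) n. ?D (sh (int s) y)) > e * real (card (occ y (?K n) n))}"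
      have E2s: "E2 \<in> sets P"
        unfolding E2_def by (rule dep_sets[OF _ dep_comp[OF dep_occ]]) simp
      have D3s: "{y. ?D y > e} \<in> sets P"
      proof -
        have "{y \<in> space P. ?D y > e} \<in> sets P" by measurable
        then show ?thesis by simp
      qed
      have E3s: "E3 \<in> sets P" unfolding E3_def by (rule sets_sh[OF D3s])
      have E4s: "E4 \<in> sets P"
      proof -
        have occ_s [measurable]: "{y \<in> space P. s \<in> occ y (?K n) n} \<in> sets P" for s
          using dep_sets[OF _ dep_comp[OF dep_occ[of "?K n" n], where h = "\<lambda>S. s \<in> S"]] by simp
        \<comment> \<open>The index set is random; a sum over all s < n with membership conditions
          makes measurability visible.\<close>
        have "(\<Sum>s\<in>occ y (?K n) n. ?D (sh (int s) y)) =
           (\<Sum>s<n. if s \<in> occ y (?K n) n then ?D (sh (int s) y) else 0)" for y :: "int \<Rightarrow> 'x"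
          by (subst sum.inter_filter[symmetric]) (auto intro!: sum.cong simp: occ_def)
        moreover have "real (card (occ y (?K n) n)) = (\<Sum>s<n. if s \<in> occ y (?K n) n then 1 else 0)"
          for y :: "int \<Rightarrow> 'x"
          by (subst sum.inter_filter[symmetric]) (auto intro!: arg_cong[where f = card] simp: occ_def)
        moreover have "{y \<in> space P. (\<Sum>s<n. if s \<in> occ y (?K n) n then ?D (sh (int s) y) else 0) >
            e * (\<Sum>s<n. if s \<in> occ y (?K n) n then 1 else 0)} \<in> sets P"
          by measurable
        ultimately show ?thesis unfolding E4_def by simp
      qed
      have "{y. err P g n y > \<epsilon>} \<subseteq> deviant P g e n \<union> E2 \<union> E3 \<union> E4"
      proof (rule subsetI, rule ccontr)
        fix y assume y: "y \<in> {y. err P g n y > \<epsilon>}" and n: "y \<notin> deviant P g e n \<union> E2 \<union> E3 \<union> E4"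
        have "?K n \<le> kappa CARD('x) y n"
          using n K_par_pos by (intro kappa_ge) (auto simp: E2_def not_less)
        then have K: "kappa CARD('x) y n = ?K n" using kappa_le[of "CARD('x)" y n] by simp
        have "err P g n y \<le> 2 * e + ?D (sh (int n) y)"
          using n elim(4) by (intro err_le_fluct) (auto simp: K E4_def not_less)
        also have "\<dots> \<le> \<epsilon>" using n by (simp add: E3_def e_def not_less)
        finally show False using y by simp
      qed
      then have "prob {y. err P g n y > \<epsilon>} \<le> prob (deviant P g e n \<union> E2 \<union> E3 \<union> E4)"
        using deviant_sets E2s E3s E4s by (intro finite_measure_mono) auto
      also have "\<dots> \<le> prob (deviant P g e n \<union> E2 \<union> E3) + prob E4"
        using deviant_sets E2s E3s E4s by (intro measure_Un_le) auto
      also have "prob (deviant P g e n \<union> E2 \<union> E3) \<le> prob (deviant P g e n \<union> E2) + prob E3"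
        using deviant_sets E2s E3s by (intro measure_Un_le) auto
      also have "prob (deviant P g e n \<union> E2) \<le> prob (deviant P g e n) + prob E2"
        using deviant_sets E2s by (intro measure_Un_le) auto
      finally have tot: "prob {y. err P g n y > \<epsilon>} \<le> prob (deviant P g e n) + prob E2 + prob E3 + prob E4"
        by linarith
      have p2: "prob E2 < r / 3"
      proof -
        have "real N * prob E2 \<le> (\<integral>y. real (CARD('x) ^ ?K n * J_par n) \<partial>P)"
          unfolding E2_def
          by (rule prob_le_of_card_shifts[OF E2s[unfolded E2_def]])
             (auto simp only: of_nat_le_iff intro!: card_shifts_rare_le[OF NK] integrable_const)
        also have "\<dots> = real (CARD('x) ^ ?K n) * real (J_par n)" by simp
        also have "\<dots> \<le> ?z n"
          using card_pow_K_par_le[OF A1] J_par_le[of n] by (intro mult_mono) auto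
        finally have "real N * prob E2 \<le> ?z n" .
        moreover have "real n * prob E2 \<le> 3 * real N * prob E2" using N by (intro mult_right_mono) auto
        ultimately have "real n * prob E2 \<le> 3 * ?z n" by linarith
        then have "prob E2 \<le> 3 * ?z n / real n" using A1 by (simp add: field_simps)
        then show ?thesis using elim(2) by linarith
      qed
      have p3: "e * prob E3 \<le> \<delta>"
      proof -
        have "prob E3 = prob {y. ?D y > e}" unfolding E3_def by (rule prob_sh[OF D3s])
        also have "\<dots> \<le> prob {y \<in> space P. ?D y \<ge> e}"
        proof (rule finite_measure_mono)
          show "{y \<in> space P. ?D y \<ge> e} \<in> sets P" by measurable
        qed auto
        also have "\<dots> \<le> (\<integral>y. ?D y \<partial>P) / e"
          by (rule integral_Markov_inequality_measure[of _ _ "{}"])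
             (use e fluct_integrable fluct_nonneg in auto)
        finally show ?thesis using e k by (simp add: field_simps)
      qed
      have p4: "e * prob E4 \<le> 8 * \<delta>"
      proof -
        let ?F = "\<lambda>y. (2 / e) * (\<Sum>s<n + N. ?D (sh (int s) y))"
        have Dsh: "integrable P (\<lambda>y. ?D (sh (int s) y))" for s
          using integrable_distr[of "sh (int s)" P P ?D] fluct_integrable[of g k] by (simp add: distr_sh')
        have "real N * prob E4 \<le> (\<integral>y. ?F y \<partial>P)"
          unfolding E4_def
        proof (rule prob_le_of_card_shifts[OF E4s[unfolded E4_def]])
          show "integrable P ?F" by (intro integrable_mult_right Bochner_Integration.integrable_sum Dsh)
          fix y
          show "real (card {i. i < N \<and> (\<Sum>s\<in>occ (sh (int i) y) (?K n) n. ?D (sh (int s) (sh (int i) y))) >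
              e * real (card (occ (sh (int i) y) (?K n) n))}) \<le> ?F y"
            using card_shifts_average_large_le[where f = ?D and N = N and K = "?K n" and n = n and y = y,
                OF fluct_nonneg e] e
            by (simp add: pos_le_divide_eq mult.commute)
        qed
        also have "\<dots> = (2 / e) * (\<Sum>s<n + N. \<integral>y. ?D (sh (int s) y) \<partial>P)"
          by (simp only: integral_mult_right_zero Bochner_Integration.integral_sum[OF Dsh])
        also have "\<dots> = (2 / e) * (real (n + N) * (\<integral>y. ?D y \<partial>P))"
          by (simp add: integral_sh)
        also have "\<dots> \<le> (2 / e) * ((4 * real N) * \<delta>)"
          using k N e by (intro mult_left_mono mult_mono) (auto simp: fluct_nonneg intro!: integral_nonneg_AE)
        also have "\<dots> = real N * (8 * \<delta> / e)" by simp
        finally have "real N * prob E4 \<le> real N * (8 * \<delta> / e)" .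
        then have "prob E4 \<le> 8 * \<delta> / e" by (rule mult_left_le_imp_le) (use N in simp)
        then show ?thesis using e by (simp add: field_simps)
      qed
      have "e * (prob E3 + prob E4) \<le> e * (r / 3)" using p3 p4 by (simp add: \<delta>_def algebra_simps)
      then have "prob E3 + prob E4 \<le> r / 3" using e by simp
      then show ?case using tot p2 elim(1) by simp
    qed
    then show "\<exists>no. \<forall>n\<ge>no. norm (prob {y. err P g n y > \<epsilon>} - 0) < r"
      by (simp add: eventually_sequentially)
  qed
qed

end

section \<open>Transfer to the process\<close>

lemma dstar_le:
  assumes "\<And>i. i < k \<Longrightarrow> z i = y i"
  shows "dstar y z \<le> (1 / 2) ^ k"
proof -
  let ?f = "\<lambda>i. (1 / 2 :: real) ^ (i + 1) * (if y i \<noteq> z i then 1 else 0)"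
  have geo: "(\<lambda>i. (1 / 2 :: real) ^ (k + 1) * (1 / 2) ^ i) sums ((1 / 2) ^ (k + 1) * (1 / (1 - 1 / 2)))"
    by (intro sums_mult geometric_sums) simp
  have sum: "summable ?f"
    by (rule summable_comparison_test'[of "\<lambda>i. (1 / 2 :: real) ^ i" 0]) (auto simp: summable_geometric)
  have "dstar y z = (\<Sum>i. ?f (i + k)) + (\<Sum>i<k. ?f i)"
    unfolding dstar_def by (rule suminf_split_initial_segment[OF sum])
  also have "(\<Sum>i<k. ?f i) = 0" using assms by simp
  also have "(\<Sum>i. ?f (i + k)) \<le> (\<Sum>i. (1 / 2 :: real) ^ (k + 1) * (1 / 2) ^ i)"
    by (intro suminf_le summable_ignore_initial_segment[OF sum] sums_summable[OF geo])
       (simp add: power_add mult_ac)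
  also have "\<dots> = (1 / 2) ^ k" using sums_unique[OF geo] by simp
  finally show ?thesis by simp
qed

text \<open>The sequence space is compact as a product of finite discrete spaces, so finitely many
  sets \<open>U c\<close> cover it. Sequences agreeing beyond every radius \<open>K c\<close> lie in
  a common \<open>U c\<close>, hence both values are within e of that at the centre. The sum of the
  radii serves as an upper bound for each of them.\<close>

lemma sequence_space_uniformly_continuous:
  fixes G :: "(nat \<Rightarrow> 'x::finite) \<Rightarrow> real"
  assumes "\<And>y. \<exists>k. \<forall>z. (\<forall>i<k. z i = y i) \<longrightarrow> \<bar>G z - G y\<bar> < e"
  shows "\<exists>k. \<forall>y z. (\<forall>i<k. y i = z i) \<longrightarrow> \<bar>G y - G z\<bar> < 2 * e"
proof -
  let ?T = "product_topology (\<lambda>_. discrete_topology (UNIV :: 'x set)) (UNIV :: nat set)"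
  obtain K where K: "\<And>y z. \<forall>i<K y. z i = y i \<Longrightarrow> \<bar>G z - G y\<bar> < e"
    using assms by metis
  define U where "U = (\<lambda>y. {z. \<forall>i<K y. z i = y i})"
  have U_PiE: "U y = PiE UNIV (\<lambda>i. if i < K y then {y i} else UNIV)" for y
    by (auto simp: U_def PiE_iff split: if_splits)
  have "openin ?T (U y)" for y
    unfolding U_PiE
    by (rule product_topology_basis) (auto intro: finite_subset[of _ "{..<K y}"])
  moreover have "topspace ?T \<subseteq> \<Union>(range U)" by (auto simp: U_def)
  moreover have "compact_space ?T"
    by (simp add: compact_space_product_topology compact_space_discrete_topology)
  ultimately obtain F where F: "finite F" "F \<subseteq> range U" "topspace ?T \<subseteq> \<Union>F"
    unfolding compact_space_alt by (metis (no_types, lifting) imageE)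
  then obtain C where C: "finite C" "F = U ` C" using finite_subset_image by meson
  show ?thesis
  proof (intro exI allI impI)
    fix y z :: "nat \<Rightarrow> 'x"
    assume *: "\<forall>i<(\<Sum>c\<in>C. K c). y i = z i"
    have "y \<in> \<Union>F" using F(3) by auto
    then obtain c where c: "c \<in> C" "\<forall>i<K c. y i = c i" using C by (auto simp: U_def)
    have "K c \<le> (\<Sum>c\<in>C. K c)" using c C by (intro member_le_sum) auto
    then have "\<forall>i<K c. z i = c i" using * c by auto
    from K[OF c(2)] K[OF this] show "\<bar>G y - G z\<bar> < 2 * e" by linarith
  qed
qed

lemma dstar_uniformly_continuous:
  fixes G :: "(nat \<Rightarrow> 'x::finite) \<Rightarrow> real"
  assumes cont: "\<forall>y. \<forall>e>0. \<exists>d>0. \<forall>z. dstar y z < d \<longrightarrow> \<bar>G z - G y\<bar> < e" and e: "e > 0"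
  shows "\<exists>k. \<forall>y z. (\<forall>i<k. y i = z i) \<longrightarrow> \<bar>G y - G z\<bar> < e"
proof -
  have "\<exists>k. \<forall>z. (\<forall>i<k. z i = y i) \<longrightarrow> \<bar>G z - G y\<bar> < e / 2" for y
  proof -
    obtain d where d: "d > 0" "\<And>z. dstar y z < d \<Longrightarrow> \<bar>G z - G y\<bar> < e / 2"
      using cont e by (meson half_gt_zero)
    obtain k where "(1 / 2 :: real) ^ k < d" using real_arch_pow_inv[of d "1 / 2"] d by auto
    then show ?thesis using d(2) dstar_le by (meson order.strict_trans1)
  qed
  from sequence_space_uniformly_continuous[OF this] show ?thesis by simp
qed

lemma dep_measurable_sub:
  fixes X :: "int \<Rightarrow> 'a \<Rightarrow> 'x::finite"
  assumes "finite I" "dep I h" and X: "\<And>i. i \<in> I \<Longrightarrow> X i \<in> measurable F (count_space UNIV)"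
  shows "(\<lambda>\<omega>. h (\<lambda>i. X i \<omega>)) \<in> measurable F (count_space UNIV)"
proof -
  \<comment> \<open>Only the coordinates in \<open>I\<close> are measurable with respect to
    \<open>F\<close>; the others are frozen at a constant, to which \<open>h\<close> is
    insensitive.\<close>
  let ?Y = "\<lambda>\<omega> i. if i \<in> I then X i \<omega> else undefined"
  have "?Y \<in> measurable F path_space"
  proof (rule measurable_PiM_single')
    fix i
    show "(\<lambda>\<omega>. ?Y \<omega> i) \<in> measurable F (count_space UNIV)"
      using X[of i] by (cases "i \<in> I") auto
  qed auto
  from measurable_compose[OF this dep_measurable[OF assms(1,2)]]
  have "(\<lambda>\<omega>. h (?Y \<omega>)) \<in> measurable F (count_space UNIV)" .
  moreover have "h (?Y \<omega>) = h (\<lambda>i. X i \<omega>)" for \<omega> by (rule dep_eq[OF assms(2)]) simp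
  ultimately show ?thesis by simp
qed

text \<open>A finite \<open>I\<close> has only finitely many cylinders, so the null ones have a null
  union. These have to be avoided because \<open>cexp\<close> has the default value 0 there.\<close>

lemma (in path_measure) AE_prob_cyl_pos:
  assumes I: "finite I"
  shows "AE y in P. prob (cyl I y) > 0"
proof -
  let ?W = "{w \<in> PiE I (\<lambda>_. UNIV). prob (cyl I w) = 0}"
  have "finite ?W" using finite_PiE[OF I, of "\<lambda>_. UNIV :: 'x set"] by simp
  then have "(\<Union>w\<in>?W. cyl I w) \<in> null_sets P"
    using cyl_sets[OF I]
    by (intro null_sets_UN') (auto simp: null_sets_def emeasure_eq_measure intro: countable_finite)
  from AE_not_in[OF this] show ?thesis
  proof eventually_elim
    case (elim y)
    have eq: "cyl I (restrict y I) = cyl I y" by (rule cyl_cong) simp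
    have "y \<in> cyl I (restrict y I)" by (simp add: cyl_def)
    with elim have "restrict y I \<notin> ?W" by blast
    then have "prob (cyl I (restrict y I)) \<noteq> 0" by simp
    then show ?case unfolding eq by (simp add: zero_less_measure_iff)
  qed
qed

section \<open>The process and its law on path space\<close>

locale process = prob_space M for M :: "'a measure" +
  fixes X :: "int \<Rightarrow> 'a \<Rightarrow> 'x::finite" and P :: "(int \<Rightarrow> 'x) measure"
  assumes X_meas [measurable]: "\<And>i. X i \<in> measurable M (count_space UNIV)"
  and stat: "stationary_proc M X"
  and erg: "ergodic_proc M X"
  and P_def: "P = distr M path_space (\<lambda>\<omega> i. X i \<omega>)"
begin

lemma path_meas [measurable]: "(\<lambda>\<omega> i. X i \<omega>) \<in> measurable M path_space"
  by (rule measurable_PiM_single') (auto intro: X_meas)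

lemma ergodic_path_P: "ergodic_path P"
proof -
  interpret P: prob_space P unfolding P_def by (rule prob_space_distr) simp
  have sets: "sets P = sets path_space" by (simp add: P_def)
  show ?thesis
  proof unfold_locales
    show "sets P = sets path_space" by (rule sets)
    show "distr P path_space (sh m) = P" for m
    proof -
      have "distr P path_space (sh m) = distr M path_space (sh m \<circ> (\<lambda>\<omega> i. X i \<omega>))"
        unfolding P_def by (rule distr_distr) auto
      also have "sh m \<circ> (\<lambda>\<omega> i. X i \<omega>) = (\<lambda>\<omega> i. X (i + m) \<omega>)" by (auto simp: sh_def)
      also have "distr M path_space (\<lambda>\<omega> i. X (i + m) \<omega>) = P"
        using stat by (simp add: stationary_proc_def P_def)
      finally show ?thesis .
    qed
    fix B assume B: "B \<in> sets P" "sh 1 -` B = B"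
    have "measure P B = measure M {\<omega> \<in> space M. (\<lambda>i. X i \<omega>) \<in> B}"
      unfolding P_def using B sets by (subst measure_distr) (auto simp: vimage_def Int_def conj_commute)
    moreover have "(\<lambda>y i. y (i + 1)) -` B = B" using B(2) by (simp add: sh_def[abs_def])
    ultimately show "measure P B \<in> {0, 1}"
      using erg B(1) sets unfolding ergodic_proc_def by auto
  qed
qed

sublocale path: ergodic_path P by (rule ergodic_path_P)

lemma AE_path: "AE y in P. Q y \<Longrightarrow> AE \<omega> in M. Q (\<lambda>i. X i \<omega>)"
  unfolding P_def by (rule AE_distrD[OF path_meas])

lemma integral_path:
  fixes f :: "(int \<Rightarrow> 'x) \<Rightarrow> real"
  assumes "f \<in> borel_measurable P"
  shows "(\<integral>y. f y \<partial>P) = (\<integral>\<omega>. f (\<lambda>i. X i \<omega>) \<partial>M)"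
  using assms unfolding P_def by (intro integral_distr) auto

lemma dep_borel_sub:
  fixes h :: "(int \<Rightarrow> 'x) \<Rightarrow> real"
  assumes "finite I" "dep I h" "\<And>i. i \<in> I \<Longrightarrow> X i \<in> measurable F (count_space UNIV)"
  shows "(\<lambda>\<omega>. h (\<lambda>i. X i \<omega>)) \<in> borel_measurable F"
  using measurable_compose[OF dep_measurable_sub[OF assms], where g = "\<lambda>x. x" and L = borel] by simp

lemma dep_integrable_M:
  fixes h :: "(int \<Rightarrow> 'x) \<Rightarrow> real"
  assumes "finite I" "dep I h"
  shows "integrable M (\<lambda>\<omega>. h (\<lambda>i. X i \<omega>))"
  using path.dep_integrable[OF assms] unfolding P_def by (rule integrable_distr[OF path_meas])

lemma
  shows space_past_alg: "space (past_alg M X n) = space M"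
    and sets_past_alg: "sets (past_alg M X n) = sigma_sets (space M) {X i -` A \<inter> space M |i A. 0 \<le> i \<and> i \<le> int n}"
  unfolding past_alg_def by (auto intro!: space_measure_of sets_measure_of)

lemma
  shows space_inf_past_alg: "space (inf_past_alg M X) = space M"
    and sets_inf_past_alg: "sets (inf_past_alg M X) = sigma_sets (space M) {X i -` A \<inter> space M |i A. i \<le> 0}"
  unfolding inf_past_alg_def by (auto intro!: space_measure_of sets_measure_of)

lemma subalgebra_past_alg: "subalgebra M (past_alg M X n)"
  unfolding subalgebra_def space_past_alg sets_past_alg
  by (auto intro!: sets.sigma_sets_subset measurable_sets[OF X_meas])

lemma subalgebra_inf_past_alg: "subalgebra M (inf_past_alg M X)"
  unfolding subalgebra_def space_inf_past_alg sets_inf_past_alg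
  by (auto intro!: sets.sigma_sets_subset measurable_sets[OF X_meas])

lemma X_past_alg: "0 \<le> i \<Longrightarrow> i \<le> int n \<Longrightarrow> X i \<in> measurable (past_alg M X n) (count_space UNIV)"
  by (rule measurableI) (auto simp: space_past_alg sets_past_alg intro!: sigma_sets.Basic)

lemma X_inf_past_alg: "i \<le> 0 \<Longrightarrow> X i \<in> measurable (inf_past_alg M X) (count_space UNIV)"
  by (rule measurableI) (auto simp: space_inf_past_alg sets_inf_past_alg intro!: sigma_sets.Basic)

text \<open>Events described by the coordinates 0, ..., n are closed under complements and countable
  unions and include the generators. As the index range is finite, dependence alone makes
  \<open>Q\<close> measurable.\<close>

lemma past_alg_dep:
  assumes "A \<in> sets (past_alg M X n)"
  shows "\<exists>Q. dep {0..int n} Q \<and> A = {\<omega> \<in> space M. Q (\<lambda>i. X i \<omega>)}"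
  using assms unfolding sets_past_alg
proof (induction rule: sigma_sets.induct)
  case (Basic a)
  then obtain i A where "a = X i -` A \<inter> space M" "0 \<le> i" "i \<le> int n" by blast
  then show ?case by (intro exI[of _ "\<lambda>y. y i \<in> A"]) (auto intro!: dep_coord)
next
  case Empty
  show ?case by (intro exI[of _ "\<lambda>_. False"]) (simp add: dep_const)
next
  case (Compl a)
  then obtain Q where "dep {0..int n} Q" "a = {\<omega> \<in> space M. Q (\<lambda>i. X i \<omega>)}" by blast
  then show ?case by (intro exI[of _ "\<lambda>y. \<not> Q y"]) (auto intro: dep_comp)
next
  case (Union a)
  then obtain Q where Q: "\<And>j. dep {0..int n} (Q j)" "\<And>j. a j = {\<omega> \<in> space M. Q j (\<lambda>i. X i \<omega>)}"
    by metis
  have "dep {0..int n} (\<lambda>y. \<exists>j::nat. Q j y)" by (rule dep_fun[where h = Ex]) (rule Q)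
  then show ?case using Q(2) by (intro exI[of _ "\<lambda>y. \<exists>j. Q j y"]) auto
qed

text \<open>The characterisation of conditional expectation: C_n is measurable with respect to the
  past, and its integrals over past events are correct by the martingale difference property,
  carried over from path space.\<close>

lemma AE_cond_pred: "AE \<omega> in M. \<forall>n. cond_pred M X g n \<omega> = pred_at P g n (\<lambda>i. X i \<omega>)"
  unfolding AE_all_countable
proof
  fix n
  interpret finite_measure_subalgebra M "past_alg M X n"
    by unfold_locales (rule subalgebra_past_alg)
  have dg: "dep {int n + 1} (\<lambda>y. g (y (int n + 1)))" by (rule dep_coord) simp
  show "AE \<omega> in M. cond_pred M X g n \<omega> = pred_at P g n (\<lambda>i. X i \<omega>)"
    unfolding cond_pred_def
  proof (rule real_cond_exp_charact)
    show "integrable M (\<lambda>\<omega>. g (X (int n + 1) \<omega>))" by (rule dep_integrable_M[OF _ dg]) simp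
    show "integrable M (\<lambda>\<omega>. pred_at P g n (\<lambda>i. X i \<omega>))" by (rule dep_integrable_M[OF _ dep_pred_at]) simp
    show "(\<lambda>\<omega>. pred_at P g n (\<lambda>i. X i \<omega>)) \<in> borel_measurable (past_alg M X n)"
      by (rule dep_borel_sub[OF _ dep_pred_at]) (auto intro: X_past_alg)
    fix A assume "A \<in> sets (past_alg M X n)"
    then obtain Q where Q: "dep {0..int n} Q" "A = {\<omega> \<in> space M. Q (\<lambda>i. X i \<omega>)}"
      using past_alg_dep by blast
    define H :: "(int \<Rightarrow> 'x) \<Rightarrow> real" where "H = (\<lambda>y. of_bool (Q y))"
    have H: "dep {0..int n} H" unfolding H_def by (rule dep_comp[OF Q(1)])
    have ind: "indicator A \<omega> *\<^sub>R r = H (\<lambda>i. X i \<omega>) * r" if "\<omega> \<in> space M" for \<omega> and r :: real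
      using that by (simp add: Q(2) H_def indicator_def)
    let ?a = "\<lambda>y. H y * g (y (int n + 1))" and ?b = "\<lambda>y. H y * pred_at P g n y"
    have a: "dep {0..int n + 1} ?a"
      by (intro dep_comp2[of _ _ _ "\<lambda>a b. a * b"] dep_mono[OF H] dep_coord) auto
    have b: "dep {0..int n} ?b"
      by (intro dep_comp2[of _ _ _ "\<lambda>a b. a * b"] H dep_pred_at)
    have "0 = (\<integral>y. ?a y - ?b y \<partial>P)"
      using path.integral_incr_eq_0[OF H, of g] by (simp add: incr_def right_diff_distrib)
    also have "\<dots> = (\<integral>y. ?a y \<partial>P) - (\<integral>y. ?b y \<partial>P)"
      by (intro Bochner_Integration.integral_diff path.dep_integrable[OF _ a] path.dep_integrable[OF _ b]) auto
    finally have "(\<integral>y. ?a y \<partial>P) = (\<integral>y. ?b y \<partial>P)" by simp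
    then have "(\<integral>\<omega>. ?a (\<lambda>i. X i \<omega>) \<partial>M) = (\<integral>\<omega>. ?b (\<lambda>i. X i \<omega>) \<partial>M)"
      using integral_path[OF path.dep_borel[OF _ a]] integral_path[OF path.dep_borel[OF _ b]] by simp
    then show "(\<integral>\<omega>\<in>A. g (X (int n + 1) \<omega>) \<partial>M) = (\<integral>\<omega>\<in>A. pred_at P g n (\<lambda>i. X i \<omega>) \<partial>M)"
      unfolding set_lebesgue_integral_def
      by (subst (1 2) Bochner_Integration.integral_cong[OF refl ind])
  qed
qed

lemma AE_err: "AE \<omega> in M. \<forall>n. \<bar>g_est g (\<lambda>i. X i \<omega>) n - cond_pred M X g n \<omega>\<bar> = err P g n (\<lambda>i. X i \<omega>)"
  using AE_cond_pred[of g] by eventually_elim (simp add: err_def)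

text \<open>On a cylinder of positive probability the prediction from the finite past is the average
  of the infinite-past version over that cylinder, and there \<open>G\<close> varies by less than e
  / 2 once s \<ge> k. So all G_i with i \<ge> k, and G_k itself, lie within e / 2 of the same number
  \<open>\<psi> y\<close>.\<close>

lemma AE_fluct_le_of_continuous:
  assumes "G_continuous M X g" and e: "e > 0"
  shows "\<exists>k. AE y in P. fluct P g k y \<le> e"
proof -
  interpret sub: finite_measure_subalgebra M "inf_past_alg M X"
    by unfold_locales (rule subalgebra_inf_past_alg)
  let ?R = "real_cond_exp M (inf_past_alg M X) (\<lambda>\<omega>. g (X 1 \<omega>))"
  obtain G where G: "\<forall>y. \<forall>e>0. \<exists>d>0. \<forall>z. dstar y z < d \<longrightarrow> \<bar>G z - G y\<bar> < e"
    "AE \<omega> in M. G (\<lambda>i. X (- int i) \<omega>) = ?R \<omega>"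
    using assms(1) unfolding G_continuous_def by blast
  obtain k where k: "\<And>y z. \<forall>i<k. y i = z i \<Longrightarrow> \<bar>G y - G z\<bar> < e / 2"
    using dstar_uniformly_continuous[OF G(1), of "e / 2"] e by auto
  define \<psi> where "\<psi> = (\<lambda>y :: int \<Rightarrow> 'x. G (\<lambda>i. y (- int i)))"
  have g_int: "integrable M (\<lambda>\<omega>. g (X 1 \<omega>))"
    by (rule dep_integrable_M[of "{1}" "\<lambda>y. g (y 1)"]) (auto intro: dep_coord)
  have near: "\<bar>fwd P g s y - \<psi> y\<bar> \<le> e / 2" if s: "k \<le> s" and pos: "path.prob (cyl {- int s..0} y) > 0" for s y
  proof -
    let ?C = "cyl {- int s..0} y"
    define A where "A = {\<omega> \<in> space M. (\<lambda>i. X i \<omega>) \<in> ?C}"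
    have dC: "dep {- int s..0} (\<lambda>z. z \<in> ?C)" by (auto simp: dep_def cyl_def)
    have "(\<lambda>\<omega>. (\<lambda>i. X i \<omega>) \<in> ?C) \<in> measurable (inf_past_alg M X) (count_space UNIV)"
      by (rule dep_measurable_sub[OF _ dC]) (auto intro: X_inf_past_alg)
    then have A: "A \<in> sets (inf_past_alg M X)"
      unfolding A_def by (simp add: pred_def space_inf_past_alg)
    then have A': "A \<in> sets M" using subalgebra_inf_past_alg by (auto simp: subalgebra_def)
    have PC: "path.prob ?C = measure M A"
      unfolding A_def P_def using path.cyl_sets[of "{- int s..0}" y]
      by (subst measure_distr) (auto simp: path.sets_P vimage_def Int_def conj_commute)
    have dgC: "dep {- int s..1} (\<lambda>z. g (z 1) * indicator ?C z)"
      using dep_comp2[OF dep_coord[of 1 "{- int s..1}" g] dep_mono[OF dC], of "\<lambda>a b. a * of_bool b"]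
      by (simp add: indicator_def of_bool_def)
    have "(\<integral>z. g (z 1) * indicator ?C z \<partial>P) = (\<integral>\<omega>. g (X 1 \<omega>) * indicator ?C (\<lambda>i. X i \<omega>) \<partial>M)"
      by (rule integral_path[OF path.dep_borel[OF _ dgC]]) simp
    also have "\<dots> = (\<integral>\<omega>\<in>A. g (X 1 \<omega>) \<partial>M)"
      unfolding set_lebesgue_integral_def
      by (intro Bochner_Integration.integral_cong) (auto simp: A_def indicator_def)
    also have "\<dots> = (\<integral>\<omega>\<in>A. ?R \<omega> \<partial>M)" by (rule sub.real_cond_exp_intA[OF g_int A])
    finally have fwd: "fwd P g s y * measure M A = (\<integral>\<omega>. indicator A \<omega> * ?R \<omega> \<partial>M)"
      using pos by (simp add: fwd_def cexp_def PC set_lebesgue_integral_def)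
    have R_int: "integrable M (\<lambda>\<omega>. indicator A \<omega> * ?R \<omega>)"
      using integrable_mult_indicator[OF A' sub.real_cond_exp_int(1)[OF g_int]] by simp
    have c_int: "integrable M (\<lambda>\<omega>. c * indicator A \<omega>)" for c :: real
      using A' by (intro integrable_mult_right integrable_real_indicator) (auto simp: emeasure_eq_measure)
    \<comment> \<open>The conditional expectation is compared with the constant
      \<open>\<psi> y\<close>, so \<open>G\<close> enters only pointwise, through the almost sure
      identity, and never under an integral.\<close>
    have "\<bar>(fwd P g s y - \<psi> y) * measure M A\<bar> = \<bar>\<integral>\<omega>. indicator A \<omega> * ?R \<omega> - \<psi> y * indicator A \<omega> \<partial>M\<bar>"
      using A' by (subst Bochner_Integration.integral_diff[OF R_int c_int]) (simp add: fwd left_diff_distrib)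
    also have "\<dots> \<le> (\<integral>\<omega>. \<bar>indicator A \<omega> * ?R \<omega> - \<psi> y * indicator A \<omega>\<bar> \<partial>M)"
      by (rule integral_abs_bound)
    also have "\<dots> \<le> (\<integral>\<omega>. (e / 2) * indicator A \<omega> \<partial>M)"
    proof (rule integral_mono_AE)
      show "integrable M (\<lambda>\<omega>. \<bar>indicator A \<omega> * ?R \<omega> - \<psi> y * indicator A \<omega>\<bar>)"
        by (intro integrable_abs Bochner_Integration.integrable_diff R_int c_int)
      show "AE \<omega> in M. \<bar>indicator A \<omega> * ?R \<omega> - \<psi> y * indicator A \<omega>\<bar> \<le> (e / 2) * indicator A \<omega>"
        using G(2)
      proof eventually_elim
        case (elim \<omega>)
        show ?case
        proof (cases "\<omega> \<in> A")
          case True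
          have "\<forall>i<k. X (- int i) \<omega> = y (- int i)"
            using True s by (auto simp: A_def cyl_def)
          from k[OF this] have "\<bar>?R \<omega> - \<psi> y\<bar> < e / 2" by (simp add: \<psi>_def elim[symmetric])
          then show ?thesis using True by simp
        qed simp
      qed
    qed (rule c_int)
    also have "\<dots> = (e / 2) * measure M A" using A' by simp
    finally have "\<bar>fwd P g s y - \<psi> y\<bar> * measure M A \<le> (e / 2) * measure M A"
      by (simp add: abs_mult)
    then show ?thesis using pos by (simp add: PC)
  qed
  have "AE y in P. \<forall>s. path.prob (cyl {- int s..0} y) > 0"
    unfolding AE_all_countable by (intro allI path.AE_prob_cyl_pos) simp
  then have "AE y in P. fluct P g k y \<le> e"
  proof eventually_elim
    case (elim y)
    have "\<bar>fwd P g i y - fwd P g k y\<bar> \<le> e" if "k \<le> i" for i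
      using near[OF that elim[rule_format]] near[OF order_refl elim[rule_format]] by linarith
    then show ?case unfolding fluct_def by (intro cSUP_least) auto
  qed
  then show ?thesis by blast
qed

lemma AE_tendsto_of_continuous:
  assumes "G_continuous M X g"
  shows "AE \<omega> in M. (\<lambda>n. \<bar>g_est g (\<lambda>i. X i \<omega>) n - cond_pred M X g n \<omega>\<bar>) \<longlonglongrightarrow> 0"
proof -
  have "AE y in P. (\<lambda>n. err P g n y) \<longlonglongrightarrow> 0"
    by (rule path.AE_err_tendsto_0) (rule AE_fluct_le_of_continuous[OF assms])
  from AE_path[OF this] AE_err[of g] show ?thesis by eventually_elim simp
qed

lemma AE_average_tendsto:
  "AE \<omega> in M. (\<lambda>n. (1 / real n) * (\<Sum>i<n. \<bar>g_est g (\<lambda>i. X i \<omega>) i - cond_pred M X g i \<omega>\<bar>)) \<longlonglongrightarrow> 0"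
  using AE_path[OF path.AE_average_err_tendsto_0[of g]] AE_err[of g]
  by eventually_elim simp

lemma prob_tendsto:
  assumes "\<epsilon> > 0"
  shows "(\<lambda>n. measure M {\<omega> \<in> space M. \<bar>g_est g (\<lambda>i. X i \<omega>) n - cond_pred M X g n \<omega>\<bar> > \<epsilon>}) \<longlonglongrightarrow> 0"
proof -
  have "measure M {\<omega> \<in> space M. \<bar>g_est g (\<lambda>i. X i \<omega>) n - cond_pred M X g n \<omega>\<bar> > \<epsilon>} =
      measure P {y. err P g n y > \<epsilon>}" for n
  proof -
    interpret sub: finite_measure_subalgebra M "past_alg M X n"
      by unfold_locales (rule subalgebra_past_alg)
    have E: "{y. err P g n y > \<epsilon>} \<in> sets P"
      by (rule path.dep_sets[OF _ dep_comp[OF path.dep_err]]) simp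
    have [measurable]: "cond_pred M X g n \<in> borel_measurable M"
      unfolding cond_pred_def by simp
    have "dep {- int (n + K_par CARD('x) n)..int n} (\<lambda>y. g_est g y n)"
      by (rule path.dep_g_est)
    then have [measurable]: "(\<lambda>\<omega>. g_est g (\<lambda>i. X i \<omega>) n) \<in> borel_measurable M"
      by (rule dep_borel_sub[rotated]) auto
    have "measure M {\<omega> \<in> space M. \<bar>g_est g (\<lambda>i. X i \<omega>) n - cond_pred M X g n \<omega>\<bar> > \<epsilon>} =
        measure M {\<omega> \<in> space M. err P g n (\<lambda>i. X i \<omega>) > \<epsilon>}"
    proof (rule measure_eq_AE)
      show "AE \<omega> in M. (\<omega> \<in> {\<omega> \<in> space M. \<bar>g_est g (\<lambda>i. X i \<omega>) n - cond_pred M X g n \<omega>\<bar> > \<epsilon>}) =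
          (\<omega> \<in> {\<omega> \<in> space M. err P g n (\<lambda>i. X i \<omega>) > \<epsilon>})"
        using AE_err[of g] by eventually_elim simp
      show "{\<omega> \<in> space M. \<bar>g_est g (\<lambda>i. X i \<omega>) n - cond_pred M X g n \<omega>\<bar> > \<epsilon>} \<in> sets M" by measurable
      show "{\<omega> \<in> space M. err P g n (\<lambda>i. X i \<omega>) > \<epsilon>} \<in> sets M"
        using measurable_sets[OF path_meas, of "{y. err P g n y > \<epsilon>}"] E path.sets_P
        by (simp add: vimage_def Int_def conj_commute)
    qed
    also have "\<dots> = measure P {y. err P g n y > \<epsilon>}"
      using E path.sets_P unfolding P_def
      by (subst measure_distr) (auto simp: vimage_def Int_def conj_commute)
    finally show ?thesis .
  qed
  then show ?thesis using path.prob_err_large_tendsto_0[OF assms, of g] by simp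
qed

end

theorem mainTheorem1:
  fixes M :: "'a measure" and X :: "int \<Rightarrow> 'a \<Rightarrow> 'x::finite" and g :: "'x \<Rightarrow> real"
  assumes "prob_space M"
    and "\<And>i. X i \<in> measurable M (count_space UNIV)"
    and "stationary_proc M X"
    and "ergodic_proc M X"
  shows "(G_continuous M X g \<longrightarrow>
            (AE \<omega> in M. (\<lambda>n. \<bar>g_est g (\<lambda>i. X i \<omega>) n - cond_pred M X g n \<omega>\<bar>) \<longlonglongrightarrow> 0))
       \<and> (AE \<omega> in M. (\<lambda>n. (1 / real n) * (\<Sum>i<n. \<bar>g_est g (\<lambda>i. X i \<omega>) i - cond_pred M X g i \<omega>\<bar>))
                        \<longlonglongrightarrow> 0)
       \<and> (\<forall>\<epsilon>>0. (\<lambda>n. measure M {\<omega> \<in> space M. \<bar>g_est g (\<lambda>i. X i \<omega>) n - cond_pred M X g n \<omega>\<bar> > \<epsilon>})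
                        \<longlonglongrightarrow> 0)"
proof -
  interpret process M X "distr M path_space (\<lambda>\<omega> i. X i \<omega>)"
    using assms by (auto intro!: process.intro process_axioms.intro)
  show ?thesis
    using AE_tendsto_of_continuous AE_average_tendsto prob_tendsto by blast
qed

end
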